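(* Let $C\ge \max\Big\{2\sqrt{\tfrac{C(M)}{c(M)}+8},\ \sqrt{\tfrac{2C(M)}{c(M)}}+1\Big\}$, let $c\ge 2(C+1)$ be a sufficiently large constant (allowed to depend on $M$), let $$\kappa(M)=\min\Big\{\frac{c(M)^2C^2}{32\,C'(M)},\ \frac{|C(M)-c(M)(C-1)^2|}{4}\Big\},$$ and let $$\epsilon^*=\sup\{\epsilon>0:\ \epsilon^2\kappa(M)\le \log N^{\mathrm{loc}}(\epsilon,c)\}.$$ Then the minimax rate for estimating $\theta_0\in K$ in squared $\ell_2$ error is $$\mathcal R_n(f,K)\asymp_M \epsilon^{*2}\wedge \operatorname{diam}(K)^2,$$ where $\asymp_M$ means two-sided inequalities up to positive constants depending only on $M$. Moreover, this minimax rate is achieved by the tree-based algorithm described in the context.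
   Context: Model. Fix an exponential family of densities $f(y;\theta)=h(y)\exp\{\theta T(y)-A(\theta)\}$ with natural parameter domain $\mathcal D=\{\theta\in\mathbb R:\int h(y)e^{\theta T(y)}dy<\infty\}$ (the domain of $A$). Assume $\mathcal D$ is open, $A$ is twice continuously differentiable, and $\operatorname{Var}_\theta(T(Y))>0$ for all $\theta\in\mathcal D$. Let $M>0$ be a known constant with $[-2M,2M]\subset\mathcal D$. Let $K\subset[-M,M]^n$ be star-shaped: there is $x_0\in K$ with $(1-t)x_0+tx\in K$ for all $x\in K$, $t\in[0,1]$. One observes independent $Y_1,\dots,Y_n$ with $Y_i\sim f(\cdot;\theta_{0,i})$, where $\theta_0\in K$ is unknown. The minimax risk is $\mathcal R_n(f,K)=\inf_{\hat\theta}\sup_{\theta_0\in K}\mathbb E\|\hat\theta(Y)-\theta_0\|_2^2$, the infimum being over all measurable functions of $Y=(Y_1,\dots,Y_n)$. Constants. $c(M)=\min_{|\theta|\le M}A''(\theta)$, $C(M)=\max_{|\theta|\le M}A''(\theta)$, $C'(M)=\max_{|\theta|\le 2M}A''(\theta)$. "Depending only on $M$" means depending only on $M$ and on the exponential family through $A$ (not on $n$ or $K$). $a\wedge b=\min(a,b)$; $\log$ is the natural logarithm; the supremum of the empty set in the definition of $\epsilon^*$ is $0$. Local entropy. $N(\delta,S)$ is the minimal cardinality of a $\delta$-covering of $S$ (points of $S$ such that every point of $S$ is within Euclidean distance $\delta$ of one of them). $B_2(\theta,r)$ is the closed Euclidean ball. $N^{\mathrm{loc}}(\epsilon,c)=\sup_{\theta\in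 K}N(\epsilon/c,B_2(\theta,\epsilon)\cap K)$. A $\delta$-packing of $S$ is a set of points of $S$ with pairwise distances $>\delta$; it is maximal if no point can be added. Pruned tree. Put $d=\operatorname{diam}(K)$. Level 1 is an arbitrary root $\Upsilon_1\in K$. Level 2 is a maximal $d/c$-packing of $B_2(\Upsilon_1,d)\cap K=K$, with an edge from $\Upsilon_1$ to each packing point. For $k\ge3$, given (pruned) level $k-1$: for each node $u$ of level $k-1$ take a maximal $d/(2^{k-1}c)$-packing of $B_2(u,d/2^{k-2})\cap K$, with an edge from $u$ to each point of its packing; list all these points lexicographically as $\mathcal U_k$. While $\mathcal U_k\ne\varnothing$: take its first element $\tilde u$, let $\mathcal T_k(\tilde u)$ be the other elements of $\mathcal U_k$ within distance $d/(2^{k-1}c)$ of $\tilde u$; for each $u'\in\mathcal T_k(\tilde u)$ with parent $v$, replace the edge $v\to u'$ by $v\to\tilde u$; then remove $\{\tilde u\}\cup\mathcal T_k(\tilde u)$ from $\mathcal U_k$. The resulting offspring of level $k-1$ form level $k$. $\mathcal O(u)$ denotes the set of offspring of $u$ in the pruned tree. Algorithm. For two points write $\theta^\beta\succ\theta^\alpha$ if $\sum_{i=1}^n[(\theta_i^\alpha-\theta_i^\beta)T(Y_i)+A(\theta_i^\beta)-A(\theta_i^\alpha)]\le0$. For $\delta>0$, a finite set $S$ and $\theta^\alpha\in S$ let $H(\delta,\theta^\alpha,S)=\max\{\|\theta^\alpha-\theta^\beta\|_2:\theta^\beta\in S,\ \theta^\beta\succ\theta^\alpha,\ \|\theta^\alpha-\theta^\beta\|_2\ge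 C\delta\}$, with $\max\varnothing=0$. Starting from the root $\Upsilon_1$, iteration $k\ge1$ sets $\Upsilon_{k+1}=\arg\min_{\theta\in\mathcal O(\Upsilon_k)}H\big(\tfrac{d}{2^k(C+1)},\theta,\mathcal O(\Upsilon_k)\big)$, ties broken by picking the lexicographically smallest point. Put $\epsilon_J=\frac{d}{2^{J-1}(C+1)}$ and let $J^*$ be the maximal $J\ge1$ with $\kappa(M)\epsilon_J^2>\max\{2\log([N^{\mathrm{loc}}(c\epsilon_J,2c)]^2),\log2\}$ ($J^*=1$ if there is none). The estimator produced by the algorithm is its output after at least $J^*$ iterations; "achieves the rate" means that its worst-case risk $\sup_{\theta_0\in K}\mathbb E\|\cdot-\theta_0\|_2^2$ is $\lesssim_M\epsilon^{*2}\wedge d^2$. *)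

theory Defs
  imports "HOL-Probability.Probability" "HOL-Library.Fun_Lexorder"
begin

definition expfam_density :: "(real \<Rightarrow> real) \<Rightarrow> (real \<Rightarrow> real) \<Rightarrow> (real \<Rightarrow> real) \<Rightarrow> real \<Rightarrow> real \<Rightarrow> real"
  where "expfam_density h T A \<theta> y = h y * exp (\<theta> * T y - A \<theta>)"

definition expfam_law :: "(real \<Rightarrow> real) \<Rightarrow> (real \<Rightarrow> real) \<Rightarrow> (real \<Rightarrow> real) \<Rightarrow> real \<Rightarrow> real measure"
  where "expfam_law h T A \<theta> = density lborel (\<lambda>y. ennreal (expfam_density h T A \<theta> y))"

text \<open>
  The pair \<open>(h, T)\<close> generates an exponential family with natural parameter domain \<open>D\<close>.
  The normalisation to total mass one determines the log-partition function \<open>A\<close> on \<open>D\<close>;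
  values of \<open>A\<close> outside \<open>D\<close> are irrelevant.
\<close>

definition expfam :: "(real \<Rightarrow> real) \<Rightarrow> (real \<Rightarrow> real) \<Rightarrow> (real \<Rightarrow> real) \<Rightarrow> real set \<Rightarrow> bool"
  where "expfam h T A D \<longleftrightarrow>
    h \<in> borel_measurable borel \<and> T \<in> borel_measurable borel \<and> (\<forall>y. 0 \<le> h y) \<and>
    D = {\<theta>. (\<integral>\<^sup>+ y. ennreal (h y * exp (\<theta> * T y)) \<partial>lborel) < \<infinity>} \<and>
    (\<forall>\<theta>\<in>D. (\<integral>\<^sup>+ y. ennreal (expfam_density h T A \<theta> y) \<partial>lborel) = 1) \<and>
    (\<forall>\<theta>\<in>D. 0 < prob_space.variance (expfam_law h T A \<theta>) T)"

definition twice_cont_diff_on :: "(real \<Rightarrow> real) \<Rightarrow> real set \<Rightarrow> bool"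
  where "twice_cont_diff_on A D \<longleftrightarrow>
    A differentiable_on D \<and> deriv A differentiable_on D \<and> continuous_on D (deriv (deriv A))"

text \<open>The extrema below are attained, since \<open>A''\<close> is continuous on the compact intervals.\<close>

definition curv_min :: "(real \<Rightarrow> real) \<Rightarrow> real \<Rightarrow> real"
  where "curv_min A M = (INF \<theta>\<in>{-M..M}. deriv (deriv A) \<theta>)"

definition curv_max :: "(real \<Rightarrow> real) \<Rightarrow> real \<Rightarrow> real"
  where "curv_max A M = (SUP \<theta>\<in>{-M..M}. deriv (deriv A) \<theta>)"

definition kappa :: "(real \<Rightarrow> real) \<Rightarrow> real \<Rightarrow> real \<Rightarrow> real"
  where "kappa A M C =
    min ((curv_min A M)\<^sup>2 * C\<^sup>2 / (32 * curv_max A (2 * M)))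
        (\<bar>curv_max A M - curv_min A M * (C - 1)\<^sup>2\<bar> / 4)"

text \<open>
  The dimension \<open>n\<close> has to be a bound variable, because the constants of the theorem are
  uniform in it.  A point of \<open>n\<close>-dimensional space is therefore a function that is
  \<^const>\<open>extensional\<close> on \<open>{..<n}\<close>, as for the elements of a product measure \<^const>\<open>PiM\<close>.
\<close>

type_synonym point = "nat \<Rightarrow> real"

definition edist2 :: "nat \<Rightarrow> point \<Rightarrow> point \<Rightarrow> real"
  where "edist2 n x y = L2_set (\<lambda>i. x i - y i) {..<n}"

definition ball2 :: "nat \<Rightarrow> point \<Rightarrow> real \<Rightarrow> point set"
  where "ball2 n x r = {y \<in> {..<n} \<rightarrow>\<^sub>E UNIV. edist2 n x y \<le> r}"

definition diam2 :: "nat \<Rightarrow> point set \<Rightarrow> real"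
  where "diam2 n K = (SUP (x, y)\<in>K \<times> K. edist2 n x y)"

definition star_shaped :: "nat \<Rightarrow> point set \<Rightarrow> bool"
  where "star_shaped n K \<longleftrightarrow>
    (\<exists>x0\<in>K. \<forall>x\<in>K. \<forall>t\<in>{0..1}. (\<lambda>i\<in>{..<n}. (1 - t) * x0 i + t * x i) \<in> K)"

definition covering :: "nat \<Rightarrow> real \<Rightarrow> point set \<Rightarrow> point set \<Rightarrow> bool"
  where "covering n \<delta> S F \<longleftrightarrow> F \<subseteq> S \<and> (\<forall>x\<in>S. \<exists>p\<in>F. edist2 n x p \<le> \<delta>)"

definition covering_number :: "nat \<Rightarrow> real \<Rightarrow> point set \<Rightarrow> nat"
  where "covering_number n \<delta> S = (LEAST m. \<exists>F. finite F \<and> card F = m \<and> covering n \<delta> S F)"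

definition packing :: "nat \<Rightarrow> real \<Rightarrow> point set \<Rightarrow> point set \<Rightarrow> bool"
  where "packing n \<delta> S P \<longleftrightarrow> P \<subseteq> S \<and> (\<forall>x\<in>P. \<forall>y\<in>P. x \<noteq> y \<longrightarrow> edist2 n x y > \<delta>)"

definition maximal_packing :: "nat \<Rightarrow> real \<Rightarrow> point set \<Rightarrow> point set \<Rightarrow> bool"
  where "maximal_packing n \<delta> S P \<longleftrightarrow>
    packing n \<delta> S P \<and> (\<forall>x\<in>S - P. \<not> packing n \<delta> S (insert x P))"

text \<open>For bounded \<open>K\<close> and \<open>\<epsilon>, c > 0\<close> the supremum is over a bounded set of naturals.\<close>

definition N_loc :: "nat \<Rightarrow> point set \<Rightarrow> real \<Rightarrow> real \<Rightarrow> real"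
  where "N_loc n K \<epsilon> c = (SUP \<theta>\<in>K. real (covering_number n (\<epsilon> / c) (ball2 n \<theta> \<epsilon> \<inter> K)))"

definition eps_star :: "nat \<Rightarrow> point set \<Rightarrow> real \<Rightarrow> real \<Rightarrow> real"
  where "eps_star n K c \<kappa> =
    (let S = {\<epsilon>. \<epsilon> > 0 \<and> \<epsilon>\<^sup>2 * \<kappa> \<le> ln (N_loc n K \<epsilon> c)} in if S = {} then 0 else Sup S)"

definition sample_law ::
    "nat \<Rightarrow> (real \<Rightarrow> real) \<Rightarrow> (real \<Rightarrow> real) \<Rightarrow> (real \<Rightarrow> real) \<Rightarrow> point \<Rightarrow> (nat \<Rightarrow> real) measure"
  where "sample_law n h T A \<theta> = PiM {..<n} (\<lambda>i. expfam_law h T A (\<theta> i))"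

definition estimators :: "nat \<Rightarrow> ((nat \<Rightarrow> real) \<Rightarrow> point) set"
  where "estimators n = PiM {..<n} (\<lambda>_. borel) \<rightarrow>\<^sub>M PiM {..<n} (\<lambda>_. borel)"

definition worst_risk ::
    "nat \<Rightarrow> (real \<Rightarrow> real) \<Rightarrow> (real \<Rightarrow> real) \<Rightarrow> (real \<Rightarrow> real) \<Rightarrow> point set
      \<Rightarrow> ((nat \<Rightarrow> real) \<Rightarrow> point) \<Rightarrow> ennreal"
  where "worst_risk n h T A K est =
    (SUP \<theta>\<in>K. \<integral>\<^sup>+ y. ennreal ((edist2 n (est y) \<theta>)\<^sup>2) \<partial>sample_law n h T A \<theta>)"

definition minimax_risk ::
    "nat \<Rightarrow> (real \<Rightarrow> real) \<Rightarrow> (real \<Rightarrow> real) \<Rightarrow> (real \<Rightarrow> real) \<Rightarrow> point set \<Rightarrow> ennreal"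
  where "minimax_risk n h T A K = (INF est\<in>estimators n. worst_risk n h T A K est)"

text \<open>
  Points are compared lexicographically by \<^const>\<open>less_fun\<close>, which looks at the first
  coordinate in which they differ.
\<close>

definition lex_first :: "point set \<Rightarrow> point"
  where "lex_first S = (THE u. u \<in> S \<and> (\<forall>v\<in>S. v \<noteq> u \<longrightarrow> less_fun u v))"

text \<open>
  \<open>prune n \<delta> U E\<close>: the pruning loop, started on the list of candidate nodes, ends with the
  edge set \<open>E\<close>.  An element of \<open>U\<close> is an edge \<open>(v, u')\<close> from a parent to a candidate that
  is still to be processed.  A point offered by several parents occurs in several edges;
  these copies lie at distance 0 from each other and are merged in the same step.
\<close>

inductive prune :: "nat \<Rightarrow> real \<Rightarrow> (point \<times> point) set \<Rightarrow> (point \<times> point) set \<Rightarrow> bool"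
  for n \<delta>
  where
    empty: "prune n \<delta> {} {}"
  | step: "\<lbrakk>U \<noteq> {}; u = lex_first (snd ` U);
            near = {(v, u') \<in> U. edist2 n u u' \<le> \<delta>};
            prune n \<delta> (U - near) E\<rbrakk>
           \<Longrightarrow> prune n \<delta> U ((\<lambda>(v, u'). (v, u)) ` near \<union> E)"

text \<open>
  A tree is given by its root \<open>r\<close> and, for every \<open>k \<ge> 1\<close>, the set \<open>E k\<close> of edges from
  level \<open>k\<close> to level \<open>k + 1\<close>.  Edges are indexed by level because the same point may be a
  node of several levels, with different offspring.
\<close>

definition level :: "point \<Rightarrow> (nat \<Rightarrow> (point \<times> point) set) \<Rightarrow> nat \<Rightarrow> point set"
  where "level r E k = (if k = 1 then {r} else snd ` E (k - 1))"

definition offspring :: "(nat \<Rightarrow> (point \<times> point) set) \<Rightarrow> nat \<Rightarrow> point \<Rightarrow> point set"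
  where "offspring E k u = {w. (u, w) \<in> E k}"

definition pruned_tree ::
    "nat \<Rightarrow> point set \<Rightarrow> real \<Rightarrow> point \<Rightarrow> (nat \<Rightarrow> (point \<times> point) set) \<Rightarrow> bool"
  where "pruned_tree n K c r E \<longleftrightarrow>
    (let d = diam2 n K in
      r \<in> K \<and>
      (\<exists>P. maximal_packing n (d / c) (ball2 n r d \<inter> K) P \<and> E 1 = {r} \<times> P) \<and>
      (\<forall>k\<ge>3. \<exists>P.
        (\<forall>u\<in>level r E (k - 1).
           maximal_packing n (d / (2 ^ (k - 1) * c)) (ball2 n u (d / 2 ^ (k - 2)) \<inter> K) (P u)) \<and>
        prune n (d / (2 ^ (k - 1) * c)) (SIGMA u:level r E (k - 1). P u) (E (k - 1))))"

text \<open>\<open>beats n T A y b a\<close> is the relation \<open>\<theta>\<^sup>b \<succ> \<theta>\<^sup>a\<close> for the data \<open>y\<close>.\<close>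

definition beats ::
    "nat \<Rightarrow> (real \<Rightarrow> real) \<Rightarrow> (real \<Rightarrow> real) \<Rightarrow> (nat \<Rightarrow> real) \<Rightarrow> point \<Rightarrow> point \<Rightarrow> bool"
  where "beats n T A y b a \<longleftrightarrow> (\<Sum>i<n. (a i - b i) * T (y i) + A (b i) - A (a i)) \<le> 0"

definition H_crit ::
    "nat \<Rightarrow> (real \<Rightarrow> real) \<Rightarrow> (real \<Rightarrow> real) \<Rightarrow> real \<Rightarrow> (nat \<Rightarrow> real)
      \<Rightarrow> real \<Rightarrow> point \<Rightarrow> point set \<Rightarrow> real"
  where "H_crit n T A C y \<delta> a S =
    (let R = {edist2 n a b | b. b \<in> S \<and> beats n T A y b a \<and> edist2 n a b \<ge> C * \<delta>}
     in if R = {} then 0 else Max R)"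

definition lex_argmin :: "(point \<Rightarrow> real) \<Rightarrow> point set \<Rightarrow> point"
  where "lex_argmin g S = lex_first {a \<in> S. \<forall>b\<in>S. g a \<le> g b}"

text \<open>The output after \<open>k\<close> iterations, i.e. the node \<open>\<Upsilon>\<close> of level \<open>k + 1\<close>.\<close>

fun tree_output ::
    "nat \<Rightarrow> (real \<Rightarrow> real) \<Rightarrow> (real \<Rightarrow> real) \<Rightarrow> point set \<Rightarrow> real
      \<Rightarrow> point \<Rightarrow> (nat \<Rightarrow> (point \<times> point) set) \<Rightarrow> nat \<Rightarrow> (nat \<Rightarrow> real) \<Rightarrow> point"
  where
    "tree_output n T A K C r E 0 y = r"
  | "tree_output n T A K C r E (Suc k) y =
      (let S = offspring E (Suc k) (tree_output n T A K C r E k y)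
       in lex_argmin (\<lambda>a. H_crit n T A C y (diam2 n K / (2 ^ Suc k * (C + 1))) a S) S)"

definition eps_level :: "nat \<Rightarrow> point set \<Rightarrow> real \<Rightarrow> nat \<Rightarrow> real"
  where "eps_level n K C J = diam2 n K / (2 ^ (J - 1) * (C + 1))"

definition J_good :: "nat \<Rightarrow> point set \<Rightarrow> real \<Rightarrow> real \<Rightarrow> real \<Rightarrow> nat \<Rightarrow> bool"
  where "J_good n K C c \<kappa> J \<longleftrightarrow> J \<ge> 1 \<and>
    \<kappa> * (eps_level n K C J)\<^sup>2
      > max (2 * ln ((N_loc n K (c * eps_level n K C J) (2 * c))\<^sup>2)) (ln 2)"

definition J_star :: "nat \<Rightarrow> point set \<Rightarrow> real \<Rightarrow> real \<Rightarrow> real \<Rightarrow> nat"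
  where "J_star n K C c \<kappa> =
    (if \<exists>J. J_good n K C c \<kappa> J then (GREATEST J. J_good n K C c \<kappa> J) else 1)"

end

theory Submission
  imports Defs
begin

text \<open>
The statement compares the minimax risk with \<open>\<epsilon>\<^sup>*\<close>, the largest radius \<open>\<epsilon>\<close> at which the local
entropy \<open>ln (N_loc n K \<epsilon> c)\<close> still exceeds \<open>\<kappa> \<epsilon>\<^sup>2\<close>.  Two facts make this radius critical.

\<^item> On the parameter cube the log-partition function \<open>A\<close> has curvature between two positive
  constants, so likelihood ratios between two parameters behave like Gaussian ones: their
  logarithm is of the order of the squared Euclidean distance.  Positivity of the curvature is
  \<open>A2_pos\<close>.  The two consequences that are used are \<open>test_error\<close> (a likelihood comparison picks
  the wrong one of two parameters with probability at most \<open>exp (- \<kappa> \<delta>\<^sup>2)\<close>) and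
  \<open>change_of_measure_inequality\<close> (the probability of an event grows at most by a factor \<open>t\<close> when
  the parameter moves, up to an error \<open>exp (const \<cdot> distance\<^sup>2) / sqrt t\<close>).

\<^item> In a star-shaped set a packing of a ball can be contracted towards the centre, so the local
  entropy decreases with the radius (\<open>N_loc_antimono_radius\<close>).  Hence entropy at one radius
  controls entropy at every larger radius.

Lower bound (\<open>minimax_lower_bound\<close>).  At a radius \<open>\<epsilon>\<close> near \<open>\<epsilon>\<^sup>*\<close> there are \<open>N \<ge> exp (\<kappa> \<epsilon>\<^sup>2)\<close> points
of \<open>K\<close> in a ball of radius \<open>\<epsilon>\<close> that are \<open>\<epsilon> / c\<close> apart.  Contracting them by a constant factor
makes the squared distances small against \<open>ln N\<close>, while the separation keeps the order \<open>\<epsilon>\<close>.  With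
\<open>t = N / 4\<close> the change of measure inequality transfers the \<open>N\<close> disjoint events "the estimate is
near this point" to the law at the centre of the ball, where their probabilities sum to at most
one, so some point is missed with probability at least one half.  When \<open>N\<close> is bounded, \<open>\<epsilon>\<^sup>*\<close> is
bounded too, and two points of \<open>K\<close> at a distance of order \<open>min (diam2 n K) 1\<close> suffice.

Upper bound (\<open>tree_upper_bound\<close>).  The algorithm stays on the right track in an iteration as long
as the offspring that is closest to the truth is not beaten by a distant sibling.  Pruning makes
every level a packing, so the number of comparisons that can matter in an iteration is bounded by
local entropy; a union bound with \<open>test_error\<close> then makes a mistake exponentially unlikely at all
levels that are a constant number of steps above the stopping level (\<open>local_counts\<close>,
\<open>fooled_probability\<close>).  A mistake at level \<open>k\<close> costs only a multiple of the squared radius of that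
level, because later steps of the path shrink geometrically.  Summing over \<open>k\<close> gives a risk of
the order of the squared stopping tolerance (\<open>good_stop_risk\<close>).  Maximality of the stopping level
says that one level further down the entropy is already large, and with the submultiplicativity
\<open>N_loc_submult\<close> this bounds the stopping tolerance by a multiple of \<open>\<epsilon>\<^sup>*\<close>
(\<open>small_entropy_level\<close>).  If no level qualifies, \<open>diam2 n K\<close> itself is bounded by a multiple of
\<open>\<epsilon>\<^sup>*\<close> and every point of \<open>K\<close> is good enough.
\<close>

section \<open>Distances, packings and coverings\<close>

lemma edist2_nonneg [simp]: "0 \<le> edist2 n x y"
  by (simp add: edist2_def)

lemma edist2_self [simp]: "edist2 n x x = 0"
  by (simp add: edist2_def L2_set_0')

lemma edist2_commute: "edist2 n x y = edist2 n y x"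
  by (simp add: edist2_def L2_set_def power2_commute)

lemma edist2_triangle: "edist2 n x z \<le> edist2 n x y + edist2 n y z"
  using L2_set_triangle_ineq[of "\<lambda>i. x i - y i" "\<lambda>i. y i - z i" "{..<n}"]
  by (simp add: edist2_def)

lemma edist2_sq: "(edist2 n x y)\<^sup>2 = (\<Sum>i<n. (x i - y i)\<^sup>2)"
  by (simp add: edist2_def L2_set_def sum_nonneg)

lemma edist2_eq_0_iff:
  assumes "x \<in> extensional {..<n}" "y \<in> extensional {..<n}"
  shows "edist2 n x y = 0 \<longleftrightarrow> x = y"
  using assms by (auto simp: edist2_def L2_set_eq_0_iff intro!: extensionalityI[of x "{..<n}" y])

text \<open>
The homothety with centre \<open>z\<close> and ratio \<open>t\<close>, in the extensional form in which the definition of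
star-shapedness uses it.
\<close>

definition contract :: "nat \<Rightarrow> real \<Rightarrow> point \<Rightarrow> point \<Rightarrow> point"
  where "contract n t z x = (\<lambda>i\<in>{..<n}. (1 - t) * z i + t * x i)"

lemma edist2_contract:
  assumes "0 \<le> t"
  shows "edist2 n (contract n t z x) (contract n t z y) = t * edist2 n x y"
proof -
  have "edist2 n (contract n t z x) (contract n t z y) = L2_set (\<lambda>i. t * (x i - y i)) {..<n}"
    unfolding edist2_def contract_def by (intro L2_set_cong) (auto simp: algebra_simps)
  also have "\<dots> = t * edist2 n x y"
    using assms by (simp add: edist2_def L2_set_right_distrib)
  finally show ?thesis .
qed

lemma edist2_contract_centre:
  assumes "0 \<le> t"
  shows "edist2 n z (contract n t z x) = t * edist2 n z x"
proof -
  have "edist2 n z (contract n t z x) = L2_set (\<lambda>i. t * (z i - x i)) {..<n}"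
    unfolding edist2_def contract_def by (intro L2_set_cong) (auto simp: algebra_simps)
  also have "\<dots> = t * edist2 n z x"
    using assms by (simp add: edist2_def L2_set_right_distrib)
  finally show ?thesis .
qed

lemma edist2_le_sum: "edist2 n x y \<le> (\<Sum>i<n. \<bar>x i - y i\<bar>)"
  unfolding edist2_def by (rule L2_set_le_sum_abs)

lemma packing_subset:
  assumes "packing n \<delta> S P" "S \<subseteq> S'" "\<delta>' \<le> \<delta>"
  shows "packing n \<delta>' S' P"
  unfolding packing_def
proof (intro conjI ballI impI)
  show "P \<subseteq> S'" using assms(1,2) unfolding packing_def by blast
  fix x y assume "x \<in> P" "y \<in> P" "x \<noteq> y"
  then have "\<delta> < edist2 n x y" using assms(1) unfolding packing_def by blast
  then show "\<delta>' < edist2 n x y" using assms(3) by simp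
qed

lemma packing_mono: "packing n \<delta> S P \<Longrightarrow> Q \<subseteq> P \<Longrightarrow> packing n \<delta> S Q"
  by (auto simp: packing_def)

text \<open>
Rounding to a grid of mesh \<open>\<delta> / n\<close> is injective on a packing: points of one grid cell are
closer than \<open>\<delta>\<close> already in the \<open>\<ell>\<^sub>1\<close> distance.  The bound is the number of grid cells of the cube,
so it is common to all packings.
\<close>

lemma packing_cube_card_bounded:
  assumes "0 < \<delta>" "K \<subseteq> {..<n} \<rightarrow>\<^sub>E {-M..M}"
  shows "\<exists>B. \<forall>P. packing n \<delta> K P \<longrightarrow> finite P \<and> card P \<le> B"
proof (cases "n = 0")
  case True
  have "finite P \<and> card P \<le> 1" if "packing n \<delta> K P" for P
  proof -
    have "P \<subseteq> {\<lambda>_. undefined}"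
      using that assms True by (auto simp: packing_def)
    then have "finite P" "card P \<le> card {\<lambda>_::nat. undefined::real}"
      by (auto intro: finite_subset simp del: card.insert intro!: card_mono)
    then show ?thesis by simp
  qed
  then show ?thesis by blast
next
  case False
  define g where "g = (\<lambda>x::point. \<lambda>i\<in>{..<n}. \<lfloor>x i * (n / \<delta>)\<rfloor>)"
  define G where "G = {..<n} \<rightarrow>\<^sub>E {\<lfloor>-M * (n / \<delta>)\<rfloor>..\<lfloor>M * (n / \<delta>)\<rfloor>}"
  have finG: "finite G"
    unfolding G_def by (intro finite_PiE) auto
  have "finite P \<and> card P \<le> card G" if P: "packing n \<delta> K P" for P
  proof -
    have sub: "g ` P \<subseteq> G"
    proof (rule image_subsetI)
      fix x assume "x \<in> P"
      then have xc: "x \<in> {..<n} \<rightarrow>\<^sub>E {-M..M}"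
        using P assms(2) by (auto simp: packing_def)
      have b: "-M * (n / \<delta>) \<le> x i * (n / \<delta>)" "x i * (n / \<delta>) \<le> M * (n / \<delta>)" if "i < n" for i
      proof -
        have "- M \<le> x i" "x i \<le> M" using xc that by (auto simp: PiE_iff)
        then show "-M * (n / \<delta>) \<le> x i * (n / \<delta>)" "x i * (n / \<delta>) \<le> M * (n / \<delta>)"
          using assms(1) by (intro mult_right_mono; simp)+
      qed
      have "g x i \<in> {\<lfloor>-M * (n / \<delta>)\<rfloor>..\<lfloor>M * (n / \<delta>)\<rfloor>}" if "i < n" for i
        using floor_mono[OF b(1)[OF that]] floor_mono[OF b(2)[OF that]] that unfolding g_def by simp
      moreover have "g x \<in> extensional {..<n}" unfolding g_def by simp
      ultimately show "g x \<in> G"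
        unfolding G_def PiE_iff by blast
    qed
    have inj: "inj_on g P"
    proof (rule inj_onI, rule ccontr)
      fix x y assume xy: "x \<in> P" "y \<in> P" "g x = g y" "x \<noteq> y"
      have c: "\<bar>x i - y i\<bar> \<le> \<delta> / n" if "i < n" for i
      proof -
        have "\<lfloor>x i * (n / \<delta>)\<rfloor> = \<lfloor>y i * (n / \<delta>)\<rfloor>"
          using fun_cong[OF xy(3), of i] that unfolding g_def by (simp only: restrict_apply lessThan_iff if_True)
        then have "\<bar>x i * (n / \<delta>) - y i * (n / \<delta>)\<bar> \<le> 1"
          by linarith
        also have "x i * (n / \<delta>) - y i * (n / \<delta>) = (x i - y i) * (n / \<delta>)"
          by (rule left_diff_distrib[symmetric])
        finally have "\<bar>x i - y i\<bar> * (n / \<delta>) \<le> 1"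
          unfolding abs_mult using assms(1) by simp
        then show ?thesis
          using assms(1) False by (simp add: field_simps)
      qed
      have "edist2 n x y \<le> (\<Sum>i<n. \<delta> / n)"
        using edist2_le_sum[of n x y] c by (meson lessThan_iff order_trans sum_mono)
      also have "\<dots> = \<delta>" using False by simp
      finally show False
        using P xy unfolding packing_def by force
    qed
    show ?thesis
      using inj sub finG by (metis card_inj_on_le finite_subset inj_on_finite)
  qed
  then show ?thesis by blast
qed

lemma maximal_packing_exists:
  assumes "\<And>P. packing n \<delta> S P \<Longrightarrow> card P \<le> B" "\<And>P. packing n \<delta> S P \<Longrightarrow> finite P"
  shows "\<exists>P. maximal_packing n \<delta> S P"
proof -
  have "packing n \<delta> S {}" by (simp add: packing_def)
  then obtain P where P: "packing n \<delta> S P" "\<And>Q. packing n \<delta> S Q \<Longrightarrow> card Q \<le> card P"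
    using ex_has_greatest_nat[of "packing n \<delta> S" "{}" card "Suc B"] assms(1)
    by (metis le_imp_less_Suc)
  have "\<not> packing n \<delta> S (insert x P)" if "x \<in> S - P" for x
    using P(2)[of "insert x P"] assms(2)[OF P(1)] that by auto
  then show ?thesis using P(1) unfolding maximal_packing_def by blast
qed

lemma maximal_packing_covering:
  assumes "maximal_packing n \<delta> S P" "0 \<le> \<delta>"
  shows "covering n \<delta> S P"
  unfolding covering_def
proof (intro conjI ballI)
  show "P \<subseteq> S" using assms by (simp add: maximal_packing_def packing_def)
  fix x assume x: "x \<in> S"
  show "\<exists>p\<in>P. edist2 n x p \<le> \<delta>"
  proof (cases "x \<in> P")
    case True then show ?thesis using assms(2) by (intro bexI[of _ x]) auto
  next
    case False
    then have "\<not> packing n \<delta> S (insert x P)" "packing n \<delta> S P"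
      using x assms(1) by (auto simp: maximal_packing_def)
    then show ?thesis
      using x edist2_commute[of n x] unfolding packing_def
      by (smt (verit, ccfv_SIG) insert_iff insert_subset)
  qed
qed

lemma covering_number_attained:
  assumes "finite F" "covering n \<delta> S F"
  obtains G where "finite G" "covering n \<delta> S G" "card G = covering_number n \<delta> S"
proof -
  have "\<exists>G. finite G \<and> card G = covering_number n \<delta> S \<and> covering n \<delta> S G"
    unfolding covering_number_def by (rule LeastI_ex) (use assms in blast)
  then show ?thesis using that by blast
qed

lemma covering_number_le:
  assumes "finite F" "covering n \<delta> S F"
  shows "covering_number n \<delta> S \<le> card F"
  unfolding covering_number_def by (rule Least_le) (use assms in blast)

text \<open>
Mapping every point of the packing to a covering point within half the packing scale is
injective.
\<close>

lemma packing_le_covering: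
  assumes P: "packing n \<delta> S P" and F: "finite F" "covering n (\<delta> / 2) S F"
  shows "finite P \<and> card P \<le> card F"
proof -
  have "\<forall>x\<in>P. \<exists>p\<in>F. edist2 n x p \<le> \<delta> / 2"
    using P F by (auto simp: packing_def covering_def)
  then obtain f where f: "\<And>x. x \<in> P \<Longrightarrow> f x \<in> F" "\<And>x. x \<in> P \<Longrightarrow> edist2 n x (f x) \<le> \<delta> / 2"
    by metis
  have "inj_on f P"
  proof (rule inj_onI, rule ccontr)
    fix x y assume xy: "x \<in> P" "y \<in> P" "f x = f y" "x \<noteq> y"
    then have "edist2 n x y \<le> \<delta> / 2 + \<delta> / 2"
      using f(2)[of x] f(2)[of y] edist2_triangle[of n x y "f x"] edist2_commute[of n y] by simp
    then show False using P xy unfolding packing_def by force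
  qed
  then show ?thesis
    using f(1) F(1) by (meson card_inj_on_le image_subsetI inj_on_finite)
qed

section \<open>Local entropy of a star-shaped set\<close>

locale star_body =
  fixes n :: nat and M :: real and K :: "point set"
  assumes K_cube: "K \<subseteq> {..<n} \<rightarrow>\<^sub>E {-M..M}" and star: "star_shaped n K"
begin

definition centre :: point where
  "centre = (SOME z. z \<in> K \<and> (\<forall>x\<in>K. \<forall>t\<in>{0..1}. contract n t z x \<in> K))"

lemma centre: "centre \<in> K" "x \<in> K \<Longrightarrow> 0 \<le> t \<Longrightarrow> t \<le> 1 \<Longrightarrow> contract n t centre x \<in> K"
proof -
  have "\<exists>z. z \<in> K \<and> (\<forall>x\<in>K. \<forall>t\<in>{0..1}. contract n t z x \<in> K)"
    using star unfolding star_shaped_def contract_def by blast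
  then have "centre \<in> K \<and> (\<forall>x\<in>K. \<forall>t\<in>{0..1}. contract n t centre x \<in> K)"
    unfolding centre_def by (rule someI_ex)
  then show "centre \<in> K" "x \<in> K \<Longrightarrow> 0 \<le> t \<Longrightarrow> t \<le> 1 \<Longrightarrow> contract n t centre x \<in> K"
    by auto
qed

lemma K_ext: "x \<in> K \<Longrightarrow> x \<in> extensional {..<n}"
  using K_cube by (auto simp: PiE_def)

lemma K_bound: "x \<in> K \<Longrightarrow> i < n \<Longrightarrow> \<bar>x i\<bar> \<le> M"
  using K_cube by (force simp: PiE_iff)

lemma in_ball2: "x \<in> K \<Longrightarrow> x \<in> ball2 n \<theta> r \<longleftrightarrow> edist2 n \<theta> x \<le> r"
  using K_ext by (auto simp: ball2_def PiE_def)

lemma edist2_bdd: "bdd_above ((\<lambda>(x, y). edist2 n x y) ` (K \<times> K))"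
proof (rule bdd_aboveI2, clarify)
  fix x y assume xy: "x \<in> K" "y \<in> K"
  have "edist2 n x y \<le> (\<Sum>i<n. \<bar>x i - y i\<bar>)" by (rule edist2_le_sum)
  also have "\<dots> \<le> (\<Sum>i<n. 2 * M)"
    using K_bound[OF xy(1)] K_bound[OF xy(2)] by (intro sum_mono) force
  finally show "edist2 n x y \<le> (\<Sum>i<n. 2 * M)" .
qed

lemma edist2_le_diam2: "x \<in> K \<Longrightarrow> y \<in> K \<Longrightarrow> edist2 n x y \<le> diam2 n K"
  unfolding diam2_def using cSUP_upper[OF _ edist2_bdd, of "(x, y)"] by auto

lemma diam2_nonneg: "0 \<le> diam2 n K"
  using edist2_le_diam2[OF centre(1) centre(1)] by simp

text \<open>
If every point were closer to the centre than a third of the diameter, any two points would be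
closer than two thirds of it.  The diameter need not be attained, so one half is out of reach.
\<close>

lemma far_point: assumes "0 < diam2 n K"
  shows "\<exists>x\<in>K. diam2 n K / 3 \<le> edist2 n centre x"
proof (rule ccontr)
  assume "\<not> ?thesis"
  then have lt: "edist2 n centre x < diam2 n K / 3" if "x \<in> K" for x
    using that by force
  have "diam2 n K \<le> 2 * (diam2 n K / 3)"
    unfolding diam2_def[of n K]
  proof (rule cSUP_least)
    show "K \<times> K \<noteq> {}" using centre(1) by auto
    fix p assume "p \<in> K \<times> K"
    then obtain x y where p: "p = (x, y)" "x \<in> K" "y \<in> K" by auto
    have "edist2 n x y \<le> 2 * (diam2 n K / 3)"
      using lt[OF p(2)] lt[OF p(3)] edist2_triangle[of n x y centre] edist2_commute[of n x centre] by simp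
    then show "(case p of (x, y) \<Rightarrow> edist2 n x y) \<le> 2 * ((SUP (x, y)\<in>K \<times> K. edist2 n x y) / 3)"
      using p by (simp add: diam2_def)
  qed
  then show False using assms by simp
qed

lemma packing_bounded:
  assumes "0 < \<delta>"
  obtains B where "\<And>S P. S \<subseteq> K \<Longrightarrow> packing n \<delta> S P \<Longrightarrow> finite P \<and> card P \<le> B"
proof -
  from packing_cube_card_bounded[OF assms K_cube]
  obtain B where "\<And>P. packing n \<delta> K P \<Longrightarrow> finite P \<and> card P \<le> B" by blast
  then show ?thesis using that packing_subset[OF _ _ order_refl] by metis
qed

lemma maximal_packing_ex:
  assumes "0 < \<delta>" "S \<subseteq> K"
  obtains P where "finite P" "maximal_packing n \<delta> S P"
proof -
  obtain B where B: "\<And>S P. S \<subseteq> K \<Longrightarrow> packing n \<delta> S P \<Longrightarrow> finite P \<and> card P \<le> B"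
    using packing_bounded[OF assms(1)] by blast
  obtain P where "maximal_packing n \<delta> S P"
    using maximal_packing_exists[of n \<delta> S B] B[OF assms(2)] by blast
  then show ?thesis using that B[OF assms(2)] by (auto simp: maximal_packing_def)
qed

lemma minimal_covering:
  assumes "0 < \<delta>" "S \<subseteq> K"
  obtains G where "finite G" "covering n \<delta> S G" "card G = covering_number n \<delta> S"
proof -
  obtain P where "finite P" "maximal_packing n \<delta> S P" using maximal_packing_ex[OF assms] .
  then have "covering n \<delta> S P" using maximal_packing_covering assms by simp
  then show ?thesis using covering_number_attained[OF \<open>finite P\<close>] that by blast
qed

lemma covering_numbers_bdd:
  assumes "0 < \<delta>"
  shows "bdd_above ((\<lambda>\<theta>. real (covering_number n \<delta> (ball2 n \<theta> r \<inter> K))) ` K)"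
proof -
  obtain B where B: "\<And>S P. S \<subseteq> K \<Longrightarrow> packing n \<delta> S P \<Longrightarrow> finite P \<and> card P \<le> B"
    using packing_bounded[OF assms(1)] by blast
  show ?thesis
  proof (rule bdd_aboveI2)
    fix \<theta> assume "\<theta> \<in> K"
    obtain P where P: "finite P" "maximal_packing n \<delta> (ball2 n \<theta> r \<inter> K) P"
      using maximal_packing_ex[OF assms, of "ball2 n \<theta> r \<inter> K"] by blast
    then have "covering_number n \<delta> (ball2 n \<theta> r \<inter> K) \<le> card P"
      using maximal_packing_covering assms by (intro covering_number_le) auto
    also have "\<dots> \<le> B" using B[of "ball2 n \<theta> r \<inter> K" P] P by (simp add: maximal_packing_def)
    finally show "real (covering_number n \<delta> (ball2 n \<theta> r \<inter> K)) \<le> real B" by simp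
  qed
qed

lemma covering_number_le_N_loc:
  assumes "0 < \<epsilon>" "0 < c" "\<theta> \<in> K"
  shows "real (covering_number n (\<epsilon> / c) (ball2 n \<theta> \<epsilon> \<inter> K)) \<le> N_loc n K \<epsilon> c"
  unfolding N_loc_def
proof (rule cSUP_upper[OF assms(3)])
  show "bdd_above ((\<lambda>\<theta>. real (covering_number n (\<epsilon> / c) (ball2 n \<theta> \<epsilon> \<inter> K))) ` K)"
    using assms by (intro covering_numbers_bdd) simp
qed

lemma N_loc_least:
  assumes "\<And>\<theta>. \<theta> \<in> K \<Longrightarrow> real (covering_number n (\<epsilon> / c) (ball2 n \<theta> \<epsilon> \<inter> K)) \<le> B"
  shows "N_loc n K \<epsilon> c \<le> B"
  unfolding N_loc_def using assms centre(1) by (intro cSUP_least) auto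

lemma N_loc_ge_1:
  assumes "0 < \<epsilon>" "0 < c"
  shows "1 \<le> N_loc n K \<epsilon> c"
proof -
  let ?S = "ball2 n centre \<epsilon> \<inter> K"
  obtain G where G: "finite G" "covering n (\<epsilon> / c) ?S G" "card G = covering_number n (\<epsilon> / c) ?S"
    using minimal_covering[of "\<epsilon> / c" ?S] assms by auto
  have "centre \<in> ?S" using in_ball2 centre(1) assms by simp
  then have "G \<noteq> {}" using G(2) by (auto simp: covering_def)
  then have "1 \<le> card G" using G(1) by (simp add: Suc_leI card_gt_0_iff)
  then show ?thesis
    using covering_number_le_N_loc[OF assms centre(1)] G(3) by simp
qed

lemma N_loc_attained:
  assumes "0 < \<epsilon>" "0 < c"
  obtains \<theta> where "\<theta> \<in> K" "N_loc n K \<epsilon> c = real (covering_number n (\<epsilon> / c) (ball2 n \<theta> \<epsilon> \<inter> K))"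
proof -
  let ?f = "\<lambda>\<theta>. covering_number n (\<epsilon> / c) (ball2 n \<theta> \<epsilon> \<inter> K)"
  have "bdd_above ((\<lambda>\<theta>. real (?f \<theta>)) ` K)"
    using covering_numbers_bdd[of "\<epsilon> / c" \<epsilon>] assms by simp
  then obtain B where B: "\<And>\<theta>. \<theta> \<in> K \<Longrightarrow> real (?f \<theta>) \<le> B" by (auto simp: bdd_above_def)
  have "\<forall>\<theta>. \<theta> \<in> K \<longrightarrow> ?f \<theta> < Suc (nat \<lceil>B\<rceil>)"
  proof (intro allI impI)
    fix \<theta> assume "\<theta> \<in> K"
    then have "real (?f \<theta>) \<le> real (nat \<lceil>B\<rceil>)" using B real_nat_ceiling_ge order_trans by blast
    then show "?f \<theta> < Suc (nat \<lceil>B\<rceil>)" by linarith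
  qed
  then obtain \<theta> where t: "\<theta> \<in> K" "\<And>\<eta>. \<eta> \<in> K \<Longrightarrow> ?f \<eta> \<le> ?f \<theta>"
    using ex_has_greatest_nat[of "\<lambda>\<theta>. \<theta> \<in> K" centre ?f] centre(1) by metis
  have "N_loc n K \<epsilon> c = real (?f \<theta>)"
    using t covering_number_le_N_loc[OF assms t(1)] by (intro antisym N_loc_least) auto
  then show ?thesis using that t(1) by blast
qed

lemma N_loc_antimono_scale:
  assumes "0 < \<epsilon>" "0 < c1" "c1 \<le> c2"
  shows "N_loc n K \<epsilon> c1 \<le> N_loc n K \<epsilon> c2"
proof (rule N_loc_least)
  fix \<theta> assume t: "\<theta> \<in> K"
  let ?S = "ball2 n \<theta> \<epsilon> \<inter> K"
  obtain G where G: "finite G" "covering n (\<epsilon> / c2) ?S G" "card G = covering_number n (\<epsilon> / c2) ?S"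
    using minimal_covering[of "\<epsilon> / c2" ?S] assms by auto
  have "\<epsilon> / c2 \<le> \<epsilon> / c1" using assms by (intro divide_left_mono) auto
  then have "covering n (\<epsilon> / c1) ?S G"
    using G(2) unfolding covering_def by (meson order_trans)
  then have "covering_number n (\<epsilon> / c1) ?S \<le> covering_number n (\<epsilon> / c2) ?S"
    using covering_number_le G by metis
  then show "real (covering_number n (\<epsilon> / c1) ?S) \<le> N_loc n K \<epsilon> c2"
    using covering_number_le_N_loc[OF assms(1) _ t, of c2] assms by linarith
qed

text \<open>
Contraction towards the centre of \<open>K\<close> carries a packing of a ball to a packing of a smaller ball,
with the ratio of scale to radius unchanged.  This is how star-shapedness enters the
entropy estimates.  The factor 2 pays for the change from packings to coverings by points of the
set.
\<close>

lemma local_packing_le_N_loc: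
  assumes P: "packing n (R / c) (ball2 n \<theta> R \<inter> K) P" and t: "\<theta> \<in> K"
    and R: "0 < R'" "R' \<le> R" "0 < c"
  shows "finite P \<and> real (card P) \<le> N_loc n K R' (2 * c)"
proof -
  define s where "s = R' / R"
  have s: "0 < s" "s \<le> 1" "s * R = R'" using R by (auto simp: s_def)
  let ?g = "contract n s centre"
  let ?S = "ball2 n (?g \<theta>) R' \<inter> K"
  have inj: "inj_on ?g P"
  proof (rule inj_onI)
    fix x y assume xy: "x \<in> P" "y \<in> P" "?g x = ?g y"
    then have "edist2 n x y = 0" using edist2_contract[of s n centre x y] s by simp
    then show "x = y"
      using xy P K_ext by (subst edist2_eq_0_iff[symmetric]) (auto simp: packing_def)
  qed
  have pk: "packing n (R' / c) ?S (?g ` P)"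
    unfolding packing_def
  proof (intro conjI subsetI ballI impI)
    fix y assume "y \<in> ?g ` P"
    then obtain x where x: "x \<in> P" "y = ?g x" by auto
    then have "x \<in> K" "x \<in> ball2 n \<theta> R" using P by (auto simp: packing_def)
    then have "x \<in> K" "edist2 n \<theta> x \<le> R" using in_ball2 by auto
    then have "edist2 n (?g \<theta>) (?g x) \<le> R'" "?g x \<in> K"
      using s centre(2) edist2_contract[of s n centre \<theta> x] by (auto simp: mult_left_mono simp flip: s(3))
    then show "y \<in> ?S" using x in_ball2 by simp
  next
    fix a b assume ab: "a \<in> ?g ` P" "b \<in> ?g ` P" "a \<noteq> b"
    then obtain x y where xy: "x \<in> P" "y \<in> P" "a = ?g x" "b = ?g y" "x \<noteq> y" by auto
    then have "R / c < edist2 n x y" using P by (auto simp: packing_def)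
    then have "s * (R / c) < s * edist2 n x y" using s(1) by (rule mult_strict_left_mono)
    then show "R' / c < edist2 n a b"
      using xy s(1) edist2_contract[of s n centre x y] s(3) by (metis less_imp_le times_divide_eq_right)
  qed
  have g\<theta>: "?g \<theta> \<in> K" using centre(2) t s by simp
  obtain G where G: "finite G" "covering n (R' / (2 * c)) ?S G"
      "card G = covering_number n (R' / (2 * c)) ?S"
    using minimal_covering[of "R' / (2 * c)" ?S] R by auto
  have "finite (?g ` P) \<and> card (?g ` P) \<le> card G"
    using packing_le_covering[OF pk G(1)] G(2) by (simp add: mult.commute)
  moreover have "real (card G) \<le> N_loc n K R' (2 * c)"
    using covering_number_le_N_loc[OF R(1) _ g\<theta>, of "2 * c"] G(3) R by simp
  ultimately show ?thesis
    using inj by (metis card_image finite_imageD of_nat_le_iff order_trans)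
qed

lemma N_loc_antimono_radius:
  assumes "0 < R'" "R' \<le> R" "0 < c"
  shows "N_loc n K R c \<le> N_loc n K R' (2 * c)"
proof (rule N_loc_least)
  fix \<theta> assume t: "\<theta> \<in> K"
  let ?S = "ball2 n \<theta> R \<inter> K"
  obtain P where P: "finite P" "maximal_packing n (R / c) ?S P"
    using maximal_packing_ex[of "R / c" ?S] assms by auto
  have "covering_number n (R / c) ?S \<le> card P"
    using P assms maximal_packing_covering by (intro covering_number_le) auto
  moreover have "real (card P) \<le> N_loc n K R' (2 * c)"
    using local_packing_le_N_loc[OF _ t assms] P by (auto simp: maximal_packing_def)
  ultimately show "real (covering_number n (R / c) ?S) \<le> N_loc n K R' (2 * c)"
    by linarith
qed

text \<open>
Cover the ball at the coarse scale first and split the packing along the small balls.  Counting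
packings instead of coverings matters here: a covering of one of the small balls may use points
outside the large ball, whereas the pieces of a packing remain packings.
\<close>

lemma local_packing_submult:
  assumes P: "packing n (R / (c1 * c2)) (ball2 n \<theta> R \<inter> K) P" and t: "\<theta> \<in> K"
    and R: "0 < R" "0 < c1" "0 < c2"
  shows "finite P \<and> real (card P) \<le> N_loc n K R c1 * N_loc n K (R / c1) (2 * c2)"
proof -
  let ?S = "ball2 n \<theta> R \<inter> K"
  obtain G where G: "finite G" "covering n (R / c1) ?S G" "card G = covering_number n (R / c1) ?S"
    using minimal_covering[of "R / c1" ?S] R by auto
  let ?Q = "\<lambda>p. P \<inter> ball2 n p (R / c1)"
  have PK: "P \<subseteq> K" using P by (auto simp: packing_def)
  have Q: "finite (?Q p) \<and> real (card (?Q p)) \<le> N_loc n K (R / c1) (2 * c2)" if "p \<in> G" for p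
  proof (rule local_packing_le_N_loc)
    show "p \<in> K" using that G(2) by (auto simp: covering_def)
    show "packing n (R / c1 / c2) (ball2 n p (R / c1) \<inter> K) (?Q p)"
      using P PK by (auto simp: packing_def divide_divide_eq_left)
  qed (use R in auto)
  have U: "P \<subseteq> (\<Union>p\<in>G. ?Q p)"
  proof
    fix x assume x: "x \<in> P"
    then have "x \<in> ?S" using P by (auto simp: packing_def)
    then obtain p where "p \<in> G" "edist2 n x p \<le> R / c1"
      using G(2) unfolding covering_def by blast
    then show "x \<in> (\<Union>p\<in>G. ?Q p)"
      using x subsetD[OF PK x] in_ball2[of x p "R / c1"] edist2_commute[of n x p] by auto
  qed
  have fin: "finite (\<Union>p\<in>G. ?Q p)" using Q G(1) by blast
  have "card P \<le> card (\<Union>p\<in>G. ?Q p)" by (rule card_mono[OF fin U])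
  also have "\<dots> \<le> (\<Sum>p\<in>G. card (?Q p))" by (rule card_UN_le[OF G(1)])
  finally have "real (card P) \<le> (\<Sum>p\<in>G. real (card (?Q p)))"
    by (metis of_nat_le_iff of_nat_sum)
  also have "\<dots> \<le> (\<Sum>p\<in>G. N_loc n K (R / c1) (2 * c2))"
    using Q by (intro sum_mono) auto
  also have "\<dots> = real (card G) * N_loc n K (R / c1) (2 * c2)" by simp
  also have "\<dots> \<le> N_loc n K R c1 * N_loc n K (R / c1) (2 * c2)"
    using covering_number_le_N_loc[OF R(1,2) t] G(3) N_loc_ge_1[of "R / c1" "2 * c2"] R
    by (intro mult_right_mono) auto
  finally show ?thesis using finite_subset[OF U fin] by simp
qed

lemma N_loc_submult:
  assumes "0 < R" "0 < c1" "0 < c2"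
  shows "N_loc n K R (c1 * c2) \<le> N_loc n K R c1 * N_loc n K (R / c1) (2 * c2)"
proof (rule N_loc_least)
  fix \<theta> assume t: "\<theta> \<in> K"
  let ?S = "ball2 n \<theta> R \<inter> K"
  obtain P where P: "finite P" "maximal_packing n (R / (c1 * c2)) ?S P"
    using maximal_packing_ex[of "R / (c1 * c2)" ?S] assms by auto
  have "covering_number n (R / (c1 * c2)) ?S \<le> card P"
    using P assms maximal_packing_covering by (intro covering_number_le) auto
  moreover have "real (card P) \<le> N_loc n K R c1 * N_loc n K (R / c1) (2 * c2)"
    using local_packing_submult[OF _ t assms] P by (auto simp: maximal_packing_def)
  ultimately show "real (covering_number n (R / (c1 * c2)) ?S) \<le> N_loc n K R c1 * N_loc n K (R / c1) (2 * c2)"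
    by linarith
qed

end

section \<open>Curvature of the log-partition function\<close>

lemma second_order_Taylor:
  assumes "open D" "twice_cont_diff_on A D" "closed_segment x y \<subseteq> D"
  obtains \<xi> where "\<xi> \<in> closed_segment x y"
    "A y = A x + deriv A x * (y - x) + deriv (deriv A) \<xi> / 2 * (y - x)\<^sup>2"
proof (cases "x = y")
  case True
  then show ?thesis using that[of x] by simp
next
  case False
  define df where "df = (\<lambda>m::nat. if m = 0 then A else if m = 1 then deriv A else deriv (deriv A))"
  have seg: "closed_segment x y = {min x y..max x y}"
    by (auto simp: closed_segment_eq_real_ivl)
  have D1: "DERIV A t :> deriv A t" "DERIV (deriv A) t :> deriv (deriv A) t" if "t \<in> D" for t
    using assms(1,2) that
    by (auto simp: twice_cont_diff_on_def DERIV_deriv_iff_real_differentiable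
          differentiable_on_eq_differentiable_at)
  have D2: "\<forall>m t. m < 2 \<and> min x y \<le> t \<and> t \<le> max x y \<longrightarrow> DERIV (df m) t :> df (Suc m) t"
    using D1 assms(3) unfolding seg df_def by (auto simp: less_2_cases_iff)
  obtain t where t: "if y < x then y < t \<and> t < x else x < t \<and> t < y"
      "A y = (\<Sum>m<2. (df m x / fact m) * (y - x)^m) + (df 2 t / fact 2) * (y - x)^2"
    using Taylor[of 2 df A "min x y" "max x y" x y] D2 False by (auto simp: df_def)
  have "t \<in> closed_segment x y" using t(1) unfolding seg by (auto split: if_splits)
  moreover have "A y = A x + deriv A x * (y - x) + deriv (deriv A) t / 2 * (y - x)\<^sup>2"
    using t(2) by (simp add: df_def numeral_2_eq_2)
  ultimately show ?thesis using that by blast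
qed

text \<open>
In the sum of the two Taylor polynomials the odd terms cancel, and the remainders of order four
are nonnegative.
\<close>

lemma exp_plus_exp_minus_ge: "2 + z\<^sup>2 \<le> exp z + exp (- z)" for z :: real
proof -
  have poly: "(\<Sum>m<4. x ^ m / fact m) = 1 + x + x\<^sup>2 / 2 + x ^ 3 / 6" for x :: real
    by (simp add: numeral_eq_Suc)
  have rem: "0 \<le> exp s / fact 4 * x ^ 4" for s x :: real
    by (intro mult_nonneg_nonneg zero_le_even_power) auto
  obtain s where "exp z = (\<Sum>m<4. z ^ m / fact m) + exp s / fact 4 * z ^ 4"
    using Maclaurin_exp_le[of z 4] by auto
  moreover obtain t where "exp (- z) = (\<Sum>m<4. (- z) ^ m / fact m) + exp t / fact 4 * (- z) ^ 4"
    using Maclaurin_exp_le[of "- z" 4] by auto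
  ultimately have "1 + z + z\<^sup>2 / 2 + z ^ 3 / 6 \<le> exp z" "1 - z + z\<^sup>2 / 2 - z ^ 3 / 6 \<le> exp (- z)"
    using rem[of s z] rem[of t "- z"] poly[of z] poly[of "- z"] by auto
  then show ?thesis by linarith
qed

locale expfam_model =
  fixes h T A :: "real \<Rightarrow> real" and D :: "real set" and M :: real
  assumes D_open: "open D" and A_smooth: "twice_cont_diff_on A D"
    and M_pos: "0 < M" and M_D: "{-2 * M..2 * M} \<subseteq> D"
    and family: "expfam h T A D"
begin

abbreviation "law \<theta> \<equiv> expfam_law h T A \<theta>"
abbreviation "A2 \<equiv> deriv (deriv A)"

lemma family_measurable [measurable]: "h \<in> borel_measurable borel" "T \<in> borel_measurable borel"
  using family by (auto simp: expfam_def)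

lemma h_nonneg: "0 \<le> h y"
  using family by (auto simp: expfam_def)

lemma density_meas [measurable]: "expfam_density h T A \<theta> \<in> borel_measurable borel"
  unfolding expfam_density_def by measurable

lemma sets_law [measurable_cong, simp]: "sets (law \<theta>) = sets borel"
  by (simp add: expfam_law_def)

lemma space_law [simp]: "space (law \<theta>) = UNIV"
  by (simp add: expfam_law_def)

lemma prob_space_law: assumes "\<theta> \<in> D" shows "prob_space (law \<theta>)"
proof
  show "emeasure (law \<theta>) (space (law \<theta>)) = 1"
    using assms family unfolding expfam_law_def
    by (subst emeasure_density) (auto simp: expfam_def)
qed

text \<open>
Members of the family are exponential tilts of each other.
\<close>

lemma law_tilt:
  "law \<eta> = density (law \<theta>) (\<lambda>y. ennreal (exp ((\<eta> - \<theta>) * T y - (A \<eta> - A \<theta>))))"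
proof -
  have "ennreal (expfam_density h T A \<eta> y) =
      ennreal (expfam_density h T A \<theta> y) * ennreal (exp ((\<eta> - \<theta>) * T y - (A \<eta> - A \<theta>)))" for y
    using h_nonneg by (simp add: expfam_density_def flip: ennreal_mult exp_add)
      (simp add: algebra_simps flip: exp_add)
  then show ?thesis
    unfolding expfam_law_def by (subst density_density_eq) auto
qed

text \<open>
This says that the tilted law has total mass one.
\<close>

lemma law_mgf:
  assumes "\<theta> \<in> D" "\<theta> + w \<in> D"
  shows "integrable (law \<theta>) (\<lambda>y. exp (w * T y))"
    and "(\<integral>y. exp (w * T y) \<partial>law \<theta>) = exp (A (\<theta> + w) - A \<theta>)"
proof -
  let ?k = "exp (A (\<theta> + w) - A \<theta>)"
  interpret prob_space "law (\<theta> + w)" by (rule prob_space_law) fact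
  have "1 = emeasure (law (\<theta> + w)) UNIV"
    using emeasure_space_1 by simp
  also have "\<dots> = (\<integral>\<^sup>+y. ennreal (exp (w * T y - (A (\<theta> + w) - A \<theta>))) \<partial>law \<theta>)"
    by (subst law_tilt[of "\<theta> + w" \<theta>], subst emeasure_density) auto
  finally have "ennreal ?k * 1 = ennreal ?k * \<dots>" by simp
  also have "\<dots> = (\<integral>\<^sup>+y. ennreal ?k * ennreal (exp (w * T y - (A (\<theta> + w) - A \<theta>))) \<partial>law \<theta>)"
    by (subst nn_integral_cmult) auto
  also have "\<dots> = (\<integral>\<^sup>+y. ennreal (exp (w * T y)) \<partial>law \<theta>)"
    by (intro nn_integral_cong) (simp flip: ennreal_mult exp_add)
  finally have "(\<integral>\<^sup>+y. ennreal (exp (w * T y)) \<partial>law \<theta>) = ennreal ?k" by simp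
  then have "integrable (law \<theta>) (\<lambda>y. exp (w * T y)) \<and> (\<integral>y. exp (w * T y) \<partial>law \<theta>) = ?k"
    by (subst (asm) nn_integral_eq_integrable) auto
  then show "integrable (law \<theta>) (\<lambda>y. exp (w * T y))"
    "(\<integral>y. exp (w * T y) \<partial>law \<theta>) = ?k" by auto
qed

text \<open>
Differentiation under the integral sign is avoided.  With \<open>\<mu>\<close> the mean of \<open>T\<close>, put
\<open>x = E exp (s (T - \<mu>))\<close> and \<open>y = E exp (- s (T - \<mu>))\<close>.  The logarithm of \<open>x y\<close> is the second
difference of \<open>A\<close>.  Both factors are at least 1, because \<open>exp z \<ge> 1 + z\<close>, and
\<open>x + y \<ge> 2 + s\<^sup>2 Var T\<close>; finally \<open>(x - 1) (y - 1) \<ge> 0\<close> turns the sum into the product.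
\<close>

lemma second_difference_lower_bound:
  assumes "\<theta> \<in> D" "\<theta> + s \<in> D" "\<theta> - s \<in> D"
  shows "ln (1 + s\<^sup>2 * prob_space.variance (law \<theta>) T) \<le> A (\<theta> + s) + A (\<theta> - s) - 2 * A \<theta>"
proof -
  interpret prob_space "law \<theta>" by (rule prob_space_law) fact
  define \<mu> where "\<mu> = expectation T"
  have V: "variance T > 0" using assms(1) family by (auto simp: expfam_def)
  have int2: "integrable (law \<theta>) (\<lambda>y. (T y - \<mu>)\<^sup>2)"
    using V not_integrable_integral_eq unfolding \<mu>_def by fastforce
  have int1: "integrable (law \<theta>) (\<lambda>y. T y - \<mu>)"
    by (rule square_integrable_imp_integrable[OF _ int2]) simp
  have intT: "integrable (law \<theta>) T"
    using Bochner_Integration.integrable_add[OF int1 integrable_const[of \<mu>]] by simp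
  \<comment> \<open>The positive variance is what makes \<open>T\<close> integrable: the integral of a non-integrable function would be 0.\<close>
  have zero: "expectation (\<lambda>y. T y - \<mu>) = 0"
    using intT by (simp add: \<mu>_def prob_space[unfolded space_law])
  have inte: "integrable (law \<theta>) (\<lambda>y. exp (w * (T y - \<mu>)))"
    and inte_eq: "expectation (\<lambda>y. exp (w * (T y - \<mu>))) = exp (A (\<theta> + w) - A \<theta> - w * \<mu>)"
    if "\<theta> + w \<in> D" for w
  proof -
    have eq: "(\<lambda>y. exp (w * (T y - \<mu>))) = (\<lambda>y. exp (w * T y) * exp (- (w * \<mu>)))"
      by (auto simp: algebra_simps simp flip: exp_add)
    show "integrable (law \<theta>) (\<lambda>y. exp (w * (T y - \<mu>)))"
      unfolding eq using law_mgf(1)[OF assms(1) that] by simp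
    show "expectation (\<lambda>y. exp (w * (T y - \<mu>))) = exp (A (\<theta> + w) - A \<theta> - w * \<mu>)"
      unfolding eq integral_mult_left_zero law_mgf(2)[OF assms(1) that] by (simp flip: exp_add)
  qed
  have ge1: "1 \<le> exp (A (\<theta> + w) - A \<theta> - w * \<mu>)" if "\<theta> + w \<in> D" for w
  proof -
    have "1 = expectation (\<lambda>y. 1 + w * (T y - \<mu>))"
      using int1 zero by (simp add: prob_space[unfolded space_law])
    also have "\<dots> \<le> expectation (\<lambda>y. exp (w * (T y - \<mu>)))"
      using int1 inte[OF that] by (intro integral_mono) auto
    finally show ?thesis using inte_eq[OF that] by simp
  qed
  define x y where "x = exp (A (\<theta> + s) - A \<theta> - s * \<mu>)" and "y = exp (A (\<theta> - s) - A \<theta> + s * \<mu>)"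
  have s': "\<theta> + (- s) \<in> D" using assms by simp
  have xy1: "1 \<le> x" "1 \<le> y" using ge1[of s] ge1[of "- s"] assms by (auto simp: x_def y_def)
  have "2 + s\<^sup>2 * variance T = expectation (\<lambda>y. 2 + s\<^sup>2 * (T y - \<mu>)\<^sup>2)"
    using int2 by (simp add: prob_space[unfolded space_law] \<mu>_def)
  also have "\<dots> \<le> expectation (\<lambda>y. exp (s * (T y - \<mu>)) + exp (- s * (T y - \<mu>)))"
  proof (rule integral_mono)
    fix y show "2 + s\<^sup>2 * (T y - \<mu>)\<^sup>2 \<le> exp (s * (T y - \<mu>)) + exp (- s * (T y - \<mu>))"
      using exp_plus_exp_minus_ge[of "s * (T y - \<mu>)"] by (simp add: power_mult_distrib)
  qed (use int2 inte[OF assms(2)] inte[OF s'] in auto)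
  also have "\<dots> = x + y"
    using inte[OF assms(2)] inte[OF s'] inte_eq[OF assms(2)] inte_eq[OF s']
    by (simp add: x_def y_def)
  finally have sum: "2 + s\<^sup>2 * variance T \<le> x + y" .
  have "0 \<le> (x - 1) * (y - 1)" using xy1 by simp
  then have "1 + s\<^sup>2 * variance T \<le> x * y" using sum by (simp add: algebra_simps)
  also have "x * y = exp (A (\<theta> + s) + A (\<theta> - s) - 2 * A \<theta>)"
    by (simp add: x_def y_def flip: exp_add)
  finally have "ln (1 + s\<^sup>2 * variance T) \<le> ln (exp (A (\<theta> + s) + A (\<theta> - s) - 2 * A \<theta>))"
    using V by (intro ln_mono) (auto intro!: add_pos_nonneg)
  then show ?thesis by simp
qed

text \<open>
If \<open>A''\<close> were not positive at \<open>\<theta>\<close>, by continuity it would stay below half the variance nearby,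
and Taylor's formula would make the second difference smaller than
\<open>second_difference_lower_bound\<close> allows.
\<close>

lemma A2_pos:
  assumes "\<theta> \<in> D"
  shows "0 < A2 \<theta>"
proof (rule ccontr)
  assume neg: "\<not> 0 < A2 \<theta>"
  define V where "V = prob_space.variance (law \<theta>) T"
  have V: "0 < V" using assms family by (auto simp: expfam_def V_def)
  have "isCont A2 \<theta>"
    using A_smooth D_open assms by (auto simp: twice_cont_diff_on_def continuous_on_eq_continuous_at)
  then obtain e1 where e1: "0 < e1" "\<And>x. dist x \<theta> < e1 \<Longrightarrow> dist (A2 x) (A2 \<theta>) < V / 2"
    using V unfolding continuous_at_eps_delta by (meson half_gt_zero)
  obtain e2 where e2: "0 < e2" "ball \<theta> e2 \<subseteq> D"
    using D_open assms by (meson open_contains_ball)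
  \<comment> \<open>The last bound keeps \<open>s\<^sup>2 V \<le> 1\<close>, where \<open>ln (1 + u) \<ge> u / 2\<close>.\<close>
  define s where "s = min (min e1 e2 / 2) (1 / sqrt V)"
  have s: "0 < s" "s < e1" "s < e2" "s \<le> 1 / sqrt V"
    using e1 e2 V by (auto simp: s_def min_def)
  have seg: "closed_segment \<theta> (\<theta> + s) \<subseteq> D" "closed_segment \<theta> (\<theta> - s) \<subseteq> D"
    using s e2(2) by (auto simp: closed_segment_eq_real_ivl subset_eq dist_real_def)
  obtain u where u: "u \<in> closed_segment \<theta> (\<theta> + s)"
      "A (\<theta> + s) = A \<theta> + deriv A \<theta> * s + A2 u / 2 * s\<^sup>2"
    using second_order_Taylor[OF D_open A_smooth seg(1)] by auto
  obtain v where v: "v \<in> closed_segment \<theta> (\<theta> - s)"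
      "A (\<theta> - s) = A \<theta> + deriv A \<theta> * (- s) + A2 v / 2 * s\<^sup>2"
    using second_order_Taylor[OF D_open A_smooth seg(2)] by auto
  have near: "A2 w < V / 2" if "\<bar>w - \<theta>\<bar> \<le> s" for w
  proof -
    have "\<bar>A2 w - A2 \<theta>\<bar> < V / 2" using e1(2)[of w] that s by (simp add: dist_real_def)
    then have "A2 w - A2 \<theta> < V / 2" by (rule abs_less_iff[THEN iffD1, THEN conjunct1])
    then show ?thesis using neg by linarith
  qed
  have "A2 u < V / 2" "A2 v < V / 2"
    using u(1) v(1) s(1) near[of u] near[of v] by (auto simp: closed_segment_eq_real_ivl)
  then have lt: "(A2 u + A2 v) * s\<^sup>2 < V * s\<^sup>2" using s by simp
  have "s\<^sup>2 \<le> (1 / sqrt V)\<^sup>2" using s by (intro power_mono) auto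
  then have sV: "s\<^sup>2 * V \<le> 1" using V by (simp add: power_divide field_simps)
  have "\<theta> + s \<in> D" "\<theta> - s \<in> D" using seg by auto
  then have "ln (1 + s\<^sup>2 * V) \<le> (A2 u + A2 v) / 2 * s\<^sup>2"
    using second_difference_lower_bound[OF assms, of s] u(2) v(2)
    by (simp add: V_def algebra_simps add_divide_distrib)
  moreover have "s\<^sup>2 * V / 2 \<le> ln (1 + s\<^sup>2 * V)"
  proof -
    have p: "0 < s\<^sup>2 * V" using s V by simp
    have "ln (1 / (1 + s\<^sup>2 * V)) \<le> 1 / (1 + s\<^sup>2 * V) - 1"
      using p by (intro ln_le_minus_one) auto
    moreover have "ln (1 / (1 + s\<^sup>2 * V)) = - ln (1 + s\<^sup>2 * V)" using p by (simp add: ln_div)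
    moreover have "1 / (1 + s\<^sup>2 * V) \<le> 1 - s\<^sup>2 * V / 2"
    proof -
      have "0 \<le> s\<^sup>2 * V * (1 - s\<^sup>2 * V)" using p sV by simp
      then have "1 \<le> (1 - s\<^sup>2 * V / 2) * (1 + s\<^sup>2 * V)" by (simp add: algebra_simps)
      then show ?thesis using p by (subst pos_divide_le_eq) auto
    qed
    ultimately show ?thesis by linarith
  qed
  ultimately show False using lt by (simp add: mult.commute)
qed

lemma curv_bounded: "r \<le> 2 * M \<Longrightarrow> compact (A2 ` {-r..r})"
  using A_smooth M_D
  by (intro compact_continuous_image) (auto simp: twice_cont_diff_on_def elim!: continuous_on_subset)

lemma curv_min_le: "\<bar>\<xi>\<bar> \<le> M \<Longrightarrow> curv_min A M \<le> A2 \<xi>"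
  unfolding curv_min_def using M_pos
  by (intro cINF_lower bounded_imp_bdd_below compact_imp_bounded curv_bounded) auto

lemma le_curv_max: "\<bar>\<xi>\<bar> \<le> M \<Longrightarrow> A2 \<xi> \<le> curv_max A M"
  unfolding curv_max_def using M_pos
  by (intro cSUP_upper bounded_imp_bdd_above compact_imp_bounded curv_bounded) auto

lemma le_curv_max2: "\<bar>\<xi>\<bar> \<le> 2 * M \<Longrightarrow> A2 \<xi> \<le> curv_max A (2 * M)"
  unfolding curv_max_def using M_pos
  by (intro cSUP_upper bounded_imp_bdd_above compact_imp_bounded curv_bounded) auto

lemma curv_min_pos: "0 < curv_min A M"
proof -
  have "compact (A2 ` {-M..M})" using curv_bounded M_pos by simp
  moreover have "A2 ` {-M..M} \<noteq> {}" using M_pos by simp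
  ultimately obtain x where x: "x \<in> {-M..M}" "\<forall>y\<in>{-M..M}. A2 x \<le> A2 y"
    using compact_attains_inf[of "A2 ` {-M..M}"] by auto
  have "A2 x \<le> curv_min A M"
    unfolding curv_min_def using x M_pos by (intro cINF_greatest) auto
  moreover have "0 < A2 x" using x(1) M_pos M_D by (intro A2_pos) auto
  ultimately show ?thesis by linarith
qed

lemma curv_order: "curv_min A M \<le> curv_max A M" "curv_max A M \<le> curv_max A (2 * M)"
proof -
  show "curv_min A M \<le> curv_max A M"
    using curv_min_le[of 0] le_curv_max[of 0] M_pos by simp
  show "curv_max A M \<le> curv_max A (2 * M)"
    unfolding curv_max_def[of A M] using M_pos by (intro cSUP_least le_curv_max2) auto
qed

lemma quadratic_bounds:
  assumes "\<bar>x\<bar> \<le> M" "\<bar>y\<bar> \<le> M"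
  shows "A x + deriv A x * (y - x) + curv_min A M / 2 * (y - x)\<^sup>2 \<le> A y"
    and "A y \<le> A x + deriv A x * (y - x) + curv_max A M / 2 * (y - x)\<^sup>2"
proof -
  have seg: "closed_segment x y \<subseteq> {-M..M}" using assms by (auto simp: closed_segment_eq_real_ivl)
  moreover have "{-M..M} \<subseteq> D" using M_D M_pos by auto
  ultimately have "closed_segment x y \<subseteq> D" by (rule subset_trans)
  from second_order_Taylor[OF D_open A_smooth this]
  obtain u where "u \<in> closed_segment x y"
    "A y = A x + deriv A x * (y - x) + A2 u / 2 * (y - x)\<^sup>2" by metis
  with seg have u: "u \<in> {-M..M}" "A y = A x + deriv A x * (y - x) + A2 u / 2 * (y - x)\<^sup>2"
    by auto
  have "curv_min A M / 2 * (y - x)\<^sup>2 \<le> A2 u / 2 * (y - x)\<^sup>2"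
       "A2 u / 2 * (y - x)\<^sup>2 \<le> curv_max A M / 2 * (y - x)\<^sup>2"
    using curv_min_le[of u] le_curv_max[of u] u(1) by (auto intro!: mult_right_mono)
  then show "A x + deriv A x * (y - x) + curv_min A M / 2 * (y - x)\<^sup>2 \<le> A y"
    "A y \<le> A x + deriv A x * (y - x) + curv_max A M / 2 * (y - x)\<^sup>2"
    using u(2) by auto
qed

lemma quadratic_upper_bound:
  assumes "\<bar>x\<bar> \<le> 2 * M" "\<bar>y\<bar> \<le> 2 * M"
  shows "A y \<le> A x + deriv A x * (y - x) + curv_max A (2 * M) / 2 * (y - x)\<^sup>2"
proof -
  have seg: "closed_segment x y \<subseteq> {-2*M..2*M}" using assms by (auto simp: closed_segment_eq_real_ivl)
  from second_order_Taylor[OF D_open A_smooth subset_trans[OF this M_D]]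
  obtain u where "u \<in> closed_segment x y"
    "A y = A x + deriv A x * (y - x) + A2 u / 2 * (y - x)\<^sup>2" by metis
  with seg have u: "u \<in> {-2*M..2*M}" "A y = A x + deriv A x * (y - x) + A2 u / 2 * (y - x)\<^sup>2"
    by auto
  have "A2 u / 2 * (y - x)\<^sup>2 \<le> curv_max A (2 * M) / 2 * (y - x)\<^sup>2"
    using le_curv_max2[of u] u(1) by (auto intro!: mult_right_mono)
  then show ?thesis using u(2) by auto
qed

section \<open>Likelihood ratios of the sample\<close>

definition admissible :: "nat \<Rightarrow> point \<Rightarrow> bool"
  where "admissible n \<theta> \<longleftrightarrow> (\<forall>i<n. \<theta> i \<in> D)"

abbreviation "sample n \<theta> \<equiv> sample_law n h T A \<theta>"

text \<open>
The locale of product probability spaces asks for a probability measure at every index, so the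
irrelevant indices get the parameter 0, which lies in the domain.
\<close>

lemma sample_alt: "sample n \<theta> = PiM {..<n} (\<lambda>i. law (if i < n then \<theta> i else 0))"
  unfolding sample_law_def by (intro PiM_cong) auto

lemma sets_sample [measurable_cong, simp]: "sets (sample n \<theta>) = sets (PiM {..<n} (\<lambda>_. borel))"
  unfolding sample_law_def by (intro sets_PiM_cong) auto

lemma space_sample [simp]: "space (sample n \<theta>) = {..<n} \<rightarrow>\<^sub>E UNIV"
  unfolding sample_law_def by (simp add: space_PiM)

lemma zero_in_D: "0 \<in> D"
  using M_D M_pos by auto

lemma product_prob_space_law:
  assumes "admissible n \<theta>"
  shows "product_prob_space (\<lambda>i. law (if i < n then \<theta> i else 0))"
  using assms zero_in_D
  by (auto simp: admissible_def product_prob_space_def product_prob_space_axioms_def product_sigma_finite_def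
      intro!: prob_space_law prob_space_imp_sigma_finite)

lemma prob_space_sample:
  assumes "admissible n \<theta>"
  shows "prob_space (sample n \<theta>)"
  unfolding sample_law_def using assms
  by (intro prob_space_PiM prob_space_law) (auto simp: admissible_def)

text \<open>
The coordinatewise tilts multiply; it suffices to compare both measures on boxes.
\<close>

lemma sample_tilt:
  assumes "admissible n \<theta>" "admissible n \<eta>"
  shows "sample n \<eta> = density (sample n \<theta>)
    (\<lambda>y. ennreal (exp (\<Sum>i<n. (\<eta> i - \<theta> i) * T (y i) - (A (\<eta> i) - A (\<theta> i)))))"
    (is "_ = density _ ?L")
proof -
  let ?N = "\<lambda>\<theta> i. law (if i < n then \<theta> i else 0)"
  let ?l = "\<lambda>i y. ennreal (exp ((\<eta> i - \<theta> i) * T y - (A (\<eta> i) - A (\<theta> i))))"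
  interpret P: product_prob_space "?N \<theta>" by (rule product_prob_space_law[OF assms(1)])
  interpret Q: product_prob_space "?N \<eta>" by (rule product_prob_space_law[OF assms(2)])
  have "density (sample n \<theta>) ?L = PiM {..<n} (?N \<eta>)"
  proof (rule Q.PiM_eqI)
    show "sets (density (sample n \<theta>) ?L) = sets (PiM {..<n} (?N \<eta>))"
      by (simp add: sample_alt[symmetric])
    fix B assume "\<And>i. i \<in> {..<n} \<Longrightarrow> B i \<in> sets (?N \<eta> i)"
    then have B: "i < n \<Longrightarrow> B i \<in> sets borel" for i by auto
    have [measurable]: "B i \<in> sets borel" if "i \<in> {..<n}" for i using B that by auto
    have BP: "Pi\<^sub>E {..<n} B \<in> sets (PiM {..<n} (\<lambda>_. borel))"
      using B by (intro sets_PiM_I_finite) auto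
    have "emeasure (density (sample n \<theta>) ?L) (Pi\<^sub>E {..<n} B) =
        (\<integral>\<^sup>+y. ?L y * indicator (Pi\<^sub>E {..<n} B) y \<partial>sample n \<theta>)"
      using BP by (intro emeasure_density) auto
    also have "\<dots> = (\<integral>\<^sup>+y. (\<Prod>i<n. ?l i (y i) * indicator (B i) (y i)) \<partial>sample n \<theta>)"
    proof (rule nn_integral_cong)
      fix y assume "y \<in> space (sample n \<theta>)"
      then have "y \<in> extensional {..<n}" by (simp add: PiE_def)
      then have ind: "indicator (Pi\<^sub>E {..<n} B) y = (\<Prod>i<n. indicator (B i) (y i) :: ennreal)"
        by (auto simp: indicator_def PiE_iff prod_zero_iff)
      have "?L y = (\<Prod>i<n. ?l i (y i))"
        by (simp add: exp_sum prod_ennreal)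
      then show "?L y * indicator (Pi\<^sub>E {..<n} B) y = (\<Prod>i<n. ?l i (y i) * indicator (B i) (y i))"
        unfolding ind by (simp add: prod.distrib)
    qed
    also have "\<dots> = (\<Prod>i<n. \<integral>\<^sup>+y. ?l i y * indicator (B i) y \<partial>?N \<theta> i)"
      unfolding sample_alt by (rule P.product_nn_integral_prod) (auto simp: B)
    also have "\<dots> = (\<Prod>i<n. emeasure (?N \<eta> i) (B i))"
    proof (rule prod.cong[OF refl])
      fix i assume "i \<in> {..<n}"
      then show "(\<integral>\<^sup>+y. ?l i y * indicator (B i) y \<partial>?N \<theta> i) = emeasure (?N \<eta> i) (B i)"
        using law_tilt[of "\<eta> i" "\<theta> i"] B[of i] by (subst emeasure_density[symmetric]) auto
    qed
    finally show "emeasure (density (sample n \<theta>) ?L) (Pi\<^sub>E {..<n} B) =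
      (\<Prod>i<n. emeasure (?N \<eta> i) (B i))" .
  qed simp
  then show ?thesis by (simp add: sample_alt)
qed

lemma sample_mgf:
  assumes "admissible n \<theta>" "admissible n (\<lambda>i. \<theta> i + w i)"
  shows "(\<integral>\<^sup>+y. ennreal (exp (\<Sum>i<n. w i * T (y i))) \<partial>sample n \<theta>) =
    ennreal (exp (\<Sum>i<n. A (\<theta> i + w i) - A (\<theta> i)))"
proof -
  let ?k = "exp (\<Sum>i<n. A (\<theta> i + w i) - A (\<theta> i))"
  let ?L = "\<lambda>y. ennreal (exp (\<Sum>i<n. w i * T (y i) - (A (\<theta> i + w i) - A (\<theta> i))))"
  interpret prob_space "sample n (\<lambda>i. \<theta> i + w i)" by (rule prob_space_sample) fact
  have "sample n (\<lambda>i. \<theta> i + w i) = density (sample n \<theta>) ?L"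
    using sample_tilt[OF assms] by simp
  then have mass: "emeasure (density (sample n \<theta>) ?L) (space (sample n \<theta>)) = 1"
    using emeasure_space_1 by simp
  have "(\<integral>\<^sup>+y. ?L y \<partial>sample n \<theta>) = (\<integral>\<^sup>+y. ?L y * indicator (space (sample n \<theta>)) y \<partial>sample n \<theta>)"
    by (intro nn_integral_cong) (simp del: space_sample)
  also have "\<dots> = emeasure (density (sample n \<theta>) ?L) (space (sample n \<theta>))"
  proof (rule emeasure_density[symmetric])
    show "?L \<in> borel_measurable (sample n \<theta>)" by simp
  qed (rule sets.top)
  finally have one: "(\<integral>\<^sup>+y. ?L y \<partial>sample n \<theta>) = 1" using mass by simp
  have "(\<integral>\<^sup>+y. ennreal (exp (\<Sum>i<n. w i * T (y i))) \<partial>sample n \<theta>) =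
      (\<integral>\<^sup>+y. ennreal ?k * ?L y \<partial>sample n \<theta>)"
    by (intro nn_integral_cong) (simp add: sum_subtractf flip: ennreal_mult exp_add)
  also have "\<dots> = ennreal ?k * (\<integral>\<^sup>+y. ?L y \<partial>sample n \<theta>)"
    by (rule nn_integral_cmult) auto
  finally show ?thesis using one by simp
qed

definition cube_point :: "nat \<Rightarrow> point \<Rightarrow> bool"
  where "cube_point n \<theta> \<longleftrightarrow> (\<forall>i<n. \<bar>\<theta> i\<bar> \<le> M)"

lemma double_cube_admissible: "(\<And>i. i < n \<Longrightarrow> \<bar>\<theta> i\<bar> \<le> 2 * M) \<Longrightarrow> admissible n \<theta>"
  using M_D unfolding admissible_def by (force simp: abs_le_iff)

lemma cube_point_admissible: "cube_point n \<theta> \<Longrightarrow> admissible n \<theta>"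
  using M_pos by (intro double_cube_admissible) (force simp: cube_point_def)

lemma beats_measurable [measurable]:
  "{y \<in> space (PiM {..<n} (\<lambda>_. borel)). beats n T A y b a} \<in> sets (PiM {..<n} (\<lambda>_. borel))"
  unfolding beats_def by measurable

lemma beats_measurable': "{y \<in> space (sample n \<theta>). beats n T A y b a} \<in> sets (sample n \<theta>)"
  using beats_measurable[of n b a] by (simp add: space_PiM)

text \<open>
This is the role of the lower bound on \<open>C\<close>.  At \<open>\<rho> = 2 q \<delta>\<close> with \<open>q = sqrt (L + 8)\<close> the gap is
\<open>((q - 2)\<^sup>2 + 5) \<delta>\<^sup>2\<close>, and it increases from there on.
\<close>

lemma test_error_exponent:
  assumes L: "1 \<le> L" and C: "2 * sqrt (L + 8) \<le> C" and \<rho>: "C * \<delta> \<le> \<rho>" and \<delta>: "0 \<le> \<delta>"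
  shows "L * \<delta>\<^sup>2 - (\<rho> - \<delta>)\<^sup>2 \<le> - \<rho>\<^sup>2 / 2"
proof -
  define q where "q = sqrt (L + 8)"
  have q: "q\<^sup>2 = L + 8" "3 \<le> q"
    using L real_le_rsqrt[of 3 "L + 8"] by (auto simp: q_def)
  have "2 * q * \<delta> \<le> \<rho>" using C \<rho> \<delta> mult_right_mono[OF C \<delta>] by (simp add: q_def)
  then obtain r where r: "\<rho> = 2 * q * \<delta> + r" "0 \<le> r" by (metis add.commute diff_add_cancel diff_ge_0_iff_ge)
  have "\<rho>\<^sup>2 / 2 - 2 * \<rho> * \<delta> + \<delta>\<^sup>2 - L * \<delta>\<^sup>2 = ((q - 2)\<^sup>2 + 5) * \<delta>\<^sup>2 + 2 * (q - 1) * \<delta> * r + r\<^sup>2 / 2"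
  proof -
    have L: "L = q\<^sup>2 - 8" using q(1) by simp
    show ?thesis unfolding r(1) L by (simp add: power2_eq_square algebra_simps)
  qed
  moreover have "0 \<le> ((q - 2)\<^sup>2 + 5) * \<delta>\<^sup>2 + 2 * (q - 1) * \<delta> * r + r\<^sup>2 / 2"
    using q(2) r(2) \<delta> by (intro add_nonneg_nonneg mult_nonneg_nonneg) auto
  ultimately show ?thesis by (simp add: power2_eq_square algebra_simps)
qed

text \<open>
Chernoff's bound for the log-likelihood difference, with parameter \<open>s = c(M) / (4 C'(M))\<close>.
Coordinatewise, the exponent is a quadratic error of the tilt plus \<open>s\<close> times the difference
of the Bregman divergences of \<open>A\<close> from \<open>\<theta>\<close> to \<open>a\<close> and to \<open>b\<close>; curvature bounds turn all of them
into squared distances, and \<open>test_error_exponent\<close> shows that the far point \<open>b\<close> dominates.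
\<close>

lemma test_error:
  assumes cube: "cube_point n \<theta>" "cube_point n a" "cube_point n b"
    and C: "2 * sqrt (curv_max A M / curv_min A M + 8) \<le> C"
    and \<delta>: "0 \<le> \<delta>" "edist2 n a \<theta> \<le> \<delta>" "C * \<delta> \<le> edist2 n a b"
  shows "emeasure (sample n \<theta>) {y \<in> space (sample n \<theta>). beats n T A y b a}
    \<le> ennreal (exp (- ((curv_min A M)\<^sup>2 * C\<^sup>2 / (32 * curv_max A (2 * M)) * \<delta>\<^sup>2)))"
proof -
  define cm Cm Cd where "cm = curv_min A M" and "Cm = curv_max A M" and "Cd = curv_max A (2 * M)"
  have pos: "0 < cm" "cm \<le> Cm" "Cm \<le> Cd"
    using curv_min_pos curv_order by (auto simp: cm_def Cm_def Cd_def)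
  define s where "s = cm / (4 * Cd)"
  have s: "0 < s" "s \<le> 1 / 2" using pos by (auto simp: s_def field_simps)
  define \<rho> where "\<rho> = edist2 n a b"
  let ?w = "\<lambda>i. s * (b i - a i)"
  let ?X = "\<lambda>y. (\<Sum>i<n. (a i - b i) * T (y i) + A (b i) - A (a i))"
  let ?E = "{y \<in> space (sample n \<theta>). beats n T A y b a}"
  let ?k = "exp (- s * (\<Sum>i<n. A (b i) - A (a i)))"
  have adm: "admissible n (\<lambda>i. \<theta> i + ?w i)"
  proof (rule double_cube_admissible)
    fix i assume i: "i < n"
    have "\<bar>a i\<bar> \<le> M" "\<bar>b i\<bar> \<le> M" using cube i by (auto simp: cube_point_def)
    then have "\<bar>b i - a i\<bar> \<le> 2 * M" by linarith
    then have "\<bar>s * (b i - a i)\<bar> \<le> 1 / 2 * (2 * M)"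
      unfolding abs_mult using s by (intro mult_mono) auto
    then show "\<bar>\<theta> i + s * (b i - a i)\<bar> \<le> 2 * M"
      using cube(1) i by (auto simp: cube_point_def)
  qed
  have "emeasure (sample n \<theta>) ?E = (\<integral>\<^sup>+y. indicator ?E y \<partial>sample n \<theta>)"
    using beats_measurable' by (rule nn_integral_indicator[symmetric])
  also have "\<dots> \<le> (\<integral>\<^sup>+y. ennreal ?k * ennreal (exp (\<Sum>i<n. ?w i * T (y i))) \<partial>sample n \<theta>)"
  proof (rule nn_integral_mono)
    fix y
    have "- s * ?X y = - s * (\<Sum>i<n. A (b i) - A (a i)) + (\<Sum>i<n. ?w i * T (y i))"
      unfolding sum_distrib_left sum.distrib[symmetric] by (intro sum.cong) (auto simp: algebra_simps)
    then have "ennreal ?k * ennreal (exp (\<Sum>i<n. ?w i * T (y i))) = ennreal (exp (- s * ?X y))"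
      by (simp flip: ennreal_mult exp_add)
    moreover have "1 \<le> exp (- s * ?X y)" if "y \<in> ?E"
      using that s by (simp add: beats_def mult_nonneg_nonpos)
    ultimately show "indicator ?E y \<le> ennreal ?k * ennreal (exp (\<Sum>i<n. ?w i * T (y i)))"
      by (cases "y \<in> ?E") (auto simp del: mem_Collect_eq)
  qed
  also have "\<dots> = ennreal ?k * (\<integral>\<^sup>+y. ennreal (exp (\<Sum>i<n. ?w i * T (y i))) \<partial>sample n \<theta>)"
    by (rule nn_integral_cmult) auto
  also have "\<dots> = ennreal ?k * ennreal (exp (\<Sum>i<n. A (\<theta> i + ?w i) - A (\<theta> i)))"
    using sample_mgf[OF cube_point_admissible[OF cube(1)] adm] by simp
  also have "\<dots> = ennreal (exp (\<Sum>i<n. A (\<theta> i + ?w i) - A (\<theta> i) - s * (A (b i) - A (a i))))"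
  proof -
    have "- s * (\<Sum>i<n. A (b i) - A (a i)) + (\<Sum>i<n. A (\<theta> i + ?w i) - A (\<theta> i))
      = (\<Sum>i<n. A (\<theta> i + ?w i) - A (\<theta> i) - s * (A (b i) - A (a i)))"
      unfolding sum_distrib_left sum.distrib[symmetric] by (intro sum.cong) auto
    then show ?thesis by (simp flip: ennreal_mult exp_add)
  qed
  also have "\<dots> \<le> ennreal (exp (- (cm\<^sup>2 * C\<^sup>2 / (32 * Cd) * \<delta>\<^sup>2)))"
  proof (intro ennreal_leI, subst exp_le_cancel_iff)
    have "(\<Sum>i<n. A (\<theta> i + ?w i) - A (\<theta> i) - s * (A (b i) - A (a i))) \<le>
      (\<Sum>i<n. Cd / 2 * s\<^sup>2 * (a i - b i)\<^sup>2 + s * Cm / 2 * (a i - \<theta> i)\<^sup>2 - s * cm / 2 * (b i - \<theta> i)\<^sup>2)"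
    proof (rule sum_mono)
      fix i assume "i \<in> {..<n}"
      then have i: "i < n" by simp
      have c: "\<bar>\<theta> i\<bar> \<le> M" "\<bar>a i\<bar> \<le> M" "\<bar>b i\<bar> \<le> M" using cube i by (auto simp: cube_point_def)
      have c2: "\<bar>\<theta> i\<bar> \<le> 2 * M" using c(1) M_pos by linarith
      have "\<bar>b i - a i\<bar> \<le> 2 * M" using c by linarith
      then have "\<bar>s * (b i - a i)\<bar> \<le> 1 / 2 * (2 * M)"
        unfolding abs_mult using s by (intro mult_mono) auto
      then have c3: "\<bar>\<theta> i + s * (b i - a i)\<bar> \<le> 2 * M" using c by linarith
      have 1: "A (\<theta> i + ?w i) \<le> A (\<theta> i) + deriv A (\<theta> i) * (?w i) + Cd / 2 * (?w i)\<^sup>2"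
        using quadratic_upper_bound[OF c2 c3] by (simp add: Cd_def)
      have 2: "s * A (a i) \<le> s * (A (\<theta> i) + deriv A (\<theta> i) * (a i - \<theta> i) + Cm / 2 * (a i - \<theta> i)\<^sup>2)"
        using quadratic_bounds(2)[OF c(1,2)] s by (simp add: Cm_def)
      have 3: "s * (A (\<theta> i) + deriv A (\<theta> i) * (b i - \<theta> i) + cm / 2 * (b i - \<theta> i)\<^sup>2) \<le> s * A (b i)"
        using quadratic_bounds(1)[OF c(1,3)] s by (simp add: cm_def)
      have 4: "Cd / 2 * (?w i)\<^sup>2 = Cd / 2 * s\<^sup>2 * (a i - b i)\<^sup>2"
        by (simp add: power_mult_distrib power2_commute)
      have 5: "s * (A (\<theta> i) + deriv A (\<theta> i) * (a i - \<theta> i) + Cm / 2 * (a i - \<theta> i)\<^sup>2)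
         - s * (A (\<theta> i) + deriv A (\<theta> i) * (b i - \<theta> i) + cm / 2 * (b i - \<theta> i)\<^sup>2) =
         - (deriv A (\<theta> i) * ?w i) + s * Cm / 2 * (a i - \<theta> i)\<^sup>2 - s * cm / 2 * (b i - \<theta> i)\<^sup>2"
        by (simp add: algebra_simps)
      show "A (\<theta> i + ?w i) - A (\<theta> i) - s * (A (b i) - A (a i)) \<le>
        Cd / 2 * s\<^sup>2 * (a i - b i)\<^sup>2 + s * Cm / 2 * (a i - \<theta> i)\<^sup>2 - s * cm / 2 * (b i - \<theta> i)\<^sup>2"
        using 1 2 3 4 5 unfolding right_diff_distrib by linarith
    qed
    also have "\<dots> = Cd / 2 * s\<^sup>2 * \<rho>\<^sup>2 + s * Cm / 2 * (edist2 n a \<theta>)\<^sup>2 - s * cm / 2 * (edist2 n b \<theta>)\<^sup>2"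
      unfolding edist2_sq \<rho>_def by (simp add: sum.distrib sum_subtractf sum_distrib_left)
    also have "\<dots> \<le> Cd / 2 * s\<^sup>2 * \<rho>\<^sup>2 + s * Cm / 2 * \<delta>\<^sup>2 - s * cm / 2 * (\<rho> - \<delta>)\<^sup>2"
    proof -
      have "1 \<le> sqrt (curv_max A M / curv_min A M + 8)"
        using pos by (auto simp: cm_def Cm_def intro!: real_le_rsqrt)
      then have "1 \<le> C" using C by linarith
      then have "\<delta> \<le> \<rho>" using \<delta> mult_right_mono[of 1 C \<delta>] by (simp add: \<rho>_def)
      moreover have "\<rho> - \<delta> \<le> edist2 n b \<theta>"
        using edist2_triangle[of n a b \<theta>] \<delta>(2) edist2_commute[of n b] by (simp add: \<rho>_def)
      ultimately have "(\<rho> - \<delta>)\<^sup>2 \<le> (edist2 n b \<theta>)\<^sup>2" by (intro power_mono) auto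
      moreover have "(edist2 n a \<theta>)\<^sup>2 \<le> \<delta>\<^sup>2" using \<delta> by (intro power_mono) auto
      ultimately show ?thesis using s pos
        by (intro add_mono diff_mono mult_left_mono) auto
    qed
    also have "\<dots> = Cd / 2 * s\<^sup>2 * \<rho>\<^sup>2 + s * cm / 2 * (Cm / cm * \<delta>\<^sup>2 - (\<rho> - \<delta>)\<^sup>2)"
      using pos by (simp add: algebra_simps)
    also have "\<dots> \<le> Cd / 2 * s\<^sup>2 * \<rho>\<^sup>2 + s * cm / 2 * (- \<rho>\<^sup>2 / 2)"
    proof (intro add_left_mono mult_left_mono test_error_exponent)
      show "1 \<le> Cm / cm" using pos by simp
      show "2 * sqrt (Cm / cm + 8) \<le> C" using C by (simp add: Cm_def cm_def)
    qed (use \<delta> s pos in \<open>auto simp: \<rho>_def\<close>)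
    also have "\<dots> = - (cm\<^sup>2 / (32 * Cd) * \<rho>\<^sup>2)"
      using pos by (simp add: s_def power2_eq_square field_simps)
    also have "\<dots> \<le> - (cm\<^sup>2 / (32 * Cd) * (C * \<delta>)\<^sup>2)"
    proof -
      have "0 \<le> 2 * sqrt (curv_max A M / curv_min A M + 8)"
        using pos by (simp add: cm_def Cm_def)
      then have "0 \<le> C" using C by linarith
      then have "(C * \<delta>)\<^sup>2 \<le> \<rho>\<^sup>2" using \<delta> by (intro power_mono) (auto simp: \<rho>_def)
      then show ?thesis using pos by (simp add: divide_right_mono mult_left_mono)
    qed
    also have "\<dots> = - (cm\<^sup>2 * C\<^sup>2 / (32 * Cd) * \<delta>\<^sup>2)" by (simp add: power_mult_distrib)
    finally show "(\<Sum>i<n. A (\<theta> i + ?w i) - A (\<theta> i) - s * (A (b i) - A (a i))) \<le>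
      - (cm\<^sup>2 * C\<^sup>2 / (32 * Cd) * \<delta>\<^sup>2)" .
  qed
  finally show ?thesis by (simp add: cm_def Cd_def)
qed

text \<open>
A truncation of a likelihood ratio \<open>l\<close> at the level \<open>t\<close>: where \<open>l\<close> exceeds \<open>t\<close>, the factor
\<open>sqrt (l / t)\<close> is at least 1.
\<close>

lemma likelihood_ratio_inequality:
  fixes l t :: real
  assumes "0 < l" "0 < t"
  shows "l \<le> t + l * sqrt l / sqrt t"
proof (cases "l \<le> t")
  case True then show ?thesis using assms by (simp add: add_increasing2)
next
  case False
  then have "1 \<le> sqrt l / sqrt t" using assms by simp
  then have "l * 1 \<le> l * (sqrt l / sqrt t)" using assms by (intro mult_left_mono) auto
  then show ?thesis using assms by simp
qed

text \<open>
This takes the place of Fano's inequality.  Integrate \<open>likelihood_ratio_inequality\<close> over \<open>B\<close>; what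
remains is the moment of order 3/2 of the likelihood ratio.  That order is chosen because the
tilt \<open>\<theta> + 3/2 (\<eta> - \<theta>)\<close> stays in the doubled cube, where \<open>A\<close> is controlled; the second moment
would lead to \<open>2 \<eta> - \<theta>\<close>, which can leave it.
\<close>

lemma change_of_measure_inequality:
  assumes cube: "cube_point n \<theta>" "cube_point n \<eta>" and t: "0 < t"
    and B: "B \<in> sets (PiM {..<n} (\<lambda>_. borel))"
  shows "measure (sample n \<eta>) B \<le> t * measure (sample n \<theta>) B
     + exp (curv_max A (2 * M) / 2 * (edist2 n \<eta> \<theta>)\<^sup>2) / sqrt t"
proof -
  define Cd where "Cd = curv_max A (2 * M)"
  have Cd: "0 \<le> Cd" using curv_min_pos curv_order by (simp add: Cd_def)
  note adm = cube_point_admissible[OF cube(1)] cube_point_admissible[OF cube(2)]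
  let ?Z = "\<lambda>y. \<Sum>i<n. (\<eta> i - \<theta> i) * T (y i) - (A (\<eta> i) - A (\<theta> i))"
  let ?L = "\<lambda>y. exp (?Z y)"
  let ?w = "\<lambda>i. 3 / 2 * (\<eta> i - \<theta> i)"
  let ?m = "\<Sum>i<n. 3 / 2 * (A (\<eta> i) - A (\<theta> i))"
  interpret P: prob_space "sample n \<theta>" by (rule prob_space_sample) fact
  interpret Q: prob_space "sample n \<eta>" by (rule prob_space_sample) fact
  have admw: "admissible n (\<lambda>i. \<theta> i + ?w i)"
  proof (rule double_cube_admissible)
    fix i assume "i < n"
    then have "\<bar>\<theta> i\<bar> \<le> M" "\<bar>\<eta> i\<bar> \<le> M" using cube by (auto simp: cube_point_def)
    then show "\<bar>\<theta> i + 3 / 2 * (\<eta> i - \<theta> i)\<bar> \<le> 2 * M"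
      unfolding abs_le_iff right_diff_distrib by linarith
  qed
  \<comment> \<open>The power 3/2 of the likelihood ratio is, up to a constant, again an exponential of \<open>T\<close>.\<close>
  have half: "?L y * sqrt (?L y) = exp (- ?m) * exp (\<Sum>i<n. ?w i * T (y i))" for y
  proof -
    have "?Z y + ?Z y / 2 = - ?m + (\<Sum>i<n. ?w i * T (y i))"
      unfolding sum_divide_distrib sum_negf[symmetric] sum.distrib[symmetric]
      by (intro sum.cong) (auto simp: field_simps)
    moreover have "sqrt (exp x) = exp (x / 2)" for x :: real
      by (rule real_sqrt_unique) (simp_all add: power2_eq_square flip: exp_add)
    then have "sqrt (?L y) = exp (?Z y / 2)" .
    ultimately show ?thesis by (simp flip: exp_add)
  qed
  have "emeasure (sample n \<eta>) B = (\<integral>\<^sup>+y. ennreal (?L y) * indicator B y \<partial>sample n \<theta>)"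
    unfolding sample_tilt[OF adm] using B by (intro emeasure_density) auto
  also have "\<dots> \<le> (\<integral>\<^sup>+y. ennreal t * indicator B y
      + ennreal (exp (- ?m) / sqrt t) * ennreal (exp (\<Sum>i<n. ?w i * T (y i))) \<partial>sample n \<theta>)"
  proof (rule nn_integral_mono)
    fix y
    have "?L y \<le> t + exp (- ?m) / sqrt t * exp (\<Sum>i<n. ?w i * T (y i))"
      using likelihood_ratio_inequality[of "?L y" t] t half[of y] by simp
    then have "ennreal (?L y) \<le> ennreal t + ennreal (exp (- ?m) / sqrt t) * ennreal (exp (\<Sum>i<n. ?w i * T (y i)))"
      using t by (simp flip: ennreal_mult ennreal_plus del: times_divide_eq_left)
    then show "ennreal (?L y) * indicator B y \<le> ennreal t * indicator B y
      + ennreal (exp (- ?m) / sqrt t) * ennreal (exp (\<Sum>i<n. ?w i * T (y i)))"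
      by (cases "y \<in> B") auto
  qed
  also have "\<dots> = ennreal t * emeasure (sample n \<theta>) B
      + ennreal (exp (- ?m) / sqrt t) * (\<integral>\<^sup>+y. ennreal (exp (\<Sum>i<n. ?w i * T (y i))) \<partial>sample n \<theta>)"
    using B by (subst nn_integral_add) (auto simp: nn_integral_cmult nn_integral_cmult_indicator)
  also have "\<dots> = ennreal t * emeasure (sample n \<theta>) B
      + ennreal (exp (- ?m) / sqrt t) * ennreal (exp (\<Sum>i<n. A (\<theta> i + ?w i) - A (\<theta> i)))"
    using sample_mgf[OF adm(1) admw] by simp
  also have "\<dots> = ennreal (t * measure (sample n \<theta>) B
      + exp (- ?m) / sqrt t * exp (\<Sum>i<n. A (\<theta> i + ?w i) - A (\<theta> i)))"
    using t by (simp add: P.emeasure_eq_measure ennreal_mult del: times_divide_eq_left)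
  finally have "measure (sample n \<eta>) B \<le> t * measure (sample n \<theta>) B
      + exp (- ?m) / sqrt t * exp (\<Sum>i<n. A (\<theta> i + ?w i) - A (\<theta> i))"
    using t unfolding Q.emeasure_eq_measure by (subst (asm) ennreal_le_iff) auto
  also have "exp (- ?m) / sqrt t * exp (\<Sum>i<n. A (\<theta> i + ?w i) - A (\<theta> i)) =
      exp (\<Sum>i<n. A (\<theta> i + ?w i) - A (\<theta> i) - 3 / 2 * (A (\<eta> i) - A (\<theta> i))) / sqrt t"
    by (simp add: sum_subtractf flip: exp_add)
  also have "\<dots> \<le> exp (Cd / 2 * (edist2 n \<eta> \<theta>)\<^sup>2) / sqrt t"
  proof (intro divide_right_mono, subst exp_le_cancel_iff)
    have "(\<Sum>i<n. A (\<theta> i + ?w i) - A (\<theta> i) - 3 / 2 * (A (\<eta> i) - A (\<theta> i)))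
       \<le> (\<Sum>i<n. Cd / 2 * (\<eta> i - \<theta> i)\<^sup>2)"
    proof (rule sum_mono)
      fix i assume "i \<in> {..<n}"
      then have c: "\<bar>\<theta> i\<bar> \<le> M" "\<bar>\<eta> i\<bar> \<le> M" using cube by (auto simp: cube_point_def)
      then have c2: "\<bar>\<theta> i\<bar> \<le> 2 * M" "\<bar>\<eta> i\<bar> \<le> 2 * M" "\<bar>\<theta> i + ?w i\<bar> \<le> 2 * M"
        unfolding abs_le_iff right_diff_distrib by linarith+
      define u where "u = \<eta> i - \<theta> i"
      have u: "\<theta> i + ?w i - \<eta> i = u / 2" "\<theta> i - \<eta> i = - u" by (auto simp: u_def field_simps)
      have "A (\<theta> i + ?w i) \<le> A (\<eta> i) + deriv A (\<eta> i) * (\<theta> i + ?w i - \<eta> i) + Cd / 2 * (\<theta> i + ?w i - \<eta> i)\<^sup>2"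
        unfolding Cd_def by (rule quadratic_upper_bound[OF c2(2,3)])
      then have 1: "A (\<theta> i + ?w i) \<le> A (\<eta> i) + deriv A (\<eta> i) * u / 2 + Cd * u\<^sup>2 / 8"
        unfolding u by (simp add: power_divide)
      have "A (\<theta> i) \<le> A (\<eta> i) + deriv A (\<eta> i) * (\<theta> i - \<eta> i) + Cd / 2 * (\<theta> i - \<eta> i)\<^sup>2"
        unfolding Cd_def by (rule quadratic_upper_bound[OF c2(2,1)])
      then have 2: "A (\<theta> i) \<le> A (\<eta> i) - deriv A (\<eta> i) * u + Cd * u\<^sup>2 / 2"
        unfolding u by simp
      have 3: "0 \<le> Cd * u\<^sup>2" using Cd by simp
      have "A (\<theta> i + ?w i) - A (\<theta> i) - 3 / 2 * (A (\<eta> i) - A (\<theta> i)) \<le> Cd * u\<^sup>2 / 2"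
        using 1 2 3 unfolding right_diff_distrib by linarith
      then show "A (\<theta> i + ?w i) - A (\<theta> i) - 3 / 2 * (A (\<eta> i) - A (\<theta> i)) \<le> Cd / 2 * (\<eta> i - \<theta> i)\<^sup>2"
        by (simp add: u_def)
    qed
    also have "\<dots> = Cd / 2 * (edist2 n \<eta> \<theta>)\<^sup>2"
      by (simp add: edist2_sq sum_distrib_left)
    finally show "(\<Sum>i<n. A (\<theta> i + ?w i) - A (\<theta> i) - 3 / 2 * (A (\<eta> i) - A (\<theta> i))) \<le> Cd / 2 * (edist2 n \<eta> \<theta>)\<^sup>2" .
  qed (use t in auto)
  finally show ?thesis by (simp add: Cd_def)
qed

end

section \<open>Lower bound for the minimax risk\<close>

text \<open>
The exponential family and the parameter set share the size \<open>M\<close> of the cube.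
\<close>

locale minimax_model = expfam_model h T A D M + star_body n M K
  for h T A D M n K
begin

abbreviation "data \<equiv> PiM {..<n} (\<lambda>_. borel :: real measure)"
abbreviation "Cd \<equiv> curv_max A (2 * M)"

lemma Cd_pos: "0 < Cd"
  using curv_min_pos curv_order by simp

lemma K_cube_point: "\<theta> \<in> K \<Longrightarrow> cube_point n \<theta>"
  using K_bound by (simp add: cube_point_def)

lemma prob_space_K: "\<theta> \<in> K \<Longrightarrow> prob_space (sample n \<theta>)"
  using prob_space_sample cube_point_admissible K_cube_point by blast

lemma edist2_measurable [measurable]:
  "(\<lambda>z. edist2 n z \<theta>) \<in> borel_measurable data"
  unfolding edist2_def L2_set_def by measurable

definition near :: "((nat \<Rightarrow> real) \<Rightarrow> point) \<Rightarrow> point \<Rightarrow> real \<Rightarrow> (nat \<Rightarrow> real) set"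
  where "near est \<theta> r = {y \<in> space data. edist2 n (est y) \<theta> < r}"

lemma near_sets [measurable]:
  assumes "est \<in> estimators n"
  shows "near est \<theta> r \<in> sets data"
proof -
  have [measurable]: "est \<in> data \<rightarrow>\<^sub>M data" using assms by (simp add: estimators_def)
  have "(\<lambda>y. edist2 n (est y) \<theta>) \<in> borel_measurable data" by measurable
  then show ?thesis unfolding near_def by measurable
qed

lemma worst_risk_ge_miss_probability:
  assumes "\<theta> \<in> K" "est \<in> estimators n" "0 \<le> r"
  shows "ennreal (r\<^sup>2 * (1 - measure (sample n \<theta>) (near est \<theta> r))) \<le> worst_risk n h T A K est"
proof -
  interpret prob_space "sample n \<theta>" by (rule prob_space_K) fact
  have B: "near est \<theta> r \<in> sets (sample n \<theta>)" using near_sets[OF assms(2)] by simp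
  have "ennreal (r\<^sup>2 * (1 - prob (near est \<theta> r))) = ennreal (r\<^sup>2) * emeasure (sample n \<theta>) (space (sample n \<theta>) - near est \<theta> r)"
    using prob_compl[OF B] by (simp add: emeasure_eq_measure ennreal_mult)
  also have "\<dots> = (\<integral>\<^sup>+y. ennreal (r\<^sup>2) * indicator (space (sample n \<theta>) - near est \<theta> r) y \<partial>sample n \<theta>)"
    using B by (subst nn_integral_cmult_indicator) auto
  also have "\<dots> \<le> (\<integral>\<^sup>+y. ennreal ((edist2 n (est y) \<theta>)\<^sup>2) \<partial>sample n \<theta>)"
  proof (rule nn_integral_mono)
    fix y
    show "ennreal (r\<^sup>2) * indicator (space (sample n \<theta>) - near est \<theta> r) y \<le> ennreal ((edist2 n (est y) \<theta>)\<^sup>2)"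
      using assms(3) by (auto simp: indicator_def near_def space_PiM not_less intro!: ennreal_leI power_mono)
  qed
  also have "\<dots> \<le> worst_risk n h T A K est"
    unfolding worst_risk_def using assms(1) by (rule SUP_upper)
  finally show ?thesis .
qed

text \<open>
An estimate cannot be within half the distance of both points.  If it is near \<open>\<eta>\<close> with high
probability under \<open>\<eta>\<close>, the change of measure inequality with \<open>t = 16\<close> makes it near \<open>\<eta>\<close>, hence
far from \<open>\<theta>\<close>, with probability at least 1/34 under \<open>\<theta>\<close>.
\<close>

lemma two_point_lower_bound:
  assumes K: "\<theta> \<in> K" "\<eta> \<in> K" and est: "est \<in> estimators n"
    and close: "Cd / 2 * (edist2 n \<eta> \<theta>)\<^sup>2 \<le> ln 2"
  shows "ennreal ((edist2 n \<eta> \<theta>)\<^sup>2 / 136) \<le> worst_risk n h T A K est"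
proof -
  define r where "r = edist2 n \<eta> \<theta> / 2"
  have r: "0 \<le> r" "(edist2 n \<eta> \<theta>)\<^sup>2 / 136 = r\<^sup>2 * (1 / 34)" by (auto simp: r_def power_divide)
  interpret P: prob_space "sample n \<theta>" by (rule prob_space_K) fact
  let ?B = "near est \<theta> r" and ?B' = "near est \<eta> r"
  have B: "?B \<in> sets data" "?B' \<in> sets data" using near_sets[OF est] by auto
  have disj: "?B \<inter> ?B' = {}"
  proof -
    have "2 * r < edist2 n \<eta> \<theta>" if "y \<in> ?B \<inter> ?B'" for y
      using that edist2_triangle[of n \<eta> \<theta> "est y"] edist2_commute[of n \<eta> "est y"]
      by (auto simp: near_def r_def)
    then show ?thesis by (auto simp: r_def)
  qed
  have "P.prob ?B + P.prob ?B' = P.prob (?B \<union> ?B')"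
    using B disj by (intro P.finite_measure_Union[symmetric]) auto
  also have "\<dots> \<le> 1" by simp
  finally have sum: "P.prob ?B' \<le> 1 - P.prob ?B" by simp
  have "measure (sample n \<eta>) ?B' \<le> 16 * P.prob ?B' + exp (Cd / 2 * (edist2 n \<eta> \<theta>)\<^sup>2) / sqrt 16"
    by (rule change_of_measure_inequality) (use K K_cube_point B in auto)
  also have "exp (Cd / 2 * (edist2 n \<eta> \<theta>)\<^sup>2) \<le> exp (ln 2)" using close by (subst exp_le_cancel_iff)
  finally have "measure (sample n \<eta>) ?B' \<le> 16 * P.prob ?B' + 1 / 2" by (simp add: divide_right_mono)
  then have "1 / 34 \<le> 1 - P.prob ?B \<or> 1 / 34 \<le> 1 - measure (sample n \<eta>) ?B'"
    using sum by linarith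
  then obtain \<zeta> where z: "\<zeta> \<in> K" "1 / 34 \<le> 1 - measure (sample n \<zeta>) (near est \<zeta> r)"
    using K by blast
  have "ennreal (r\<^sup>2 * (1 / 34)) \<le> ennreal (r\<^sup>2 * (1 - measure (sample n \<zeta>) (near est \<zeta> r)))"
    using z(2) by (intro ennreal_leI mult_left_mono) auto
  then show ?thesis
    using worst_risk_ge_miss_probability[OF z(1) est r(1)] unfolding r(2) by (rule order_trans)
qed

text \<open>
With \<open>t = N / 4\<close> every point \<open>p\<close> is recovered with probability at most \<open>N / 4\<close> times the
probability, under the reference \<open>\<theta>\<close>, of estimating near \<open>p\<close>, plus \<open>2 / N powr (1/4)\<close>.  The events
are disjoint, so on average over \<open>p\<close> the first part is at most 1/4; the second is at most 1/4
because \<open>4096 = 8 ^ 4\<close>.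
\<close>

lemma many_point_lower_bound:
  assumes \<theta>: "\<theta> \<in> K" and P: "finite P" "P \<subseteq> K" "4096 \<le> card P" and est: "est \<in> estimators n"
    and sep: "\<And>x y. x \<in> P \<Longrightarrow> y \<in> P \<Longrightarrow> x \<noteq> y \<Longrightarrow> 2 * r < edist2 n x y" and r: "0 \<le> r"
    and close: "\<And>x. x \<in> P \<Longrightarrow> Cd / 2 * (edist2 n x \<theta>)\<^sup>2 \<le> ln (card P) / 4"
  shows "ennreal (r\<^sup>2 / 2) \<le> worst_risk n h T A K est"
proof -
  define N where "N = real (card P)"
  have N: "4096 \<le> N" using P(3) by (simp add: N_def)
  \<comment> \<open>the fourth root of \<open>N\<close>\<close>
  define x where "x = exp (ln N / 4)"
  have x4: "x ^ 4 = N" using N by (simp add: x_def flip: exp_of_nat_mult)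
  have x8: "8 \<le> x"
    using x4 N power_le_imp_le_base[of 8 3 x] by (simp add: x_def)
  interpret Q: prob_space "sample n \<theta>" by (rule prob_space_K) fact
  let ?B = "\<lambda>p. near est p r"
  have B: "?B p \<in> sets data" for p using near_sets[OF est] by auto
  have disj: "disjoint_family_on ?B P"
  proof (unfold disjoint_family_on_def, intro ballI impI)
    fix p q assume pq: "p \<in> P" "q \<in> P" "p \<noteq> q"
    have "edist2 n p q < 2 * r" if "y \<in> ?B p \<inter> ?B q" for y
      using that edist2_triangle[of n p q "est y"] edist2_commute[of n p "est y"] by (auto simp: near_def)
    then show "?B p \<inter> ?B q = {}" using sep[OF pq] by fastforce
  qed
  have "(\<Sum>p\<in>P. Q.prob (?B p)) = Q.prob (\<Union>p\<in>P. ?B p)"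
    using B disj P(1) by (intro Q.finite_measure_finite_Union[symmetric]) auto
  also have "\<dots> \<le> 1" by simp
  finally have total: "(\<Sum>p\<in>P. Q.prob (?B p)) \<le> 1" .
  have one: "measure (sample n p) (?B p) \<le> N / 4 * Q.prob (?B p) + 1 / 4" if p: "p \<in> P" for p
  proof -
    have "sqrt (N / 4) = x\<^sup>2 / 2"
      using x4 by (intro real_sqrt_unique) (auto simp: power_divide simp flip: power_mult)
    moreover have "exp (Cd / 2 * (edist2 n p \<theta>)\<^sup>2) \<le> x"
      using close[OF p] by (simp add: x_def N_def)
    ultimately have "exp (Cd / 2 * (edist2 n p \<theta>)\<^sup>2) / sqrt (N / 4) \<le> x / (x\<^sup>2 / 2)"
      by (metis divide_right_mono zero_le_power2 half_gt_zero_iff divide_nonneg_pos zero_less_numeral)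
    also have "\<dots> \<le> 1 / 4" using x8 by (simp add: power2_eq_square field_simps)
    finally have "exp (Cd / 2 * (edist2 n p \<theta>)\<^sup>2) / sqrt (N / 4) \<le> 1 / 4" .
    moreover have "measure (sample n p) (?B p) \<le> N / 4 * Q.prob (?B p) + exp (Cd / 2 * (edist2 n p \<theta>)\<^sup>2) / sqrt (N / 4)"
      by (rule change_of_measure_inequality) (use p P \<theta> K_cube_point B N in auto)
    ultimately show ?thesis by linarith
  qed
  have "\<exists>p\<in>P. measure (sample n p) (?B p) \<le> 1 / 2"
  proof (rule ccontr)
    assume "\<not> ?thesis"
    then have "(\<Sum>p\<in>P. 1 / 2) < (\<Sum>p\<in>P. measure (sample n p) (?B p))"
      using P N by (intro sum_strict_mono) (auto simp: N_def)
    also have "\<dots> \<le> (\<Sum>p\<in>P. N / 4 * Q.prob (?B p) + 1 / 4)" by (intro sum_mono one)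
    also have "\<dots> = N / 4 * (\<Sum>p\<in>P. Q.prob (?B p)) + N / 4"
      by (simp add: sum.distrib sum_distrib_left N_def)
    also have "\<dots> \<le> N / 4 * 1 + N / 4"
      using total N by (intro add_mono mult_left_mono) auto
    finally show False by (simp add: N_def)
  qed
  then obtain p where p: "p \<in> P" "measure (sample n p) (?B p) \<le> 1 / 2" by blast
  have "ennreal (r\<^sup>2 / 2) \<le> ennreal (r\<^sup>2 * (1 - measure (sample n p) (?B p)))"
    using p(2) mult_left_mono[of "1/2" "1 - measure (sample n p) (?B p)" "r\<^sup>2"] by (intro ennreal_leI) auto
  also have "\<dots> \<le> worst_risk n h T A K est"
    using p P by (intro worst_risk_ge_miss_probability est r) auto
  finally show ?thesis .
qed

abbreviation eps_set :: "real \<Rightarrow> real \<Rightarrow> real set"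
  where "eps_set c k \<equiv> {\<epsilon>. \<epsilon> > 0 \<and> \<epsilon>\<^sup>2 * k \<le> ln (N_loc n K \<epsilon> c)}"

text \<open>
Beyond \<open>c\<close> times the diameter a single point covers everything and the entropy vanishes.
\<close>

lemma eps_set_le:
  assumes c: "0 < c" and k: "0 < k" and \<epsilon>: "\<epsilon> \<in> eps_set c k"
  shows "\<epsilon> \<le> c * diam2 n K"
proof (rule ccontr)
  assume "\<not> ?thesis"
  then have d: "diam2 n K \<le> \<epsilon> / c" using c by (simp add: field_simps)
  have "N_loc n K \<epsilon> c \<le> 1"
  proof (rule N_loc_least)
    fix \<theta> assume t: "\<theta> \<in> K"
    have "covering n (\<epsilon> / c) (ball2 n \<theta> \<epsilon> \<inter> K) {\<theta>}"
      using t \<epsilon> d edist2_le_diam2 in_ball2[OF t] by (force simp: covering_def)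
    then show "real (covering_number n (\<epsilon> / c) (ball2 n \<theta> \<epsilon> \<inter> K)) \<le> 1"
      using covering_number_le[of "{\<theta>}"] by fastforce
  qed
  then have "ln (N_loc n K \<epsilon> c) \<le> 0"
    using N_loc_ge_1[of \<epsilon> c] \<epsilon> c by simp
  moreover have "0 < \<epsilon>\<^sup>2 * k" using \<epsilon> k by simp
  ultimately show False using \<epsilon> by simp
qed

lemma eps_star_eq: "eps_set c k \<noteq> {} \<Longrightarrow> eps_star n K c k = Sup (eps_set c k)"
  unfolding eps_star_def Let_def by (rule if_not_P)

lemma eps_star_upper:
  assumes c: "0 < c" and k: "0 < k" and \<epsilon>: "\<epsilon> \<in> eps_set c k"
  shows "\<epsilon> \<le> eps_star n K c k"
proof -
  have "bdd_above (eps_set c k)" using eps_set_le[OF c k] by (rule bdd_aboveI)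
  then have "\<epsilon> \<le> Sup (eps_set c k)" by (rule cSup_upper[OF \<epsilon>])
  moreover have "eps_set c k \<noteq> {}" using \<epsilon> by blast
  ultimately show ?thesis using eps_star_eq by simp
qed

lemma eps_star_nonneg:
  assumes c: "0 < c" and k: "0 < k"
  shows "0 \<le> eps_star n K c k"
proof (cases "eps_set c k = {}")
  case True then show ?thesis by (simp add: eps_star_def)
next
  case False
  then obtain \<epsilon> where "\<epsilon> \<in> eps_set c k" by blast
  then show ?thesis using eps_star_upper[OF c k] by force
qed

lemma eps_star_approx:
  assumes c: "0 < c" and k: "0 < k" and pos: "0 < eps_star n K c k"
  obtains \<epsilon> where "\<epsilon> \<in> eps_set c k" "eps_star n K c k < 2 * \<epsilon>"
proof -
  have ne: "eps_set c k \<noteq> {}"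
    using pos unfolding eps_star_def by (auto simp: Let_def split: if_splits)
  then have eq: "eps_star n K c k = Sup (eps_set c k)" by (rule eps_star_eq)
  have "eps_star n K c k / 2 < Sup (eps_set c k)" using pos eq by simp
  then obtain \<epsilon> where "\<epsilon> \<in> eps_set c k" "eps_star n K c k / 2 < \<epsilon>"
    using less_cSupE[OF _ ne] by blast
  then show ?thesis using that by simp
qed

text \<open>
A contraction ratio that makes \<open>C'(M) / 2\<close> times the squared radius at most a quarter of the
entropy.
\<close>

definition shrink :: "real \<Rightarrow> real"
  where "shrink k = min 1 (sqrt (k / (2 * Cd)))"

text \<open>
The first term comes from the many-point bound, the second from the two-point bound.
\<close>

definition lower_const :: "real \<Rightarrow> real \<Rightarrow> real"
  where "lower_const c k = min ((shrink k)\<^sup>2 / (32 * c\<^sup>2)) (min (1 / 9) (k / (24 * Cd)) / 136)"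

lemma shrink: assumes "0 < k"
  shows "0 < shrink k" "shrink k \<le> 1" "Cd / 2 * (shrink k)\<^sup>2 \<le> k / 4"
proof -
  show s: "0 < shrink k" "shrink k \<le> 1" using assms Cd_pos by (auto simp: shrink_def)
  have "(shrink k)\<^sup>2 \<le> (sqrt (k / (2 * Cd)))\<^sup>2" using s by (intro power_mono) (auto simp: shrink_def)
  also have "\<dots> = k / (2 * Cd)" using assms Cd_pos by simp
  finally show "Cd / 2 * (shrink k)\<^sup>2 \<le> k / 4" using Cd_pos by (simp add: field_simps)
qed

lemma lower_const_pos: "0 < c \<Longrightarrow> 0 < k \<Longrightarrow> 0 < lower_const c k"
  using shrink(1)[of k] Cd_pos by (simp add: lower_const_def)

text \<open>
The hypotheses are a maximal packing of a ball that attains the local entropy, contracted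
towards the centre of \<open>K\<close> by \<open>shrink k\<close>.
\<close>

lemma lower_bound_large_entropy:
  assumes c: "0 < c" and k: "0 < k" and \<epsilon>: "\<epsilon> \<in> eps_set c k" and large: "4096 \<le> N_loc n K \<epsilon> c"
    and est: "est \<in> estimators n"
  shows "ennreal ((shrink k)\<^sup>2 * \<epsilon>\<^sup>2 / (8 * c\<^sup>2)) \<le> worst_risk n h T A K est"
proof -
  define s where "s = shrink k"
  note s = shrink[OF k, folded s_def]
  have e: "0 < \<epsilon>" "\<epsilon>\<^sup>2 * k \<le> ln (N_loc n K \<epsilon> c)" using \<epsilon> by auto
  obtain \<theta> where t: "\<theta> \<in> K"
    "N_loc n K \<epsilon> c = real (covering_number n (\<epsilon> / c) (ball2 n \<theta> \<epsilon> \<inter> K))"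
    using N_loc_attained[OF e(1) c] .
  obtain P where P: "finite P" "maximal_packing n (\<epsilon> / c) (ball2 n \<theta> \<epsilon> \<inter> K) P"
    using maximal_packing_ex[of "\<epsilon> / c" "ball2 n \<theta> \<epsilon> \<inter> K"] e c by auto
  have "covering_number n (\<epsilon> / c) (ball2 n \<theta> \<epsilon> \<inter> K) \<le> card P"
    using P e c maximal_packing_covering by (intro covering_number_le) auto
  then have N: "N_loc n K \<epsilon> c \<le> real (card P)" using t(2) by simp
  have PK: "x \<in> K" "edist2 n \<theta> x \<le> \<epsilon>" if "x \<in> P" for x
    using P(2) that in_ball2[of x] by (auto simp: maximal_packing_def packing_def)
  have sepP: "\<epsilon> / c < edist2 n x y" if "x \<in> P" "y \<in> P" "x \<noteq> y" for x y
    using P(2) that by (auto simp: maximal_packing_def packing_def)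
  let ?g = "contract n s centre"
  have dist: "edist2 n (?g x) (?g y) = s * edist2 n x y" for x y
    using edist2_contract s(1) by simp
  have inj: "inj_on ?g P"
  proof (rule inj_onI, rule ccontr)
    fix x y assume xy: "x \<in> P" "y \<in> P" "?g x = ?g y" "x \<noteq> y"
    have "0 < edist2 n x y"
      using sepP[OF xy(1,2,4)] e(1) c by (meson divide_pos_pos less_trans)
    then show False using dist[of x y] xy(3) s(1) by simp
  qed
  define r where "r = s * \<epsilon> / (2 * c)"
  have "ennreal (r\<^sup>2 / 2) \<le> worst_risk n h T A K est"
  proof (rule many_point_lower_bound[where \<theta> = "?g \<theta>" and P = "?g ` P"])
    show "?g \<theta> \<in> K" using centre(2) t s by simp
    show "?g ` P \<subseteq> K" using centre(2) PK s by auto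
    show "4096 \<le> card (?g ` P)" using N large by (simp add: card_image[OF inj])
    show "2 * r < edist2 n x y" if xy: "x \<in> ?g ` P" "y \<in> ?g ` P" "x \<noteq> y" for x y
    proof -
      obtain u v where uv: "u \<in> P" "v \<in> P" "x = ?g u" "y = ?g v" using xy by blast
      then have "u \<noteq> v" using xy by blast
      then show ?thesis
        using mult_strict_left_mono[OF sepP[OF uv(1,2) \<open>u \<noteq> v\<close>] s(1)] uv(3,4) by (simp add: dist r_def)
    qed
    show "Cd / 2 * (edist2 n x (?g \<theta>))\<^sup>2 \<le> ln (real (card (?g ` P))) / 4" if x: "x \<in> ?g ` P" for x
    proof -
      obtain u where u: "u \<in> P" "x = ?g u" using x by blast
      have "edist2 n x (?g \<theta>) \<le> s * \<epsilon>"
        using PK(2)[OF u(1)] s(1) by (simp add: u(2) dist edist2_commute[of n u])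
      then have "(edist2 n x (?g \<theta>))\<^sup>2 \<le> (s * \<epsilon>)\<^sup>2" by (intro power_mono) auto
      then have "Cd / 2 * (edist2 n x (?g \<theta>))\<^sup>2 \<le> Cd / 2 * (s * \<epsilon>)\<^sup>2"
        using Cd_pos by (intro mult_left_mono) auto
      also have "\<dots> = (Cd / 2 * s\<^sup>2) * \<epsilon>\<^sup>2" by (simp add: power_mult_distrib)
      also have "\<dots> \<le> k / 4 * \<epsilon>\<^sup>2" using s(3) by (intro mult_right_mono) auto
      also have "\<dots> \<le> ln (N_loc n K \<epsilon> c) / 4" using e(2) by (simp add: mult.commute)
      also have "\<dots> \<le> ln (real (card P)) / 4" using N large by simp
      finally show ?thesis by (simp add: card_image[OF inj])
    qed
  qed (use P est s c e in \<open>auto simp: r_def\<close>)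
  moreover have "r\<^sup>2 / 2 = s\<^sup>2 * \<epsilon>\<^sup>2 / (8 * c\<^sup>2)"
    by (simp add: r_def power_divide power_mult_distrib)
  ultimately show ?thesis by (simp add: s_def)
qed

text \<open>
The pair consists of the centre of \<open>K\<close> and a point on the segment to a far point, at a distance
where both laws are still hard to tell apart.
\<close>

lemma lower_bound_two_points:
  assumes d: "0 < diam2 n K" and est: "est \<in> estimators n"
  shows "ennreal (min ((diam2 n K)\<^sup>2 / 9) (2 * ln 2 / Cd) / 136) \<le> worst_risk n h T A K est"
proof -
  obtain x where x: "x \<in> K" "diam2 n K / 3 \<le> edist2 n centre x"
    using far_point[OF d] by blast
  define e where "e = edist2 n centre x"
  have e: "0 < e" "diam2 n K / 3 \<le> e" using x d by (auto simp: e_def)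
  define \<rho> where "\<rho> = min e (sqrt (2 * ln 2 / Cd))"
  have \<rho>: "0 < \<rho>" "\<rho> \<le> e" "\<rho> \<le> sqrt (2 * ln 2 / Cd)" using e Cd_pos by (auto simp: \<rho>_def)
  let ?\<eta> = "contract n (\<rho> / e) centre x"
  have \<eta>: "?\<eta> \<in> K" using x \<rho> e by (intro centre(2)) auto
  have dist: "edist2 n ?\<eta> centre = \<rho>"
    using edist2_contract_centre[of "\<rho> / e" n centre x] \<rho> e
    by (simp add: edist2_commute[of n _ centre] e_def[symmetric])
  have "\<rho>\<^sup>2 \<le> (sqrt (2 * ln 2 / Cd))\<^sup>2" using \<rho> by (intro power_mono) auto
  then have "Cd / 2 * \<rho>\<^sup>2 \<le> ln 2" using Cd_pos by (simp add: field_simps)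
  then have bound: "ennreal (\<rho>\<^sup>2 / 136) \<le> worst_risk n h T A K est"
    using two_point_lower_bound[OF centre(1) \<eta> est] dist by simp
  have "min ((diam2 n K)\<^sup>2 / 9) (2 * ln 2 / Cd) \<le> \<rho>\<^sup>2"
  proof (cases "e \<le> sqrt (2 * ln 2 / Cd)")
    case True
    have "(diam2 n K / 3)\<^sup>2 \<le> e\<^sup>2" using e d by (intro power_mono) auto
    then show ?thesis using True by (simp add: \<rho>_def power_divide min.coboundedI1)
  next
    case False
    then have "\<rho>\<^sup>2 = 2 * ln 2 / Cd" using Cd_pos by (simp add: \<rho>_def)
    then show ?thesis by simp
  qed
  then have "ennreal (min ((diam2 n K)\<^sup>2 / 9) (2 * ln 2 / Cd) / 136) \<le> ennreal (\<rho>\<^sup>2 / 136)"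
    by (intro ennreal_leI) simp
  then show ?thesis using bound by (rule order_trans)
qed

text \<open>
Either the entropy near the critical radius is large enough for many hypotheses, or it is below
\<open>ln 4096\<close>; in that case \<open>\<epsilon>\<^sup>2 \<kappa>\<close> is bounded and two points give the order of
\<open>min (diam\<^sup>2) (1 / \<kappa>)\<close>.
\<close>

lemma minimax_lower_bound:
  assumes c: "0 < c" and k: "0 < k"
  shows "ennreal (lower_const c k * min ((eps_star n K c k)\<^sup>2) ((diam2 n K)\<^sup>2))
    \<le> minimax_risk n h T A K"
  unfolding minimax_risk_def
proof (rule INF_greatest)
  fix est assume est: "est \<in> estimators n"
  let ?e = "eps_star n K c k" and ?d = "diam2 n K"
  show "ennreal (lower_const c k * min (?e\<^sup>2) (?d\<^sup>2)) \<le> worst_risk n h T A K est"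
  proof (cases "?e = 0 \<or> ?d = 0")
    case True then show ?thesis by auto
  next
    case False
    then have pos: "0 < ?e" "0 < ?d"
      using eps_star_nonneg[OF c k] diam2_nonneg by auto
    obtain \<epsilon> where \<epsilon>: "\<epsilon> \<in> eps_set c k" "?e < 2 * \<epsilon>"
      using eps_star_approx[OF c k pos(1)] .
    have "?e\<^sup>2 \<le> (2 * \<epsilon>)\<^sup>2" using \<epsilon>(2) pos by (intro power_mono) auto
    then have e4: "?e\<^sup>2 \<le> 4 * \<epsilon>\<^sup>2" by (simp add: power_mult_distrib)
    show ?thesis
    proof (cases "4096 \<le> N_loc n K \<epsilon> c")
      case True
      have "lower_const c k * min (?e\<^sup>2) (?d\<^sup>2) \<le> (shrink k)\<^sup>2 / (32 * c\<^sup>2) * (4 * \<epsilon>\<^sup>2)"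
        using e4 by (intro mult_mono) (auto simp: lower_const_def)
      also have "\<dots> = (shrink k)\<^sup>2 * \<epsilon>\<^sup>2 / (8 * c\<^sup>2)" by simp
      finally show ?thesis
        using lower_bound_large_entropy[OF c k \<epsilon>(1) True est] by (meson ennreal_leI order_trans)
    next
      case False
      have "0 < N_loc n K \<epsilon> c" using N_loc_ge_1[of \<epsilon> c] \<epsilon> c by force
      then have "ln (N_loc n K \<epsilon> c) \<le> ln 4096" using False by (subst ln_le_cancel_iff) auto
      also have "ln 4096 = 12 * ln (2::real)" using ln_realpow[of 2 12] by simp
      finally have "\<epsilon>\<^sup>2 * k \<le> 12 * ln 2" using \<epsilon>(1) by simp
      then have "\<epsilon>\<^sup>2 \<le> 12 * ln 2 / k" using k by (simp add: field_simps)
      then have e48: "?e\<^sup>2 \<le> 48 * ln 2 / k" using e4 by simp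
      define q where "q = min (1 / 9) (k / (24 * Cd))"
      have q: "0 \<le> q" "q \<le> 1 / 9" "q \<le> k / (24 * Cd)" using k Cd_pos by (auto simp: q_def)
      have "q * min (?e\<^sup>2) (?d\<^sup>2) \<le> min (?d\<^sup>2 / 9) (2 * ln 2 / Cd)"
      proof (rule min.boundedI)
        have "q * min (?e\<^sup>2) (?d\<^sup>2) \<le> 1 / 9 * ?d\<^sup>2" using q by (intro mult_mono) auto
        then show "q * min (?e\<^sup>2) (?d\<^sup>2) \<le> ?d\<^sup>2 / 9" by simp
        have "q * min (?e\<^sup>2) (?d\<^sup>2) \<le> k / (24 * Cd) * (48 * ln 2 / k)"
          using q e48 k Cd_pos by (intro mult_mono) (auto simp: min.coboundedI1)
        also have "\<dots> = 2 * ln 2 / Cd" using k Cd_pos by (simp add: field_simps)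
        finally show "q * min (?e\<^sup>2) (?d\<^sup>2) \<le> 2 * ln 2 / Cd" .
      qed
      moreover have "lower_const c k \<le> q / 136"
        unfolding lower_const_def q_def by (rule min.cobounded2)
      then have "lower_const c k * min (?e\<^sup>2) (?d\<^sup>2) \<le> q / 136 * min (?e\<^sup>2) (?d\<^sup>2)"
        by (rule mult_right_mono) simp
      ultimately have "lower_const c k * min (?e\<^sup>2) (?d\<^sup>2) \<le> min (?d\<^sup>2 / 9) (2 * ln 2 / Cd) / 136"
        by simp
      then show ?thesis
        using lower_bound_two_points[OF pos(2) est] by (meson ennreal_leI order_trans)
    qed
  qed
qed

end

section \<open>The pruned packing tree\<close>

text \<open>
Two distinct points have a first coordinate in which they differ, because coordinates are
indexed by natural numbers.
\<close>

lemma less_fun_total: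
  fixes x y :: point
  assumes "x \<noteq> y"
  shows "less_fun x y \<or> less_fun y x"
proof -
  define k where "k = (LEAST k. x k \<noteq> y k)"
  obtain j where "x j \<noteq> y j" using assms by blast
  then have ne: "x k \<noteq> y k" unfolding k_def by (rule LeastI)
  have eq: "x j = y j" if "j < k" for j using not_less_Least[OF that[unfolded k_def]] by simp
  have "less_fun x y" if "x k < y k" using that eq by (intro less_funI exI[of _ k]) simp
  moreover have "less_fun y x" if "y k < x k" using that eq by (intro less_funI exI[of _ k]) simp
  ultimately show ?thesis using ne by linarith
qed

lemma lex_first_least:
  assumes "finite S" "S \<noteq> {}"
  shows "lex_first S \<in> S"
proof -
  have "\<exists>u\<in>S. \<forall>v\<in>S. v \<noteq> u \<longrightarrow> less_fun u v"
    using assms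
  proof (induction rule: finite_ne_induct)
    case (insert x F)
    then obtain m where m: "m \<in> F" "\<And>v. v \<in> F \<Longrightarrow> v \<noteq> m \<Longrightarrow> less_fun m v" by blast
    show ?case
    proof (cases "less_fun x m")
      case True
      then have "less_fun x v" if "v \<in> F" for v
        using m(2)[OF that] less_fun_trans by (cases "v = m") blast+
      then show ?thesis by blast
    next
      case False
      then have "x = m \<or> less_fun m x" using less_fun_total by blast
      then have "\<forall>v\<in>insert x F. v \<noteq> m \<longrightarrow> less_fun m v" using m(2) by auto
      then show ?thesis using m(1) by (intro bexI[of _ m]) auto
    qed
  qed auto
  then obtain u where u: "u \<in> S" "\<And>v. v \<in> S \<Longrightarrow> v \<noteq> u \<Longrightarrow> less_fun u v" by blast
  have "lex_first S = u"
    unfolding lex_first_def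
  proof (rule the_equality)
    show "u \<in> S \<and> (\<forall>v\<in>S. v \<noteq> u \<longrightarrow> less_fun u v)" using u by simp
    fix w assume w: "w \<in> S \<and> (\<forall>v\<in>S. v \<noteq> w \<longrightarrow> less_fun w v)"
    show "w = u"
    proof (rule ccontr)
      assume "w \<noteq> u"
      then have "less_fun w u" "less_fun u w" using w u by auto
      then show False using less_fun_asym by auto
    qed
  qed
  then show ?thesis using u(1) by simp
qed

lemma lex_argmin_minimises:
  assumes "finite S" "S \<noteq> {}"
  shows "lex_argmin g S \<in> S" "b \<in> S \<Longrightarrow> g (lex_argmin g S) \<le> g b"
proof -
  let ?A = "{a \<in> S. \<forall>b\<in>S. g a \<le> g b}"
  have "Min (g ` S) \<in> g ` S" using assms by (intro Min_in) auto
  then obtain a where "a \<in> S" "g a = Min (g ` S)" by (metis imageE)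
  then have "a \<in> ?A" using assms by auto
  then have "?A \<noteq> {}" by blast
  then have "lex_argmin g S \<in> ?A"
    unfolding lex_argmin_def using assms(1) by (intro lex_first_least) auto
  then show "lex_argmin g S \<in> S" "b \<in> S \<Longrightarrow> g (lex_argmin g S) \<le> g b" by auto
qed

lemma prune_exists:
  assumes "finite U" "0 \<le> \<delta>"
  shows "\<exists>E. prune n \<delta> U E"
  using assms(1)
proof (induction U rule: finite_psubset_induct)
  case (psubset U)
  show ?case
  proof (cases "U = {}")
    case True then show ?thesis using prune.empty by blast
  next
    case False
    define u where "u = lex_first (snd ` U)"
    define near where "near = {(v, u') \<in> U. edist2 n u u' \<le> \<delta>}"
    have "u \<in> snd ` U" unfolding u_def using psubset False by (intro lex_first_least) auto
    then obtain v where "(v, u) \<in> near" using assms(2) by (auto simp: near_def)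
    then have "(v, u) \<in> U" "(v, u) \<notin> U - near" by (auto simp: near_def)
    then have "U - near \<subset> U" by blast
    then obtain E where "prune n \<delta> (U - near) E" using psubset by blast
    then show ?thesis using prune.step[OF False u_def near_def] by blast
  qed
qed

lemma prune_finite: "prune n \<delta> U E \<Longrightarrow> finite U \<Longrightarrow> finite E"
proof (induction rule: prune.induct)
  case (step U u near E)
  have "near \<subseteq> U" using step.hyps(3) by auto
  then show ?case using step.IH step.prems finite_subset by auto
qed simp

lemma prune_nodes: "prune n \<delta> U E \<Longrightarrow> finite U \<Longrightarrow> snd ` E \<subseteq> snd ` U"
proof (induction rule: prune.induct)
  case (step U u near E)
  have "u \<in> snd ` U" unfolding step.hyps(2) using step by (intro lex_first_least) auto
  moreover have "snd ` E \<subseteq> snd ` U" using step.IH step.prems by auto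
  moreover have "snd ` ((\<lambda>(v, u'). (v, u)) ` near \<union> E) \<subseteq> insert u (snd ` E)" by auto
  ultimately show ?case by blast
qed simp

text \<open>
A candidate disappears only by being merged, for the same parent, into a node within \<open>\<delta>\<close>.  So
pruning preserves coverings, at twice the scale.
\<close>

lemma prune_keeps_near:
  "prune n \<delta> U E \<Longrightarrow> (v, u') \<in> U \<Longrightarrow> \<exists>u. (v, u) \<in> E \<and> edist2 n u u' \<le> \<delta>"
proof (induction rule: prune.induct)
  case (step U u near E)
  show ?case
  proof (cases "(v, u') \<in> near")
    case True
    then show ?thesis using step.hyps(3) by force
  next
    case False
    then show ?thesis using step by blast
  qed
qed simp

lemma prune_origin:
  "prune n \<delta> U E \<Longrightarrow> (v, u) \<in> E \<Longrightarrow> \<exists>u'. (v, u') \<in> U \<and> edist2 n u u' \<le> \<delta>"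
proof (induction rule: prune.induct)
  case (step U u' near E)
  then show ?case by auto
qed simp

text \<open>
A selected node removes everything within \<open>\<delta>\<close> of it from the rest of the loop.
\<close>

lemma prune_separated:
  "prune n \<delta> U E \<Longrightarrow> finite U \<Longrightarrow> x \<in> snd ` E \<Longrightarrow> y \<in> snd ` E \<Longrightarrow> x \<noteq> y \<Longrightarrow> \<delta> < edist2 n x y"
proof (induction rule: prune.induct)
  case (step U u near E)
  have far: "\<delta> < edist2 n u z" if "z \<in> snd ` E" for z
  proof -
    have "z \<in> snd ` (U - near)" using prune_nodes[OF step.hyps(4)] step.prems(1) that by auto
    then obtain v where "(v, z) \<in> U" "(v, z) \<notin> near" by auto
    then show ?thesis unfolding step.hyps(3) by auto
  qed
  have cases: "z = u \<or> z \<in> snd ` E" if "z \<in> snd ` ((\<lambda>(v, u'). (v, u)) ` near \<union> E)" for z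
    using that by auto
  have IH: "\<delta> < edist2 n x y" if "x \<in> snd ` E" "y \<in> snd ` E"
    using step.IH step.prems(1,4) that by simp
  show ?case
    using cases[OF step.prems(2)] cases[OF step.prems(3)]
  proof (elim disjE)
    assume "x = u" "y = u" then show ?thesis using step.prems(4) by simp
  next
    assume "x = u" "y \<in> snd ` E" then show ?thesis using far by simp
  next
    assume "x \<in> snd ` E" "y = u" then show ?thesis using far[of x] edist2_commute[of n x y] by simp
  qed (rule IH)
qed simp

text \<open>
All edges of a parent that are redirected in one step end in the same node.
\<close>

lemma prune_offspring_card:
  "prune n \<delta> U E \<Longrightarrow> finite U \<Longrightarrow> card {w. (v, w) \<in> E} \<le> card {w. (v, w) \<in> U}"
proof (induction rule: prune.induct)
  case (step U u near E)
  have fin: "finite {w. (v, w) \<in> V}" if "V \<subseteq> U" for V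
    using finite_subset[OF that step.prems] by (rule finite_subset[rotated, OF finite_imageI[of _ snd]]) force
  have nU: "near \<subseteq> U" using step.hyps(3) by auto
  let ?new = "{w. (v, w) \<in> (\<lambda>(v, u'). (v, u)) ` near}"
  have new: "card ?new \<le> card {w. (v, w) \<in> near}"
  proof (cases "{w. (v, w) \<in> near} = {}")
    case True
    then have "?new = {}" by auto
    then show ?thesis by simp
  next
    case False
    have "?new \<subseteq> {u}" by auto
    then have "card ?new \<le> 1" using card_mono[of "{u}" ?new] by simp
    also have "1 \<le> card {w. (v, w) \<in> near}"
      using False fin[OF nU] by (simp add: Suc_leI card_gt_0_iff)
    finally show ?thesis .
  qed
  have "card {w. (v, w) \<in> (\<lambda>(v, u'). (v, u)) ` near \<union> E} = card (?new \<union> {w. (v, w) \<in> E})"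
    by (rule arg_cong[where f = card]) auto
  also have "\<dots> \<le> card ?new + card {w. (v, w) \<in> E}" by (rule card_Un_le)
  also have "\<dots> \<le> card {w. (v, w) \<in> near} + card {w. (v, w) \<in> U - near}"
    using new step.IH step.prems by simp
  also have "\<dots> = card ({w. (v, w) \<in> near} \<union> {w. (v, w) \<in> U - near})"
    using fin[OF nU] fin[of "U - near"] by (intro card_Un_disjoint[symmetric]) auto
  also have "{w. (v, w) \<in> near} \<union> {w. (v, w) \<in> U - near} = {w. (v, w) \<in> U}" using nU by auto
  finally show ?case .
qed simp

context star_body begin

abbreviation "diam \<equiv> diam2 n K"

lemma zero_diameter: "diam = 0 \<Longrightarrow> x \<in> K \<Longrightarrow> x = centre"
  using edist2_le_diam2[OF _ centre(1)] edist2_eq_0_iff K_ext centre(1)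
  by (metis antisym edist2_nonneg)

text \<open>
For \<open>diam = 0\<close> the scale is zero and the grid argument fails, but then \<open>K\<close> is a single point.
Scales are therefore given relative to the diameter, as in the construction of the tree.
\<close>

lemma relative_packing_bounded:
  assumes "0 < q"
  obtains B where "\<And>S P. S \<subseteq> K \<Longrightarrow> packing n (diam / q) S P \<Longrightarrow> finite P \<and> card P \<le> B"
proof (cases "diam = 0")
  case True
  have "finite P \<and> card P \<le> 1" if "S \<subseteq> K" "packing n (diam / q) S P" for S P
  proof -
    have "P \<subseteq> {centre}" using that zero_diameter[OF True] by (auto simp: packing_def)
    then show ?thesis using card_mono[of "{centre}" P] finite_subset[of P "{centre}"] by simp
  qed
  then show ?thesis using that by blast
next
  case False
  then have "0 < diam / q" using diam2_nonneg assms by simp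
  then show ?thesis using packing_bounded that by blast
qed

lemma relative_maximal_packing:
  assumes "0 < q" "S \<subseteq> K"
  shows "\<exists>P. maximal_packing n (diam / q) S P"
proof -
  obtain B where "\<And>S P. S \<subseteq> K \<Longrightarrow> packing n (diam / q) S P \<Longrightarrow> finite P \<and> card P \<le> B"
    using relative_packing_bounded[OF assms(1)] by blast
  then show ?thesis using maximal_packing_exists[of n "diam / q" S B] assms(2) by blast
qed

lemma relative_packing_finite:
  assumes "0 < q" "S \<subseteq> K" "maximal_packing n (diam / q) S P"
  shows "finite P"
  using relative_packing_bounded[OF assms(1)] assms(2,3) by (metis maximal_packing_def)

text \<open>
The tree is grown level by level with dependent choice.  The invariant \<open>I\<close> keeps every edge set
finite, so that each pruning loop terminates, and fixes the root edges.
\<close>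

lemma pruned_tree_exists:
  assumes c: "0 < c"
  shows "\<exists>E. pruned_tree n K c centre E"
proof -
  define Q where "Q = (\<lambda>(k::nat) (X :: (point \<times> point) set) Y. \<exists>P. (\<forall>u\<in>snd ` X. maximal_packing n (diam / (2 ^ (k + 2) * c)) (ball2 n u (diam / 2 ^ (k + 1)) \<inter> K) (P u)) \<and>
      prune n (diam / (2 ^ (k + 2) * c)) (SIGMA u:snd ` X. P u) Y)"
  define I where "I = (\<lambda>(k::nat) X. finite X \<and> snd ` X \<subseteq> K \<and>
    (k = 0 \<longrightarrow> (\<exists>P. maximal_packing n (diam / c) (ball2 n centre diam \<inter> K) P \<and> X = {centre} \<times> P)))"
  have "\<exists>f. \<forall>k. I k (f k) \<and> Q k (f k) (f (Suc k))"
  proof (rule dependent_nat_choice)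
    obtain P where P: "maximal_packing n (diam / c) (ball2 n centre diam \<inter> K) P"
      using relative_maximal_packing[OF c, of "ball2 n centre diam \<inter> K"] by blast
    have "finite P" using relative_packing_finite[OF c _ P] by simp
    then show "\<exists>X. I 0 X"
      unfolding I_def using P by (intro exI[of _ "{centre} \<times> P"]) (auto simp: maximal_packing_def packing_def)
  next
    fix X :: "(point \<times> point) set" and k assume X: "I k X"
    have pos: "0 < 2 ^ (k + 2) * c" using c by simp
    have "\<forall>u. \<exists>P. maximal_packing n (diam / (2 ^ (k + 2) * c)) (ball2 n u (diam / 2 ^ (k + 1)) \<inter> K) P"
      using relative_maximal_packing[OF pos] by simp
    then obtain P where P: "\<And>u. maximal_packing n (diam / (2 ^ (k + 2) * c)) (ball2 n u (diam / 2 ^ (k + 1)) \<inter> K) (P u)"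
      by metis
    have finP: "finite (P u)" for u using relative_packing_finite[OF pos _ P[of u]] by simp
    have PK: "P u \<subseteq> K" for u using P[of u] by (auto simp: maximal_packing_def packing_def)
    have finU: "finite (SIGMA u:snd ` X. P u)" using X finP by (simp add: I_def)
    have "0 \<le> diam / (2 ^ (k + 2) * c)" using diam2_nonneg c by simp
    then obtain Y where Y: "prune n (diam / (2 ^ (k + 2) * c)) (SIGMA u:snd ` X. P u) Y"
      using prune_exists[OF finU] by blast
    have UK: "snd ` (SIGMA u:snd ` X. P u) \<subseteq> K"
    proof (rule image_subsetI)
      fix x assume "x \<in> (SIGMA u:snd ` X. P u)"
      then show "snd x \<in> K" using PK by (cases x) auto
    qed
    have "finite Y" by (rule prune_finite[OF Y finU])
    moreover have "snd ` Y \<subseteq> K" using prune_nodes[OF Y finU] UK by (rule subset_trans)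
    ultimately have "I (Suc k) Y" by (simp add: I_def)
    then show "\<exists>Y. I (Suc k) Y \<and> Q k X Y" unfolding Q_def using P Y by (intro exI[of _ Y] conjI exI[of _ P]) auto
  qed
  then obtain f where f: "\<And>k. I k (f k)" "\<And>k. Q k (f k) (f (Suc k))" by blast
  define E where "E = (\<lambda>k::nat. f (k - 1))"
  have "pruned_tree n K c centre E"
    unfolding pruned_tree_def Let_def
  proof (intro conjI allI impI)
    show "\<exists>P. maximal_packing n (diam / c) (ball2 n centre diam \<inter> K) P \<and> E 1 = {centre} \<times> P"
      using f(1)[of 0] by (simp add: E_def I_def)
    fix k :: nat assume k: "3 \<le> k"
    then obtain j where j: "k = j + 3" by (metis add.commute le_Suc_ex)
    have L: "level centre E (k - 1) = snd ` f j" by (simp add: j level_def E_def)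
    have "k - 1 = j + 2" "k - 2 = j + 1" "E (k - 1) = f (Suc j)" by (auto simp: j E_def)
    then show "\<exists>P. (\<forall>u\<in>level centre E (k - 1).
           maximal_packing n (diam / (2 ^ (k - 1) * c)) (ball2 n u (diam / 2 ^ (k - 2)) \<inter> K) (P u)) \<and>
        prune n (diam / (2 ^ (k - 1) * c)) (SIGMA u:level centre E (k - 1). P u) (E (k - 1))"
      using f(2)[of j] unfolding L Q_def by simp
  qed (rule centre)
  then show ?thesis by blast
qed

end

text \<open>
Everything about the shape of the tree holds without reference to the data.
\<close>

locale tree_body = star_body n M K for n M K +
  fixes c :: real and r :: point and E :: "nat \<Rightarrow> (point \<times> point) set"
  assumes c_ge: "1 \<le> c" and tree: "pruned_tree n K c r E"
begin

text \<open>
The radius of the balls that are packed around the nodes of level \<open>k\<close>; it is also the accuracy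
that a path on the right track has reached there.
\<close>

definition radius :: "nat \<Rightarrow> real"
  where "radius k = diam / 2 ^ (k - 1)"

lemma radius_nonneg: "0 \<le> radius k"
  using diam2_nonneg by (simp add: radius_def)

lemma radius_Suc: "1 \<le> k \<Longrightarrow> radius (Suc k) = radius k / 2"
  by (cases k) (auto simp: radius_def)

lemma radius_1: "radius 1 = diam"
  by (simp add: radius_def)

lemma root: "r \<in> K"
  using tree by (auto simp: pruned_tree_def Let_def)

lemma first_edges: obtains P where
  "maximal_packing n (radius 1 / c) (ball2 n r (radius 1) \<inter> K) P" "E 1 = {r} \<times> P"
proof -
  have "\<exists>P. maximal_packing n (radius 1 / c) (ball2 n r (radius 1) \<inter> K) P \<and> E 1 = {r} \<times> P"
    using tree unfolding pruned_tree_def Let_def radius_1 by (elim conjE)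
  then show thesis using that by metis
qed

lemma later_edges:
  assumes "2 \<le> k"
  obtains P where
    "\<And>u. u \<in> level r E k \<Longrightarrow> maximal_packing n (radius k / (2 * c)) (ball2 n u (radius k) \<inter> K) (P u)"
    "prune n (radius k / (2 * c)) (SIGMA u:level r E k. P u) (E k)"
proof -
  obtain j where j: "k = Suc (Suc j)" using assms by (metis add_2_eq_Suc le_Suc_ex)
  have "\<exists>P. (\<forall>u\<in>level r E k.
         maximal_packing n (diam / (2 ^ k * c)) (ball2 n u (diam / 2 ^ (k - 1)) \<inter> K) (P u)) \<and>
      prune n (diam / (2 ^ k * c)) (SIGMA u:level r E k. P u) (E k)"
    using tree unfolding pruned_tree_def Let_def j by (force dest: spec[of _ "Suc (Suc (Suc j))"])
  moreover have "diam / (2 ^ k * c) = radius k / (2 * c)" by (simp add: j radius_def)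
  ultimately show ?thesis using that unfolding radius_def by metis
qed

lemma level_1: "level r E 1 = {r}"
  by (simp add: level_def)

lemma level_Suc: "1 \<le> k \<Longrightarrow> level r E (Suc k) = snd ` E k"
  by (simp add: level_def)

lemma child_packing_finite:
  assumes "2 \<le> k" "u \<in> level r E k" "maximal_packing n (radius k / (2 * c)) (ball2 n u (radius k) \<inter> K) P"
  shows "finite P"
proof -
  have "radius k / (2 * c) = diam / (2 ^ (k - 1) * (2 * c))" by (simp add: radius_def)
  moreover have "0 < 2 ^ (k - 1) * (2 * c)" using c_ge by simp
  ultimately show ?thesis using relative_packing_finite[OF _ Int_lower2] assms(3) by metis
qed

lemma level_finite_subset: "1 \<le> k \<Longrightarrow> finite (level r E k) \<and> finite (E k) \<and> level r E k \<subseteq> K \<and> snd ` E k \<subseteq> K"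
proof (induction k rule: nat_induct_at_least)
  case base
  obtain P where P: "maximal_packing n (radius 1 / c) (ball2 n r (radius 1) \<inter> K) P" "E 1 = {r} \<times> P"
    using first_edges .
  have "finite P" using relative_packing_finite[OF _ Int_lower2 P(1)[unfolded radius_1]] c_ge by simp
  have "P \<subseteq> K" using P(1) by (simp add: maximal_packing_def packing_def)
  then show ?case using P(2) root \<open>finite P\<close> unfolding level_1 by auto
next
  case (Suc k)
  have L: "finite (level r E (Suc k))" "level r E (Suc k) \<subseteq> K" using Suc by (auto simp: level_Suc)
  have "2 \<le> Suc k" using Suc by simp
  then obtain P where P:
    "\<And>u. u \<in> level r E (Suc k) \<Longrightarrow> maximal_packing n (radius (Suc k) / (2 * c)) (ball2 n u (radius (Suc k)) \<inter> K) (P u)"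
    "prune n (radius (Suc k) / (2 * c)) (SIGMA u:level r E (Suc k). P u) (E (Suc k))"
    using later_edges by blast
  have finU: "finite (SIGMA u:level r E (Suc k). P u)"
    using L(1) child_packing_finite[OF \<open>2 \<le> Suc k\<close>] P(1) by blast
  have PK: "P u \<subseteq> K" if "u \<in> level r E (Suc k)" for u
    using P(1)[OF that] by (auto simp: maximal_packing_def packing_def)
  have "snd ` (SIGMA u:level r E (Suc k). P u) \<subseteq> K"
  proof (rule image_subsetI)
    fix x assume "x \<in> (SIGMA u:level r E (Suc k). P u)"
    then show "snd x \<in> K" using PK by (cases x) auto
  qed
  with prune_nodes[OF P(2) finU] have "snd ` E (Suc k) \<subseteq> K" by (rule subset_trans)
  then show ?case using L prune_finite[OF P(2) finU] by simp
qed

lemma offspring_finite: "1 \<le> k \<Longrightarrow> finite (offspring E k u)"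
  using level_finite_subset[of k] unfolding offspring_def
  by (intro finite_subset[of "{w. (u, w) \<in> E k}" "snd ` E k"]) force+

lemma offspring_level: "1 \<le> k \<Longrightarrow> offspring E k u \<subseteq> level r E (Suc k)"
  by (force simp: level_Suc offspring_def)

lemma level_K: "1 \<le> k \<Longrightarrow> u \<in> level r E k \<Longrightarrow> u \<in> K"
  using level_finite_subset by blast

text \<open>
The first level is not pruned and uses the scale \<open>radius 1 / c\<close>, the later ones are pruned at
\<open>radius k / (2 c)\<close>.  In both cases the offspring covers at the scale \<open>radius k / c\<close>: pruning
moves a covering point by at most the packing scale.  The witness \<open>P\<close> is the packing before
pruning, through which the offspring is counted.
\<close>

lemma offspring_structure:
  assumes k: "1 \<le> k" and u: "u \<in> level r E k"
  obtains P where "finite P" "packing n (radius k / (2 * c)) (ball2 n u (radius k) \<inter> K) P"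
    "card (offspring E k u) \<le> card P"
    "\<And>w. w \<in> offspring E k u \<Longrightarrow> \<exists>p\<in>P. edist2 n w p \<le> radius k / (2 * c)"
    "\<And>\<theta>. \<theta> \<in> K \<Longrightarrow> edist2 n u \<theta> \<le> radius k \<Longrightarrow> \<exists>a\<in>offspring E k u. edist2 n a \<theta> \<le> radius k / c"
proof (cases "k = 1")
  case True
  then have u: "u = r" using u level_1 by simp
  obtain P where P: "maximal_packing n (radius 1 / c) (ball2 n r (radius 1) \<inter> K) P" "E 1 = {r} \<times> P"
    using first_edges .
  have finP: "finite P" using relative_packing_finite[OF _ Int_lower2 P(1)[unfolded radius_1]] c_ge by simp
  have off: "offspring E k u = P" using P(2) by (simp add: True u offspring_def)
  have half: "radius k / (2 * c) \<le> radius k / c" using radius_nonneg c_ge by (simp add: field_simps)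
  have cov: "covering n (radius 1 / c) (ball2 n r (radius 1) \<inter> K) P"
    using maximal_packing_covering[OF P(1)] radius_nonneg c_ge by simp
  show ?thesis
  proof (rule that[OF finP])
    show "packing n (radius k / (2 * c)) (ball2 n u (radius k) \<inter> K) P"
      using P(1) half packing_subset[OF _ order_refl half] by (simp add: True u maximal_packing_def)
    show "card (offspring E k u) \<le> card P" by (simp add: off)
    show "\<exists>p\<in>P. edist2 n w p \<le> radius k / (2 * c)" if "w \<in> offspring E k u" for w
      using that radius_nonneg c_ge by (auto simp: off intro!: bexI[of _ w])
    show "\<exists>a\<in>offspring E k u. edist2 n a \<theta> \<le> radius k / c" if "\<theta> \<in> K" "edist2 n u \<theta> \<le> radius k" for \<theta>
    proof -
      have "\<theta> \<in> ball2 n r (radius 1) \<inter> K" using that in_ball2[OF that(1)] by (simp add: True u)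
      then have "\<exists>p\<in>P. edist2 n \<theta> p \<le> radius 1 / c"
        using cov[unfolded covering_def, THEN conjunct2] by (rule bspec[rotated])
      then obtain p where "p \<in> P" "edist2 n \<theta> p \<le> radius 1 / c" by auto
      then show ?thesis unfolding off by (intro bexI[of _ p]) (simp_all add: True edist2_commute[of n p])
    qed
  qed
next
  case False
  then have k2: "2 \<le> k" using k by simp
  then obtain P where P:
    "\<And>u. u \<in> level r E k \<Longrightarrow> maximal_packing n (radius k / (2 * c)) (ball2 n u (radius k) \<inter> K) (P u)"
    "prune n (radius k / (2 * c)) (SIGMA u:level r E k. P u) (E k)"
    using later_edges by blast
  let ?U = "SIGMA u:level r E k. P u"
  have finP: "finite (P u)" if "u \<in> level r E k" for u using child_packing_finite[OF k2 that P(1)[OF that]] .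
  have finU: "finite ?U" using level_finite_subset[OF k] finP by blast
  have Uu: "{w. (u, w) \<in> ?U} = P u" using u by auto
  have cov: "covering n (radius k / (2 * c)) (ball2 n u (radius k) \<inter> K) (P u)"
    using maximal_packing_covering[OF P(1)[OF u]] radius_nonneg c_ge by simp
  show ?thesis
  proof (rule that[OF finP[OF u]])
    show "packing n (radius k / (2 * c)) (ball2 n u (radius k) \<inter> K) (P u)"
      using P(1)[OF u] by (simp add: maximal_packing_def)
    show "card (offspring E k u) \<le> card (P u)"
      using prune_offspring_card[OF P(2) finU, of u] unfolding Uu offspring_def .
    show "\<exists>p\<in>P u. edist2 n w p \<le> radius k / (2 * c)" if "w \<in> offspring E k u" for w
      using prune_origin[OF P(2), of u w] that by (auto simp: offspring_def)
    show "\<exists>a\<in>offspring E k u. edist2 n a \<theta> \<le> radius k / c" if \<theta>: "\<theta> \<in> K" "edist2 n u \<theta> \<le> radius k" for \<theta>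
    proof -
      have "\<theta> \<in> ball2 n u (radius k) \<inter> K" using \<theta> in_ball2[OF \<theta>(1)] by simp
      then obtain p where p: "p \<in> P u" "edist2 n \<theta> p \<le> radius k / (2 * c)"
        using cov unfolding covering_def by blast
      then have "(u, p) \<in> ?U" using u by simp
      then obtain a where a: "(u, a) \<in> E k" "edist2 n a p \<le> radius k / (2 * c)"
        using prune_keeps_near[OF P(2)] by blast
      have "edist2 n a \<theta> \<le> radius k / (2 * c) + radius k / (2 * c)"
        using edist2_triangle[of n a \<theta> p] a(2) p(2) edist2_commute[of n p \<theta>] by linarith
      then show ?thesis using a(1) by (auto simp: offspring_def)
    qed
  qed
qed

lemma offspring_nonempty:
  assumes "1 \<le> k" "u \<in> level r E k"
  shows "offspring E k u \<noteq> {}"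
proof (rule offspring_structure[OF assms])
  assume "\<And>\<theta>. \<theta> \<in> K \<Longrightarrow> edist2 n u \<theta> \<le> radius k \<Longrightarrow> \<exists>a\<in>offspring E k u. edist2 n a \<theta> \<le> radius k / c"
  from this[of u] show ?thesis using level_K[OF assms] radius_nonneg[of k] by auto
qed

lemma offspring_close:
  assumes k: "1 \<le> k" and u: "u \<in> level r E k" and w: "w \<in> offspring E k u"
  shows "edist2 n u w \<le> 2 * radius k"
proof -
  obtain P where P: "packing n (radius k / (2 * c)) (ball2 n u (radius k) \<inter> K) P"
    "\<And>w. w \<in> offspring E k u \<Longrightarrow> \<exists>p\<in>P. edist2 n w p \<le> radius k / (2 * c)"
    using offspring_structure[OF k u] by metis
  obtain p where p: "p \<in> P" "edist2 n w p \<le> radius k / (2 * c)" using P(2)[OF w] by blast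
  then have "p \<in> ball2 n u (radius k)" using P(1) by (auto simp: packing_def)
  then have "edist2 n u p \<le> radius k" by (simp add: ball2_def)
  moreover have "radius k / (2 * c) \<le> radius k"
    using radius_nonneg[of k] c_ge mult_left_mono[of 1 "2 * c" "radius k"] by (simp add: field_simps)
  ultimately show ?thesis
    using edist2_triangle[of n u w p] p(2) edist2_commute[of n w p] by linarith
qed

text \<open>
This is what pruning is for: nodes of one level are separated even if they have different
parents, so few of them can be near a given parameter.
\<close>

lemma level_packing:
  assumes "1 \<le> k"
  shows "packing n (radius k / (2 * c)) K (level r E k)"
proof -
  consider "k = 1" | "k = 2" | j where "k = Suc j" "2 \<le> j" using assms
    by (metis One_nat_def Suc_1 le_antisym not_less_eq_eq old.nat.exhaust not_one_le_zero)
  then show ?thesis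
  proof cases
    case 1 then show ?thesis using root by (simp add: level_1[simplified] packing_def)
  next
    case 2
    obtain P where P: "maximal_packing n (radius 1 / c) (ball2 n r (radius 1) \<inter> K) P" "E 1 = {r} \<times> P"
      using first_edges .
    have L: "level r E k = P" using P(2) level_Suc[of 1] 2 by (simp add: numeral_2_eq_2)
    have "radius k = radius 1 / 2" using radius_Suc[of 1] 2 by (simp add: numeral_2_eq_2)
    then have le: "radius k / (2 * c) \<le> radius 1 / c"
      using radius_nonneg[of 1] c_ge by (simp add: field_simps)
    show ?thesis unfolding L
      using P(1) by (intro packing_subset[OF _ _ le]) (auto simp: maximal_packing_def)
  next
    case (3 j)
    obtain P where P:
      "\<And>u. u \<in> level r E j \<Longrightarrow> maximal_packing n (radius j / (2 * c)) (ball2 n u (radius j) \<inter> K) (P u)"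
      "prune n (radius j / (2 * c)) (SIGMA u:level r E j. P u) (E j)"
      using later_edges[OF 3(2)] by blast
    have "1 \<le> j" using 3 by simp
    have finU: "finite (SIGMA u:level r E j. P u)"
      using level_finite_subset[OF \<open>1 \<le> j\<close>] child_packing_finite[OF 3(2)] P(1) by blast
    have L: "level r E k = snd ` E j" using level_Suc[OF \<open>1 \<le> j\<close>] 3 by simp
    have rk: "radius k = radius j / 2" using radius_Suc[OF \<open>1 \<le> j\<close>] 3 by simp
    have le: "radius k / (2 * c) \<le> radius j / (2 * c)"
      unfolding rk using radius_nonneg[of j] c_ge by (simp add: field_simps)
    have "packing n (radius j / (2 * c)) K (level r E k)"
      using prune_separated[OF P(2) finU] level_finite_subset[OF \<open>1 \<le> j\<close>]
      unfolding L packing_def by blast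
    then show ?thesis by (rule packing_subset[OF _ order_refl le])
  qed
qed

end

section \<open>Outputs of the tree algorithm\<close>

lemma H_crit_positive:
  assumes "finite S" "b \<in> S" "beats n T A y b a" "C * \<delta> \<le> edist2 n a b" "0 < C * \<delta>"
  shows "0 < H_crit n T A C y \<delta> a S"
proof -
  let ?R = "{edist2 n a b | b. b \<in> S \<and> beats n T A y b a \<and> edist2 n a b \<ge> C * \<delta>}"
  have "finite ?R" using assms(1) by simp
  moreover have "edist2 n a b \<in> ?R" using assms by blast
  ultimately have "edist2 n a b \<le> Max ?R" "?R \<noteq> {}" by (auto intro: Max_ge)
  then show ?thesis using assms(4,5) unfolding H_crit_def Let_def by simp
qed

lemma H_crit_zero:
  assumes "\<And>b. b \<in> S \<Longrightarrow> C * \<delta> \<le> edist2 n a b \<Longrightarrow> \<not> beats n T A y b a"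
  shows "H_crit n T A C y \<delta> a S = 0"
  using assms unfolding H_crit_def Let_def by auto

lemma beats_total: "beats n T A y b a \<or> beats n T A y a b"
proof -
  have "(\<Sum>i<n. (b i - a i) * T (y i) + A (a i) - A (b i)) = - (\<Sum>i<n. (a i - b i) * T (y i) + A (b i) - A (a i))"
    unfolding sum_negf[symmetric] by (intro sum.cong) (auto simp: algebra_simps)
  then show ?thesis unfolding beats_def by linarith
qed

text \<open>
If no distant sibling beats \<open>a\<close>, its criterion is zero, so the selected point has criterion zero
as well and is not beaten by \<open>a\<close> from afar.  One of any two points beats the other; hence the
selected point is within \<open>C \<delta>\<close> of \<open>a\<close>.
\<close>

lemma selection_accuracy:
  assumes S: "finite S" "a \<in> S" and \<delta>: "0 < C * \<delta>"
    and a: "edist2 n a \<theta> \<le> \<delta>"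
    and unbeaten: "\<And>b. b \<in> S \<Longrightarrow> C * \<delta> \<le> edist2 n a b \<Longrightarrow> \<not> beats n T A y b a"
  shows "edist2 n (lex_argmin (\<lambda>a. H_crit n T A C y \<delta> a S) S) \<theta> \<le> (C + 1) * \<delta>"
proof -
  define w where "w = lex_argmin (\<lambda>a. H_crit n T A C y \<delta> a S) S"
  have ne: "S \<noteq> {}" using S by auto
  have w: "w \<in> S" "H_crit n T A C y \<delta> w S \<le> H_crit n T A C y \<delta> a S"
    unfolding w_def by (rule lex_argmin_minimises(1)[OF S(1) ne], rule lex_argmin_minimises(2)[OF S(1) ne S(2)])
  have "edist2 n a w < C * \<delta>"
  proof (rule ccontr)
    assume "\<not> ?thesis"
    then have far: "C * \<delta> \<le> edist2 n a w" by simp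
    then have "beats n T A y a w" using unbeaten[OF w(1)] beats_total by blast
    then have "0 < H_crit n T A C y \<delta> w S"
      using H_crit_positive[OF S] far \<delta> by (simp add: edist2_commute[of n w])
    then show False using w(2) H_crit_zero[OF unbeaten] by simp
  qed
  then show ?thesis
    using a edist2_triangle[of n w \<theta> a] edist2_commute[of n w a]
    unfolding w_def[symmetric] by (simp add: algebra_simps)
qed

lemma H_crit_cong:
  assumes "\<And>b. b \<in> S \<Longrightarrow> beats n T A y b a = beats n T A y' b a"
  shows "H_crit n T A C y \<delta> a S = H_crit n T A C y' \<delta> a S"
proof -
  have "{edist2 n a b | b. b \<in> S \<and> beats n T A y b a \<and> edist2 n a b \<ge> C * \<delta>}
     = {edist2 n a b | b. b \<in> S \<and> beats n T A y' b a \<and> edist2 n a b \<ge> C * \<delta>}"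
    using assms by auto
  then show ?thesis unfolding H_crit_def by simp
qed

lemma lex_argmin_cong:
  assumes "\<And>a. a \<in> S \<Longrightarrow> g a = g' a"
  shows "lex_argmin g S = lex_argmin g' S"
proof -
  have "{a \<in> S. \<forall>b\<in>S. g a \<le> g b} = {a \<in> S. \<forall>b\<in>S. g' a \<le> g' b}" using assms by auto
  then show ?thesis unfolding lex_argmin_def by simp
qed

text \<open>
The selection depends on the data only through the outcomes of the finitely many comparisons
between points of \<open>S\<close>; each pattern of outcomes is a measurable event on which the selection is
constant.
\<close>

lemma (in expfam_model) selection_measurable:
  assumes "finite S"
  shows "{y \<in> space (PiM {..<n} (\<lambda>_. borel)). lex_argmin (\<lambda>a. H_crit n T A C y \<delta> a S) S = w}
    \<in> sets (PiM {..<n} (\<lambda>_. borel))"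
proof -
  let ?N = "PiM {..<n} (\<lambda>_. borel :: real measure)"
  let ?sel = "\<lambda>y. lex_argmin (\<lambda>a. H_crit n T A C y \<delta> a S) S"
  let ?G = "\<lambda>R. {y \<in> space ?N. \<forall>p\<in>S \<times> S. p \<in> R \<longleftrightarrow> beats n T A y (fst p) (snd p)}"
  let ?RR = "{R \<in> Pow (S \<times> S). \<exists>y\<in>?G R. ?sel y = w}"
  have G: "?G R \<in> sets ?N" for R
  proof (rule sets.sets_Collect_finite_All)
    fix p assume "p \<in> S \<times> S"
    show "{y \<in> space ?N. p \<in> R \<longleftrightarrow> beats n T A y (fst p) (snd p)} \<in> sets ?N"
      using beats_measurable[of n "fst p" "snd p"] sets.sets_Collect_neg[OF beats_measurable[of n "fst p" "snd p"]]
      by (cases "p \<in> R") auto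
  qed (use assms in auto)
  have same: "?sel y = ?sel y'" if "y \<in> ?G R" "y' \<in> ?G R" for y y' R
  proof (rule lex_argmin_cong, rule H_crit_cong)
    fix a b assume "a \<in> S" "b \<in> S"
    then have "(b, a) \<in> S \<times> S" by simp
    then show "beats n T A y b a = beats n T A y' b a" using that by fastforce
  qed
  have "{y \<in> space ?N. ?sel y = w} = (\<Union>R\<in>?RR. ?G R)"
  proof (intro equalityI subsetI)
    fix y assume y: "y \<in> {y \<in> space ?N. ?sel y = w}"
    define R where "R = {p \<in> S \<times> S. beats n T A y (fst p) (snd p)}"
    have "y \<in> ?G R" using y by (auto simp: R_def)
    moreover have "R \<in> Pow (S \<times> S)" by (auto simp: R_def)
    ultimately show "y \<in> (\<Union>R\<in>?RR. ?G R)" using y by blast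
  next
    fix y assume "y \<in> (\<Union>R\<in>?RR. ?G R)"
    then obtain R y' where "y \<in> ?G R" "y' \<in> ?G R" "?sel y' = w" by blast
    then show "y \<in> {y \<in> space ?N. ?sel y = w}" using same[of y R y'] by simp
  qed
  also have "\<dots> \<in> sets ?N"
    using assms G by (intro sets.finite_UN) auto
  finally show ?thesis .
qed

locale tree_estimator = minimax_model h T A D M n K + tree_body n M K c r E
  for h T A D M n K c r E +
  fixes C :: real
  assumes C_test: "2 * sqrt (curv_max A M / curv_min A M + 8) \<le> C" and C_c: "2 * (C + 1) \<le> c"
begin

abbreviation "out k y \<equiv> tree_output n T A K C r E k y"

text \<open>
For \<open>k \<ge> 1\<close> this is the parameter \<open>\<delta>\<close> of the selection criterion in iteration \<open>k\<close>.
\<close>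

definition tol :: "nat \<Rightarrow> real"
  where "tol k = radius k / (2 * (C + 1))"

lemma C_ge: "6 \<le> C"
proof -
  have "3 \<le> sqrt (curv_max A M / curv_min A M + 8)"
    using curv_min_pos curv_order by (intro real_le_rsqrt) simp
  then show ?thesis using C_test by linarith
qed

lemma radius_pos: "0 < diam \<Longrightarrow> 0 < radius k"
  by (simp add: radius_def)

lemma tol_pos: "0 < diam \<Longrightarrow> 0 < tol k"
  using C_ge by (simp add: tol_def radius_pos)

lemma tol_radius: "radius k = 2 * (C + 1) * tol k"
  using C_ge by (simp add: tol_def)

lemma out_Suc:
  "out (Suc k) y = lex_argmin (\<lambda>a. H_crit n T A C y (tol (Suc k)) a (offspring E (Suc k) (out k y)))
     (offspring E (Suc k) (out k y))"
proof -
  have "diam / (2 ^ Suc k * (C + 1)) = tol (Suc k)" by (simp add: tol_def radius_def)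
  then show ?thesis by (simp add: Let_def)
qed

declare tree_output.simps(2) [simp del]

lemma out_level: "out k y \<in> level r E (Suc k)"
proof (induction k)
  case 0 then show ?case using level_1 by simp
next
  case (Suc k)
  have "out (Suc k) y \<in> offspring E (Suc k) (out k y)"
    unfolding out_Suc using Suc by (intro lex_argmin_minimises offspring_finite offspring_nonempty) auto
  then show ?case using offspring_level[of "Suc k"] by auto
qed

lemma out_offspring: "out (Suc k) y \<in> offspring E (Suc k) (out k y)"
  unfolding out_Suc using out_level by (intro lex_argmin_minimises offspring_finite offspring_nonempty) auto

lemma out_K: "out k y \<in> K"
  using level_K[OF _ out_level] by simp

lemma out_level_sets: "{y \<in> space data. out k y = v} \<in> sets data"
proof (induction k arbitrary: v)
  case 0
  then show ?case by (cases "r = v") auto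
next
  case (Suc k)
  let ?L = "level r E (Suc k)"
  let ?sel = "\<lambda>u y. lex_argmin (\<lambda>a. H_crit n T A C y (tol (Suc k)) a (offspring E (Suc k) u)) (offspring E (Suc k) u)"
  have "{y \<in> space data. out (Suc k) y = v} =
    (\<Union>u\<in>?L. {y \<in> space data. out k y = u} \<inter> {y \<in> space data. ?sel u y = v})"
    using out_level by (auto simp: out_Suc)
  also have "\<dots> \<in> sets data"
    using level_finite_subset[of "Suc k"] Suc offspring_finite[of "Suc k"]
    by (intro sets.finite_UN sets.Int selection_measurable) auto
  finally show ?case .
qed

lemma out_estimator: "out k \<in> estimators n"
proof -
  let ?L = "level r E (Suc k)"
  have fin: "finite ?L" using level_finite_subset[of "Suc k"] by simp
  have "out k \<in> data \<rightarrow>\<^sub>M count_space ?L"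
    unfolding measurable_count_space_eq2[OF fin]
  proof (intro conjI ballI)
    show "out k \<in> space data \<rightarrow> ?L" using out_level by simp
    fix v
    have "out k -` {v} \<inter> space data = {y \<in> space data. out k y = v}" by auto
    then show "out k -` {v} \<inter> space data \<in> sets data" using out_level_sets by simp
  qed
  moreover have "(\<lambda>x. x) \<in> count_space ?L \<rightarrow>\<^sub>M data"
    using level_K[of "Suc k"] K_ext by (auto simp: space_PiM PiE_def)
  ultimately have "(\<lambda>y. (\<lambda>x. x) (out k y)) \<in> data \<rightarrow>\<^sub>M data"
    by (rule measurable_compose)
  then show ?thesis by (simp add: estimators_def)
qed

text \<open>
Edge lengths are at most twice the radius of their level and halve from level to level.  Keeping
the remaining radius on the left side makes the geometric series telescope.
\<close>

lemma later_output_close: "edist2 n (out k y) (out (k + j) y) + 4 * radius (Suc (k + j)) \<le> 4 * radius (Suc k)"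
proof (induction j)
  case (Suc j)
  have "edist2 n (out (k + j) y) (out (Suc (k + j)) y) \<le> 2 * radius (Suc (k + j))"
    using out_level out_offspring by (intro offspring_close) auto
  moreover have "radius (Suc (Suc (k + j))) = radius (Suc (k + j)) / 2" by (intro radius_Suc) simp
  ultimately show ?case
    using Suc edist2_triangle[of n "out k y" "out (Suc (k + j)) y" "out (k + j) y"] by simp
qed simp

definition near_nodes :: "nat \<Rightarrow> point \<Rightarrow> point set"
  where "near_nodes k \<theta> = {u \<in> level r E k. edist2 n u \<theta> \<le> radius k}"

text \<open>
An offspring of \<open>u\<close> that is close to \<open>\<theta>\<close>; it exists if \<open>u\<close> is a near node.
\<close>

definition anchor :: "nat \<Rightarrow> point \<Rightarrow> point \<Rightarrow> point"
  where "anchor k \<theta> u = (SOME a. a \<in> offspring E k u \<and> edist2 n a \<theta> \<le> tol k)"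

definition rivals :: "nat \<Rightarrow> point \<Rightarrow> point \<Rightarrow> point set"
  where "rivals k \<theta> u = {b \<in> offspring E k u. C * tol k \<le> edist2 n (anchor k \<theta> u) b}"

text \<open>
The event ranges over all nodes that are near \<open>\<theta>\<close> and not only over the random node that the
algorithm visits.  This removes the dependence between the path and the comparisons, at the price
of a factor that \<open>level_packing\<close> controls.
\<close>

definition fooled :: "nat \<Rightarrow> point \<Rightarrow> (nat \<Rightarrow> real) set"
  where "fooled k \<theta> = (\<Union>u\<in>near_nodes k \<theta>. \<Union>b\<in>rivals k \<theta> u.
    {y \<in> space data. beats n T A y b (anchor k \<theta> u)})"

lemma anchor:
  assumes "1 \<le> k" "\<theta> \<in> K" "u \<in> near_nodes k \<theta>"
  shows "anchor k \<theta> u \<in> offspring E k u" "edist2 n (anchor k \<theta> u) \<theta> \<le> tol k"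
proof -
  have u: "u \<in> level r E k" "edist2 n u \<theta> \<le> radius k" using assms(3) by (auto simp: near_nodes_def)
  have "\<exists>a\<in>offspring E k u. edist2 n a \<theta> \<le> radius k / c"
  proof (rule offspring_structure[OF assms(1) u(1)])
    assume "\<And>\<theta>. \<theta> \<in> K \<Longrightarrow> edist2 n u \<theta> \<le> radius k \<Longrightarrow> \<exists>a\<in>offspring E k u. edist2 n a \<theta> \<le> radius k / c"
    then show ?thesis using assms(2) u(2) by simp
  qed
  moreover have "radius k / c \<le> tol k"
    unfolding tol_def using C_c C_ge radius_nonneg by (intro divide_left_mono) auto
  ultimately have "\<exists>a. a \<in> offspring E k u \<and> edist2 n a \<theta> \<le> tol k" by force
  then have "anchor k \<theta> u \<in> offspring E k u \<and> edist2 n (anchor k \<theta> u) \<theta> \<le> tol k"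
    unfolding anchor_def by (rule someI_ex)
  then show "anchor k \<theta> u \<in> offspring E k u" "edist2 n (anchor k \<theta> u) \<theta> \<le> tol k" by auto
qed

text \<open>
The selection is accurate to \<open>(C + 1) \<cdot> tol\<close>, which is exactly the radius of the next level.
\<close>

lemma unfooled_step:
  assumes d: "0 < diam" and \<theta>: "\<theta> \<in> K" and y: "y \<in> space data" and nf: "y \<notin> fooled (Suc k) \<theta>"
    and close: "edist2 n (out k y) \<theta> \<le> radius (Suc k)"
  shows "edist2 n (out (Suc k) y) \<theta> \<le> radius (Suc (Suc k))"
proof -
  let ?u = "out k y"
  have u: "?u \<in> near_nodes (Suc k) \<theta>" using out_level close by (simp add: near_nodes_def)
  have "edist2 n (out (Suc k) y) \<theta> \<le> (C + 1) * tol (Suc k)"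
    unfolding out_Suc
  proof (rule selection_accuracy)
    show "finite (offspring E (Suc k) ?u)" by (intro offspring_finite) simp
    show "anchor (Suc k) \<theta> ?u \<in> offspring E (Suc k) ?u" "edist2 n (anchor (Suc k) \<theta> ?u) \<theta> \<le> tol (Suc k)"
      using anchor[OF _ \<theta> u] by auto
    show "0 < C * tol (Suc k)" using tol_pos[OF d] C_ge by simp
    fix b assume "b \<in> offspring E (Suc k) ?u" "C * tol (Suc k) \<le> edist2 n (anchor (Suc k) \<theta> ?u) b"
    then have "b \<in> rivals (Suc k) \<theta> ?u" by (simp add: rivals_def)
    then show "\<not> beats n T A y b (anchor (Suc k) \<theta> ?u)"
      using nf u y unfolding fooled_def by blast
  qed
  also have "\<dots> = radius (Suc k) / 2" by (subst tol_radius) simp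
  also have "\<dots> = radius (Suc (Suc k))" by (simp add: radius_Suc)
  finally show ?thesis .
qed

lemma unfooled_close:
  assumes "0 < diam" "\<theta> \<in> K" "y \<in> space data" "\<And>j. 1 \<le> j \<Longrightarrow> j \<le> k \<Longrightarrow> y \<notin> fooled j \<theta>"
  shows "edist2 n (out k y) \<theta> \<le> radius (Suc k)"
  using assms(4)
proof (induction k)
  case 0
  then show ?case using edist2_le_diam2[OF root assms(2)] radius_1 by simp
next
  case (Suc k)
  then show ?case using assms(1-3) by (intro unfooled_step) auto
qed

lemma loss_after_close:
  assumes "edist2 n (out k y) \<theta> \<le> radius (Suc k)" "k \<le> J"
  shows "(edist2 n (out J y) \<theta>)\<^sup>2 \<le> 25 * (radius (Suc k))\<^sup>2"
proof -
  obtain j where J: "J = k + j" using assms(2) le_Suc_ex by blast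
  have "edist2 n (out J y) \<theta> \<le> 5 * radius (Suc k)"
    using later_output_close[of k y j] assms(1) radius_nonneg[of "Suc (k + j)"]
      edist2_triangle[of n "out J y" \<theta> "out k y"] edist2_commute[of n "out J y" "out k y"]
    unfolding J by simp
  then have "(edist2 n (out J y) \<theta>)\<^sup>2 \<le> (5 * radius (Suc k))\<^sup>2" by (intro power_mono) auto
  then show ?thesis by (simp add: power_mult_distrib)
qed

text \<open>
Before the first iteration that is fooled the path is on the right track, so a mistake in
iteration \<open>k\<close> costs no more than the squared radius of level \<open>k\<close>, up to the factor 25.
\<close>

lemma loss_bound:
  assumes d: "0 < diam" "\<theta> \<in> K" "y \<in> space data" "k0 \<le> J"
  shows "ennreal ((edist2 n (out J y) \<theta>)\<^sup>2) \<le> ennreal (25 * (radius (Suc k0))\<^sup>2)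
    + (\<Sum>k=1..k0. ennreal (25 * (radius k)\<^sup>2) * indicator (fooled k \<theta>) y)"
proof (cases "\<exists>k. 1 \<le> k \<and> k \<le> k0 \<and> y \<in> fooled k \<theta>")
  case False
  then have "edist2 n (out k0 y) \<theta> \<le> radius (Suc k0)"
    using d by (intro unfooled_close) auto
  then have "ennreal ((edist2 n (out J y) \<theta>)\<^sup>2) \<le> ennreal (25 * (radius (Suc k0))\<^sup>2)"
    using loss_after_close d by (intro ennreal_leI) auto
  then show ?thesis by (rule order_trans) simp
next
  case True
  define k where "k = (LEAST k. 1 \<le> k \<and> k \<le> k0 \<and> y \<in> fooled k \<theta>)"
  have k: "1 \<le> k" "k \<le> k0" "y \<in> fooled k \<theta>" using LeastI_ex[OF True] by (auto simp: k_def)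
  obtain j where j: "k = Suc j" using k(1) by (cases k) auto
  have "y \<notin> fooled i \<theta>" if "1 \<le> i" "i \<le> j" for i
  proof -
    have "i < k" using that j by simp
    then have "\<not> (1 \<le> i \<and> i \<le> k0 \<and> y \<in> fooled i \<theta>)" unfolding k_def by (rule not_less_Least)
    then show ?thesis using that j k(2) by simp
  qed
  then have "edist2 n (out j y) \<theta> \<le> radius (Suc j)" using d by (intro unfooled_close) auto
  then have "(edist2 n (out J y) \<theta>)\<^sup>2 \<le> 25 * (radius (Suc j))\<^sup>2"
    using j k d by (intro loss_after_close) auto
  then have "ennreal ((edist2 n (out J y) \<theta>)\<^sup>2) \<le> ennreal (25 * (radius k)\<^sup>2) * indicator (fooled k \<theta>) y"
    using k(3) by (auto simp: j intro!: ennreal_leI)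
  also have "\<dots> \<le> (\<Sum>k=1..k0. ennreal (25 * (radius k)\<^sup>2) * indicator (fooled k \<theta>) y)"
    using k by (intro member_le_sum) auto
  finally show ?thesis by (rule order_trans) simp
qed

definition rate_exponent :: real
  where "rate_exponent = (curv_min A M)\<^sup>2 * C\<^sup>2 / (32 * Cd)"

lemma near_nodes_finite: "1 \<le> k \<Longrightarrow> finite (near_nodes k \<theta>)"
  using level_finite_subset by (simp add: near_nodes_def)

lemma rivals_finite: "1 \<le> k \<Longrightarrow> finite (rivals k \<theta> u)"
  using offspring_finite by (simp add: rivals_def)

lemma fooled_sets: "1 \<le> k \<Longrightarrow> fooled k \<theta> \<in> sets data"
  unfolding fooled_def using near_nodes_finite rivals_finite
  by (intro sets.finite_UN beats_measurable) auto

lemma fooled_probability: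
  assumes k: "1 \<le> k" and \<theta>: "\<theta> \<in> K"
    and nodes: "real (card (near_nodes k \<theta>)) \<le> B"
    and offs: "\<And>u. u \<in> level r E k \<Longrightarrow> real (card (offspring E k u)) \<le> B"
  shows "emeasure (sample n \<theta>) (fooled k \<theta>) \<le> ennreal (B\<^sup>2 * exp (- (rate_exponent * (tol k)\<^sup>2)))"
proof -
  let ?e = "exp (- (rate_exponent * (tol k)\<^sup>2))"
  let ?Ev = "\<lambda>u b. {y \<in> space data. beats n T A y b (anchor k \<theta> u)}"
  have B: "0 \<le> B" using nodes by (rule order_trans[rotated]) simp
  have one: "emeasure (sample n \<theta>) (?Ev u b) \<le> ennreal ?e" if "u \<in> near_nodes k \<theta>" "b \<in> rivals k \<theta> u" for u b
  proof -
    have a: "anchor k \<theta> u \<in> K" "b \<in> K"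
      using anchor(1)[OF k \<theta> that(1)] that(2) offspring_level[OF k, of u] level_K[of "Suc k"]
      by (auto simp: rivals_def)
    have "emeasure (sample n \<theta>) {y \<in> space (sample n \<theta>). beats n T A y b (anchor k \<theta> u)} \<le> ennreal ?e"
      unfolding rate_exponent_def
    proof (rule test_error[OF _ _ _ C_test])
      show "0 \<le> tol k" using radius_nonneg C_ge by (simp add: tol_def)
      show "C * tol k \<le> edist2 n (anchor k \<theta> u) b" using that(2) by (simp add: rivals_def)
    qed (use a \<theta> K_cube_point anchor(2)[OF k \<theta> that(1)] in auto)
    then show ?thesis by (simp add: space_PiM)
  qed
  have "emeasure (sample n \<theta>) (fooled k \<theta>) \<le> (\<Sum>u\<in>near_nodes k \<theta>. emeasure (sample n \<theta>) (\<Union>b\<in>rivals k \<theta> u. ?Ev u b))"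
    unfolding fooled_def
  proof (rule emeasure_subadditive_finite[OF near_nodes_finite[OF k]])
    show "(\<lambda>u. \<Union>b\<in>rivals k \<theta> u. ?Ev u b) ` near_nodes k \<theta> \<subseteq> sets (sample n \<theta>)"
      using rivals_finite[OF k] beats_measurable by (auto intro!: sets.finite_UN)
  qed
  also have "\<dots> \<le> (\<Sum>u\<in>near_nodes k \<theta>. ennreal (B * ?e))"
  proof (rule sum_mono)
    fix u assume u: "u \<in> near_nodes k \<theta>"
    have "emeasure (sample n \<theta>) (\<Union>b\<in>rivals k \<theta> u. ?Ev u b) \<le> (\<Sum>b\<in>rivals k \<theta> u. emeasure (sample n \<theta>) (?Ev u b))"
      using beats_measurable by (intro emeasure_subadditive_finite rivals_finite k) auto
    also have "\<dots> \<le> (\<Sum>b\<in>rivals k \<theta> u. ennreal ?e)" by (intro sum_mono one u)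
    also have "\<dots> = ennreal (real (card (rivals k \<theta> u)) * ?e)"
      by (simp add: ennreal_mult ennreal_of_nat_eq_real_of_nat)
    also have "\<dots> \<le> ennreal (B * ?e)"
    proof (intro ennreal_leI mult_right_mono)
      have "card (rivals k \<theta> u) \<le> card (offspring E k u)"
        using offspring_finite[OF k] by (intro card_mono) (auto simp: rivals_def)
      then show "real (card (rivals k \<theta> u)) \<le> B" using offs[of u] u by (simp add: near_nodes_def)
    qed simp
    finally show "emeasure (sample n \<theta>) (\<Union>b\<in>rivals k \<theta> u. ?Ev u b) \<le> ennreal (B * ?e)" .
  qed
  also have "\<dots> = ennreal (real (card (near_nodes k \<theta>)) * (B * ?e))"
    using B by (simp add: ennreal_mult ennreal_of_nat_eq_real_of_nat)
  also have "\<dots> \<le> ennreal (B * (B * ?e))"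
    using nodes B by (intro ennreal_leI mult_right_mono) auto
  finally show ?thesis by (simp add: power2_eq_square mult.assoc)
qed

lemma risk_bound:
  assumes d: "0 < diam" and \<theta>: "\<theta> \<in> K" and J: "k0 \<le> J"
    and nodes: "\<And>k. 1 \<le> k \<Longrightarrow> k \<le> k0 \<Longrightarrow> real (card (near_nodes k \<theta>)) \<le> B"
    and offs: "\<And>k u. 1 \<le> k \<Longrightarrow> k \<le> k0 \<Longrightarrow> u \<in> level r E k \<Longrightarrow> real (card (offspring E k u)) \<le> B"
  shows "(\<integral>\<^sup>+y. ennreal ((edist2 n (out J y) \<theta>)\<^sup>2) \<partial>sample n \<theta>) \<le>
    ennreal (25 * (radius (Suc k0))\<^sup>2 + (\<Sum>k=1..k0. 25 * (radius k)\<^sup>2 * (B\<^sup>2 * exp (- (rate_exponent * (tol k)\<^sup>2)))))"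
proof -
  interpret prob_space "sample n \<theta>" by (rule prob_space_K) fact
  have F: "fooled k \<theta> \<in> sets (sample n \<theta>)" if "k \<in> {1..k0}" for k using that fooled_sets by simp
  have "(\<integral>\<^sup>+y. ennreal ((edist2 n (out J y) \<theta>)\<^sup>2) \<partial>sample n \<theta>) \<le>
     (\<integral>\<^sup>+y. ennreal (25 * (radius (Suc k0))\<^sup>2) + (\<Sum>k=1..k0. ennreal (25 * (radius k)\<^sup>2) * indicator (fooled k \<theta>) y) \<partial>sample n \<theta>)"
    using loss_bound[OF d \<theta> _ J] by (intro nn_integral_mono) (simp add: space_PiM)
  also have "\<dots> = ennreal (25 * (radius (Suc k0))\<^sup>2) + (\<Sum>k=1..k0. ennreal (25 * (radius k)\<^sup>2) * emeasure (sample n \<theta>) (fooled k \<theta>))"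
  proof -
    have meas: "(\<lambda>y. ennreal a * indicator (fooled k \<theta>) y) \<in> borel_measurable (sample n \<theta>)" if "k \<in> {1..k0}" for a k
      by (intro borel_measurable_times_ennreal borel_measurable_const borel_measurable_indicator F that)
    have "(\<integral>\<^sup>+y. (\<Sum>k=1..k0. ennreal (25 * (radius k)\<^sup>2) * indicator (fooled k \<theta>) y) \<partial>sample n \<theta>)
      = (\<Sum>k=1..k0. \<integral>\<^sup>+y. ennreal (25 * (radius k)\<^sup>2) * indicator (fooled k \<theta>) y \<partial>sample n \<theta>)"
      by (rule nn_integral_sum[OF meas])
    also have "\<dots> = (\<Sum>k=1..k0. ennreal (25 * (radius k)\<^sup>2) * emeasure (sample n \<theta>) (fooled k \<theta>))"
      by (intro sum.cong refl nn_integral_cmult_indicator F)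
    finally have *: "(\<integral>\<^sup>+y. (\<Sum>k=1..k0. ennreal (25 * (radius k)\<^sup>2) * indicator (fooled k \<theta>) y) \<partial>sample n \<theta>)
      = (\<Sum>k=1..k0. ennreal (25 * (radius k)\<^sup>2) * emeasure (sample n \<theta>) (fooled k \<theta>))" .
    have "(\<integral>\<^sup>+y. ennreal (25 * (radius (Suc k0))\<^sup>2) \<partial>sample n \<theta>) = ennreal (25 * (radius (Suc k0))\<^sup>2)"
      by (simp add: emeasure_space_1[unfolded space_sample])
    with * show ?thesis
      by (subst nn_integral_add[OF borel_measurable_const borel_measurable_sum[OF meas]]) auto
  qed
  also have "\<dots> \<le> ennreal (25 * (radius (Suc k0))\<^sup>2) +
     (\<Sum>k=1..k0. ennreal (25 * (radius k)\<^sup>2) * ennreal (B\<^sup>2 * exp (- (rate_exponent * (tol k)\<^sup>2))))"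
    using nodes offs \<theta> by (intro add_left_mono sum_mono mult_left_mono fooled_probability) auto
  also have "\<dots> = ennreal (25 * (radius (Suc k0))\<^sup>2 + (\<Sum>k=1..k0. 25 * (radius k)\<^sup>2 * (B\<^sup>2 * exp (- (rate_exponent * (tol k)\<^sup>2)))))"
    by (simp add: ennreal_mult[symmetric] sum_ennreal ennreal_plus[symmetric] sum_nonneg del: ennreal_plus)
  finally show ?thesis .
qed

lemma trivial_risk: "worst_risk n h T A K (out J) \<le> ennreal (diam\<^sup>2)"
  unfolding worst_risk_def
proof (rule SUP_least)
  fix \<theta> assume \<theta>: "\<theta> \<in> K"
  interpret prob_space "sample n \<theta>" by (rule prob_space_K) fact
  have "(\<integral>\<^sup>+y. ennreal ((edist2 n (out J y) \<theta>)\<^sup>2) \<partial>sample n \<theta>) \<le> (\<integral>\<^sup>+y. ennreal (diam\<^sup>2) \<partial>sample n \<theta>)"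
    using edist2_le_diam2[OF out_K \<theta>] by (intro nn_integral_mono ennreal_leI power_mono) auto
  also have "\<dots> = ennreal (diam\<^sup>2)" using emeasure_space_1 by simp
  finally show "(\<integral>\<^sup>+y. ennreal ((edist2 n (out J y) \<theta>)\<^sup>2) \<partial>sample n \<theta>) \<le> ennreal (diam\<^sup>2)" .
qed

end

section \<open>Risk at the stopping level\<close>

lemma geometric_tail_sum: "k0 \<le> m \<Longrightarrow> (\<Sum>k=1..k0. (1 / 4 :: real) ^ (m - k)) \<le> 4 / 3 * (1 / 4) ^ (m - k0)"
proof (induction k0)
  case (Suc k0)
  have "m - k0 = Suc (m - Suc k0)" using Suc.prems by simp
  then have "(1 / 4 :: real) ^ (m - k0) = (1 / 4) ^ (m - Suc k0) / 4" by simp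
  then show ?case using Suc by simp
qed simp

text \<open>
Turns the exponentially small failure probabilities into the reciprocal of the squared
tolerance, which sums geometrically over the levels.
\<close>

lemma scaled_exp_le:
  fixes t k :: real
  assumes "0 < t" "0 < k"
  shows "t * exp (- (k * t / 2)) \<le> 8 / (k\<^sup>2 * t)"
proof -
  define x where "x = k * t / 2"
  have x: "0 < x" using assms by (simp add: x_def)
  have "x\<^sup>2 / 2 \<le> exp x" using exp_lower_Taylor_quadratic[of x] x by simp
  then have "exp (- x) \<le> 2 / x\<^sup>2" using x by (simp add: exp_minus field_simps)
  then have "t * exp (- x) \<le> t * (2 / x\<^sup>2)" using assms by (intro mult_left_mono) auto
  also have "\<dots> = 8 / (k\<^sup>2 * t)" using assms by (simp add: x_def power2_eq_square field_simps)
  finally show ?thesis by (simp add: x_def)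
qed

text \<open>
The number of levels above the stopping level in which failure probabilities are not
controlled.  Any number that depends on \<open>c\<close> alone, is at least 2 and satisfies
\<open>c\<^sup>2 \<le> 2 ^ burn_in c\<close> would serve.
\<close>

definition burn_in :: "real \<Rightarrow> nat"
  where "burn_in c = nat \<lceil>c\<^sup>2\<rceil> + 2"

lemma le_two_power_burn_in: "c\<^sup>2 \<le> 2 ^ burn_in c"
proof -
  have "c\<^sup>2 \<le> real (burn_in c)" unfolding burn_in_def by linarith
  also have "\<dots> \<le> real (2 ^ burn_in c)" by (intro of_nat_mono less_imp_le less_exp)
  finally show ?thesis by simp
qed

definition stop_const :: "real \<Rightarrow> real \<Rightarrow> real"
  where "stop_const c C = 25 * (C + 1)\<^sup>2 * (4 ^ burn_in c + 256)"

definition upper_const :: "real \<Rightarrow> real \<Rightarrow> real"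
  where "upper_const c C = 64 * stop_const c C + 16 * (C + 1)\<^sup>2 + 1"

context minimax_model begin

text \<open>
The segment from the centre to a far point contains a point at distance exactly \<open>\<epsilon>\<close> from the
centre, and no point is within \<open>\<epsilon> / c\<close> of both ends.
\<close>

lemma local_entropy_two:
  assumes "0 < \<epsilon>" "\<epsilon> \<le> diam / 3" "2 < c"
  shows "2 \<le> N_loc n K \<epsilon> c"
proof -
  have "0 < diam" using assms by simp
  then obtain x where x: "x \<in> K" "diam / 3 \<le> edist2 n centre x" using far_point by blast
  define e where "e = edist2 n centre x"
  have e: "\<epsilon> \<le> e" "0 < e" using x assms by (auto simp: e_def)
  define z where "z = contract n (\<epsilon> / e) centre x"
  have z: "z \<in> K" using x e assms unfolding z_def by (intro centre(2)) auto
  have dist: "edist2 n centre z = \<epsilon>"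
    using edist2_contract_centre[of "\<epsilon> / e" n centre x] e assms by (simp add: z_def e_def[symmetric])
  then have ne: "centre \<noteq> z" using assms by auto
  let ?S = "ball2 n centre \<epsilon> \<inter> K"
  have "2 * \<epsilon> / c < \<epsilon>" using assms by (simp add: field_simps)
  then have pk: "packing n (2 * \<epsilon> / c) ?S {centre, z}"
    using dist z centre(1) in_ball2[OF z] in_ball2[OF centre(1)] assms edist2_commute[of n z centre]
    by (auto simp: packing_def)
  obtain G where G: "finite G" "covering n (\<epsilon> / c) ?S G" "card G = covering_number n (\<epsilon> / c) ?S"
    using minimal_covering[of "\<epsilon> / c" ?S] assms by auto
  have "card {centre, z} \<le> card G" using packing_le_covering[OF pk G(1)] G(2) by simp
  then have "2 \<le> card G" using ne by simp
  then show ?thesis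
    using covering_number_le_N_loc[OF assms(1) _ centre(1), of c] assms(3) G(3) by simp
qed

text \<open>
If \<open>\<kappa> \<epsilon>\<^sup>2 \<le> ln 2\<close>, two points already provide the entropy that \<open>\<epsilon>\<^sup>*\<close> asks for at \<open>\<epsilon>\<close> itself.
Otherwise the entropy at radius \<open>c \<epsilon>\<close> and scale \<open>\<epsilon> / 2\<close> is large; by submultiplicativity it is
split between the radii \<open>c \<epsilon>\<close> and \<open>2 \<epsilon>\<close>, and both parts are dominated by the entropy at the
smaller radius \<open>\<epsilon> / 4\<close> with the ratio \<open>c\<close> of the definition of \<open>\<epsilon>\<^sup>*\<close>.
\<close>

lemma small_entropy_level:
  assumes k: "0 < k" and c: "16 \<le> c" and \<epsilon>: "0 < \<epsilon>" "\<epsilon> \<le> diam / 3"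
    and low: "k * \<epsilon>\<^sup>2 \<le> max (2 * ln ((N_loc n K (c * \<epsilon>) (2 * c))\<^sup>2)) (ln 2)"
  shows "\<epsilon> \<le> 4 * eps_star n K c k"
proof (cases "k * \<epsilon>\<^sup>2 \<le> ln 2")
  case True
  have "2 \<le> N_loc n K \<epsilon> c" using \<epsilon> c by (intro local_entropy_two) auto
  then have "ln 2 \<le> ln (N_loc n K \<epsilon> c)" by simp
  then have "\<epsilon> \<in> eps_set c k" using True \<epsilon> by (simp add: mult.commute)
  then have "\<epsilon> \<le> eps_star n K c k" using c k by (intro eps_star_upper) auto
  then show ?thesis using \<epsilon> by simp
next
  case False
  define N where "N = N_loc n K (c * \<epsilon>) (2 * c)"
  define N' where "N' = N_loc n K (\<epsilon> / 4) c"
  have pos: "0 < c" "0 < c * \<epsilon>" using c \<epsilon> by auto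
  have N1: "1 \<le> N" "1 \<le> N'" unfolding N_def N'_def using pos \<epsilon> c by (auto intro!: N_loc_ge_1)
  have "k * \<epsilon>\<^sup>2 \<le> 2 * ln (N\<^sup>2)" using low False by (auto simp: N_def max_def split: if_splits)
  then have kN: "k * \<epsilon>\<^sup>2 \<le> 4 * ln N" using N1 by (simp add: ln_realpow)
  have "N \<le> N_loc n K (c * \<epsilon>) (c / 2) * N_loc n K (c * \<epsilon> / (c / 2)) (2 * 4)"
    using N_loc_submult[of "c * \<epsilon>" "c / 2" 4] pos by (simp add: N_def mult.commute)
  also have "\<dots> \<le> N' * N'"
  proof (rule mult_mono)
    have "\<epsilon> / 4 \<le> c * \<epsilon>" using c \<epsilon> by (simp add: field_simps)
    then show "N_loc n K (c * \<epsilon>) (c / 2) \<le> N'"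
      using N_loc_antimono_radius[of "\<epsilon> / 4" "c * \<epsilon>" "c / 2"] \<epsilon> pos by (simp add: N'_def)
    have "c * \<epsilon> / (c / 2) = 2 * \<epsilon>" using pos by simp
    then have "N_loc n K (c * \<epsilon> / (c / 2)) (2 * 4) \<le> N_loc n K (\<epsilon> / 4) 16"
      using N_loc_antimono_radius[of "\<epsilon> / 4" "2 * \<epsilon>" 8] \<epsilon> by simp
    also have "\<dots> \<le> N'" unfolding N'_def using c \<epsilon> by (intro N_loc_antimono_scale) auto
    finally show "N_loc n K (c * \<epsilon> / (c / 2)) (2 * 4) \<le> N'" .
    show "0 \<le> N_loc n K (c * \<epsilon> / (c / 2)) (2 * 4)"
      using N_loc_ge_1[of "2 * \<epsilon>" "2 * 4"] \<epsilon> pos by (simp add: mult.commute)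
  qed (use N1 in auto)
  finally have "ln N \<le> ln (N' * N')" using N1 by (subst ln_le_cancel_iff) auto
  also have "\<dots> = 2 * ln N'" using N1 by (simp add: ln_mult)
  finally have "k * \<epsilon>\<^sup>2 \<le> 8 * ln N'" using kN by simp
  moreover have "0 \<le> ln N'" using N1 by simp
  moreover have "(\<epsilon> / 4)\<^sup>2 * k = k * \<epsilon>\<^sup>2 / 16" by (simp add: power_divide)
  ultimately have "(\<epsilon> / 4)\<^sup>2 * k \<le> ln N'" by linarith
  then have "\<epsilon> / 4 \<in> eps_set c k" using \<epsilon> by (simp add: N'_def)
  then have "\<epsilon> / 4 \<le> eps_star n K c k" using c k by (intro eps_star_upper) auto
  then show ?thesis by simp
qed

end

context tree_estimator begin

lemma eps_level_radius: "eps_level n K C J = radius J / (C + 1)"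
  by (simp add: eps_level_def radius_def)

lemma radius_shift: "1 \<le> k \<Longrightarrow> radius k = 2 ^ j * radius (k + j)"
proof (induction j)
  case (Suc j)
  then show ?case using radius_Suc[of "k + j"] by simp
qed simp

text \<open>
Both sets are counted by packings of a ball of radius \<open>radius k\<close> at the scale
\<open>radius k / (2 c)\<close>.  The criterion for the stopping level bounds the local entropy only at the
radius \<open>\<rho> = c \<epsilon>\<close>, with the scale \<open>\<rho> / (2 c)\<close> for coverings.  Two steps of covering, at the radii
\<open>radius k\<close> and \<open>radius k / c\<close>, both at least \<open>\<rho>\<close>, reduce the former to the square of the latter.
\<close>

lemma local_counts:
  assumes k: "1 \<le> k" and \<theta>: "\<theta> \<in> K" and \<rho>: "0 < \<rho>" "c * \<rho> \<le> radius k" and c8: "8 \<le> 2 * c"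
  shows "real (card (near_nodes k \<theta>)) \<le> (N_loc n K \<rho> (2 * c))\<^sup>2"
    and "u \<in> level r E k \<Longrightarrow> real (card (offspring E k u)) \<le> (N_loc n K \<rho> (2 * c))\<^sup>2"
proof -
  have c: "0 < c" using c_ge by simp
  have R: "0 < radius k" using \<rho> c by (meson less_le_trans mult_pos_pos)
  have \<rho>R: "\<rho> \<le> radius k / c" using \<rho> c by (simp add: field_simps)
  have "\<rho> * 1 \<le> \<rho> * c" using \<rho> c_ge by (intro mult_left_mono) auto
  then have \<rho>R': "\<rho> \<le> radius k" using \<rho>(2) by (simp add: mult.commute)
  have N: "N_loc n K (radius k) c * N_loc n K (radius k / c) (2 * 2) \<le> (N_loc n K \<rho> (2 * c))\<^sup>2"
    unfolding power2_eq_square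
  proof (rule mult_mono)
    show "N_loc n K (radius k) c \<le> N_loc n K \<rho> (2 * c)" by (rule N_loc_antimono_radius[OF \<rho>(1) \<rho>R' c])
    have "N_loc n K (radius k / c) (2 * 2) \<le> N_loc n K \<rho> (2 * (2 * 2))"
      by (rule N_loc_antimono_radius[OF \<rho>(1) \<rho>R]) simp
    also have "\<dots> \<le> N_loc n K \<rho> (2 * c)" using c8 \<rho> by (intro N_loc_antimono_scale) auto
    finally show "N_loc n K (radius k / c) (2 * 2) \<le> N_loc n K \<rho> (2 * c)" .
    show "0 \<le> N_loc n K \<rho> (2 * c)" "0 \<le> N_loc n K (radius k / c) (2 * 2)"
      using N_loc_ge_1[of \<rho> "2 * c"] N_loc_ge_1[of "radius k / c" "2 * 2"] \<rho> R c by auto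
  qed
  have count: "real (card P) \<le> (N_loc n K \<rho> (2 * c))\<^sup>2"
    if "packing n (radius k / (2 * c)) (ball2 n v (radius k) \<inter> K) P" "v \<in> K" for v P
  proof -
    have "finite P \<and> real (card P) \<le> N_loc n K (radius k) c * N_loc n K (radius k / c) (2 * 2)"
      by (rule local_packing_submult[OF _ that(2) R c]) (use that(1) in \<open>simp_all add: mult.commute\<close>)
    then show ?thesis using N by simp
  qed
  show "real (card (near_nodes k \<theta>)) \<le> (N_loc n K \<rho> (2 * c))\<^sup>2"
  proof (rule count[OF _ \<theta>])
    have "near_nodes k \<theta> \<subseteq> ball2 n \<theta> (radius k) \<inter> K"
      using level_K[OF k] in_ball2 edist2_commute[of n \<theta>] by (auto simp: near_nodes_def)
    moreover have "near_nodes k \<theta> \<subseteq> level r E k" by (auto simp: near_nodes_def)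
    ultimately show "packing n (radius k / (2 * c)) (ball2 n \<theta> (radius k) \<inter> K) (near_nodes k \<theta>)"
      using packing_mono[OF level_packing[OF k]] unfolding packing_def by simp
  qed
  show "real (card (offspring E k u)) \<le> (N_loc n K \<rho> (2 * c))\<^sup>2" if u: "u \<in> level r E k"
  proof (rule offspring_structure[OF k u])
    fix P assume "packing n (radius k / (2 * c)) (ball2 n u (radius k) \<inter> K) P"
      "card (offspring E k u) \<le> card P"
    then show ?thesis using count[OF _ level_K[OF k u]] by fastforce
  qed
qed

text \<open>
Mistakes are charged only in the iterations \<open>1..k0\<close> with \<open>k0 = j - burn_in c\<close>; after them the
accuracy is already a constant multiple of \<open>e = \<epsilon>\<^sub>j\<close>.  In these iterations the
tolerance is at least \<open>2 e\<close>, so the entropy factor \<open>exp (\<kappa> e\<^sup>2)\<close> is absorbed by the failure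
exponent.
\<close>

lemma good_stop_risk:
  assumes d: "0 < diam" and k: "0 < k" "k \<le> rate_exponent"
    and good: "J_good n K C c k j" and J: "j \<le> J"
  shows "worst_risk n h T A K (out J) \<le> ennreal (stop_const c C * (eps_level n K C j)\<^sup>2)"
  unfolding worst_risk_def
proof (rule SUP_least)
  fix \<theta> assume \<theta>: "\<theta> \<in> K"
  define e where "e = eps_level n K C j"
  define m where "m = burn_in c"
  define k0 where "k0 = j - m"
  define \<rho> where "\<rho> = c * e"
  define N where "N = N_loc n K \<rho> (2 * c)"
  have j: "1 \<le> j" using good by (simp add: J_good_def)
  have C6: "6 \<le> C" by (rule C_ge)
  have c: "14 \<le> c" using C_c C6 by simp
  have e: "0 < e" using d C6 radius_pos by (simp add: e_def eps_level_radius)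
  have rj: "radius j = (C + 1) * e" using C6 by (simp add: e_def eps_level_radius)
  have N1: "1 \<le> N" unfolding N_def \<rho>_def using e c by (intro N_loc_ge_1) auto
  have goodN: "4 * ln N < k * e\<^sup>2" "ln 2 < k * e\<^sup>2"
    using good N1 by (auto simp: J_good_def e_def N_def \<rho>_def ln_realpow)
  have m2: "2 \<le> m" by (simp add: m_def burn_in_def)
  have cm: "c\<^sup>2 \<le> 2 ^ m" unfolding m_def by (rule le_two_power_burn_in)
  have low: "radius i = 2 ^ (j - i) * radius j" if "1 \<le> i" "i \<le> j" for i
    using radius_shift[OF that(1), of "j - i"] that by simp
  have big: "c * \<rho> \<le> radius i" if i: "1 \<le> i" "i \<le> k0" for i
  proof -
    have ij: "i \<le> j" "m \<le> j - i" using i by (auto simp: k0_def)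
    have "c * \<rho> = c\<^sup>2 * e" by (simp add: \<rho>_def power2_eq_square)
    also have "\<dots> \<le> 2 ^ (j - i) * ((C + 1) * e)"
    proof (rule mult_mono)
      have "(2::real) ^ m \<le> 2 ^ (j - i)" using ij(2) by (intro power_increasing) auto
      then show "c\<^sup>2 \<le> 2 ^ (j - i)" using cm by linarith
      show "e \<le> (C + 1) * e" using e C6 by (simp add: mult_le_cancel_right1)
    qed (use e in auto)
    finally show ?thesis using low[OF i(1) ij(1)] rj by simp
  qed
  have \<rho>: "0 < \<rho>" using c e by (simp add: \<rho>_def)
  have c8: "8 \<le> 2 * c" using c by simp
  have "(\<integral>\<^sup>+y. ennreal ((edist2 n (out J y) \<theta>)\<^sup>2) \<partial>sample n \<theta>) \<le>
    ennreal (25 * (radius (Suc k0))\<^sup>2 + (\<Sum>i=1..k0. 25 * (radius i)\<^sup>2 * ((N\<^sup>2)\<^sup>2 * exp (- (rate_exponent * (tol i)\<^sup>2)))))"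
    using local_counts[OF _ \<theta> \<rho> big c8] J
    by (intro risk_bound[OF d \<theta>]) (auto simp: k0_def N_def)
  also have "\<dots> \<le> ennreal (stop_const c C * e\<^sup>2)"
  proof (rule ennreal_leI)
    \<comment> \<open>For \<open>j \<le> m\<close> this still holds, with \<open>k0 = 0\<close> by truncated subtraction and an empty sum below.\<close>
    have first: "25 * (radius (Suc k0))\<^sup>2 \<le> 25 * (C + 1)\<^sup>2 * 4 ^ m * e\<^sup>2"
    proof -
      have le: "1 \<le> Suc k0" "Suc k0 \<le> j" using j m2 by (auto simp: k0_def)
      have "j - Suc k0 \<le> m" by (simp add: k0_def)
      then have "(2::real) ^ (j - Suc k0) \<le> 2 ^ m" by (intro power_increasing) auto
      then have "radius (Suc k0) \<le> 2 ^ m * ((C + 1) * e)"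
        unfolding low[OF le] rj using e C6 by (intro mult_right_mono) auto
      then have "(radius (Suc k0))\<^sup>2 \<le> (2 ^ m * ((C + 1) * e))\<^sup>2"
        using radius_nonneg by (intro power_mono) auto
      also have "\<dots> = 4 ^ m * (C + 1)\<^sup>2 * e\<^sup>2"
        by (simp add: power_mult_distrib power_mult[symmetric] mult.commute[of m] power_mult)
      finally show ?thesis by (simp add: mult_ac)
    qed
    have summand: "25 * (radius i)\<^sup>2 * ((N\<^sup>2)\<^sup>2 * exp (- (rate_exponent * (tol i)\<^sup>2)))
        \<le> 3200 * (C + 1)\<^sup>2 * e\<^sup>2 * (1 / 4) ^ (j - 1 - i)" if i: "i \<in> {1..k0}" for i
    proof -
      have i1: "1 \<le> i" "i \<le> j" "2 \<le> j - i" using i m2 by (auto simp: k0_def)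
      define t where "t = (tol i)\<^sup>2"
      define q where "q = j - 1 - i"
      have q: "j - i = Suc q" "1 \<le> q" using i1 by (auto simp: q_def)
      have "2 * (C + 1) * tol i = 2 ^ Suc q * ((C + 1) * e)"
        using low[OF i1(1,2)] rj tol_radius[of i] q by simp
      then have "(2 * (C + 1)) * tol i = (2 * (C + 1)) * (2 ^ q * e)" by (simp only: power_Suc mult_ac)
      moreover have "2 * (C + 1) \<noteq> 0" using C6 by simp
      ultimately have tol: "tol i = 2 ^ q * e" using mult_left_cancel by blast
      have t: "t = 4 ^ q * e\<^sup>2"
        unfolding t_def tol by (simp add: power_mult_distrib power_mult[symmetric] mult.commute[of q] power_mult)
      have "(4::real) ^ 1 \<le> 4 ^ q" using q(2) by (intro power_increasing) auto
      then have et: "4 * e\<^sup>2 \<le> t" unfolding t by (intro mult_right_mono) auto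
      have tpos: "0 < t" using et e by (smt (verit) zero_less_power)
      have "ln ((N\<^sup>2)\<^sup>2) = 4 * ln N" using N1 by (simp add: ln_realpow)
      then have "(N\<^sup>2)\<^sup>2 = exp (4 * ln N)" using N1 by (metis exp_ln less_le_trans zero_less_one zero_less_power)
      then have "(N\<^sup>2)\<^sup>2 * exp (- (rate_exponent * t)) = exp (4 * ln N - rate_exponent * t)"
        by (simp add: exp_diff exp_minus field_simps)
      also have "\<dots> \<le> exp (- (k * t / 2))"
      proof (subst exp_le_cancel_iff)
        have "k * t \<le> rate_exponent * t" using k tpos by (intro mult_right_mono) auto
        moreover have "k * (4 * e\<^sup>2) \<le> k * t" using k et by (intro mult_left_mono) auto
        moreover have "0 < k * t" using k tpos by simp
        ultimately show "4 * ln N - rate_exponent * t \<le> - (k * t / 2)" using goodN(1) by linarith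
      qed
      finally have prob: "(N\<^sup>2)\<^sup>2 * exp (- (rate_exponent * t)) \<le> exp (- (k * t / 2))" .
      have "1 / 2 \<le> ln (2::real)" using ln_le_minus_one[of "1 / 2 :: real"] by (simp add: ln_div)
      then have ke: "1 / 2 \<le> k * e\<^sup>2" using goodN(2) by simp
      have "1 / 4 \<le> (k * e\<^sup>2) * (k * e\<^sup>2)" using mult_mono[OF ke ke] k(1) by simp
      then have k2: "1 / (k\<^sup>2 * e\<^sup>2) \<le> 4 * e\<^sup>2" using k e by (simp add: power2_eq_square field_simps)
      have "25 * (radius i)\<^sup>2 * ((N\<^sup>2)\<^sup>2 * exp (- (rate_exponent * t))) \<le> 25 * (radius i)\<^sup>2 * exp (- (k * t / 2))"
        using prob by (intro mult_left_mono) auto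
      also have "\<dots> = 100 * (C + 1)\<^sup>2 * (t * exp (- (k * t / 2)))"
        unfolding tol_radius t_def power_mult_distrib by simp
      also have "\<dots> \<le> 100 * (C + 1)\<^sup>2 * (8 / (k\<^sup>2 * t))"
        using scaled_exp_le[OF tpos k(1)] by (intro mult_left_mono) auto
      also have "\<dots> = 800 * (C + 1)\<^sup>2 * (1 / 4) ^ q * (1 / (k\<^sup>2 * e\<^sup>2))"
        by (simp add: t power_one_over field_simps)
      also have "\<dots> \<le> 800 * (C + 1)\<^sup>2 * (1 / 4) ^ q * (4 * e\<^sup>2)"
        using k2 by (intro mult_left_mono) auto
      finally show ?thesis by (simp add: t_def q_def mult_ac)
    qed
    have "(\<Sum>i=1..k0. 25 * (radius i)\<^sup>2 * ((N\<^sup>2)\<^sup>2 * exp (- (rate_exponent * (tol i)\<^sup>2))))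
        \<le> (\<Sum>i=1..k0. 3200 * (C + 1)\<^sup>2 * e\<^sup>2 * (1 / 4) ^ (j - 1 - i))"
      by (rule sum_mono[OF summand])
    also have "\<dots> = 3200 * (C + 1)\<^sup>2 * e\<^sup>2 * (\<Sum>i=1..k0. (1 / 4) ^ (j - 1 - i))"
      by (simp add: sum_distrib_left)
    also have "\<dots> \<le> 3200 * (C + 1)\<^sup>2 * e\<^sup>2 * 2"
    proof (rule mult_left_mono)
      have "(\<Sum>i=1..k0. (1 / 4 :: real) ^ (j - 1 - i)) \<le> 4 / 3 * (1 / 4) ^ (j - 1 - k0)"
        using m2 by (intro geometric_tail_sum) (simp add: k0_def)
      also have "\<dots> \<le> 4 / 3 * 1" by (intro mult_left_mono power_le_one) auto
      finally show "(\<Sum>i=1..k0. (1 / 4 :: real) ^ (j - 1 - i)) \<le> 2" by simp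
    qed auto
    finally show "25 * (radius (Suc k0))\<^sup>2 + (\<Sum>i=1..k0. 25 * (radius i)\<^sup>2 * ((N\<^sup>2)\<^sup>2 * exp (- (rate_exponent * (tol i)\<^sup>2))))
      \<le> stop_const c C * e\<^sup>2"
      using first by (simp add: stop_const_def m_def algebra_simps)
  qed
  finally show "(\<integral>\<^sup>+y. ennreal ((edist2 n (out J y) \<theta>)\<^sup>2) \<partial>sample n \<theta>) \<le> ennreal (stop_const c C * (eps_level n K C j)\<^sup>2)"
    by (simp add: e_def)
qed

text \<open>
Since \<open>\<kappa> \<epsilon>\<^sub>J\<^sup>2 > ln 2\<close> fails for large \<open>J\<close>, the greatest good level exists.
\<close>

lemma J_star_maximal:
  assumes d: "0 < diam" and k: "0 < k" and ex: "\<exists>J. J_good n K C c k J"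
  shows "J_good n K C c k (J_star n K C c k)" "\<not> J_good n K C c k (Suc (J_star n K C c k))"
proof -
  have bound: "J \<le> nat \<lceil>k * diam\<^sup>2 / ln 2\<rceil> + 1" if good: "J_good n K C c k J" for J
  proof -
    let ?e = "eps_level n K C J"
    have "ln 2 < k * ?e\<^sup>2" using good by (simp add: J_good_def)
    also have "\<dots> \<le> k * (diam\<^sup>2 / 2 ^ (J - 1))"
    proof (intro mult_left_mono)
      have "?e\<^sup>2 = diam\<^sup>2 / (2 ^ (J - 1) * (2 ^ (J - 1) * (C + 1)\<^sup>2))"
        by (simp add: eps_level_def power_divide power_mult_distrib power2_eq_square mult_ac)
      also have "\<dots> \<le> diam\<^sup>2 / (2 ^ (J - 1) * 1)"
      proof (intro divide_left_mono mult_left_mono)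
        have "1 * 1 \<le> 2 ^ (J - 1) * (C + 1)\<^sup>2"
          using C_ge by (intro mult_mono one_le_power) auto
        then show "1 \<le> 2 ^ (J - 1) * (C + 1)\<^sup>2" by simp
      qed (use C_ge in auto)
      finally show "?e\<^sup>2 \<le> diam\<^sup>2 / 2 ^ (J - 1)" by simp
    qed (use k in auto)
    finally have "2 ^ (J - 1) < k * diam\<^sup>2 / ln 2" by (simp add: field_simps)
    moreover have "real (J - 1) < 2 ^ (J - 1)" by simp
    ultimately have "real (J - 1) < k * diam\<^sup>2 / ln 2" by linarith
    then show ?thesis by linarith
  qed
  obtain J where J: "J_good n K C c k J" using ex by blast
  have eq: "J_star n K C c k = (GREATEST J. J_good n K C c k J)" using ex by (simp add: J_star_def)
  show "J_good n K C c k (J_star n K C c k)"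
    unfolding eq using J bound by (rule GreatestI_nat)
  show "\<not> J_good n K C c k (Suc (J_star n K C c k))"
  proof
    assume "J_good n K C c k (Suc (J_star n K C c k))"
    then have "Suc (J_star n K C c k) \<le> (GREATEST J. J_good n K C c k J)"
      using bound by (rule Greatest_le_nat)
    then show False by (simp add: eq)
  qed
qed

lemma not_good_level:
  assumes d: "0 < diam" and k: "0 < k" and c: "16 \<le> c" and J: "1 \<le> J" and bad: "\<not> J_good n K C c k J"
  shows "eps_level n K C J \<le> 4 * eps_star n K c k"
proof (rule small_entropy_level[OF k c])
  have C6: "6 \<le> C" by (rule C_ge)
  show "0 < eps_level n K C J" using d C6 by (simp add: eps_level_def)
  have "diam / (2 ^ (J - 1) * (C + 1)) \<le> diam / (1 * 3)"
    using d C6 by (intro divide_left_mono mult_mono) auto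
  then show "eps_level n K C J \<le> diam / 3" by (simp add: eps_level_def)
  show "k * (eps_level n K C J)\<^sup>2 \<le> max (2 * ln ((N_loc n K (c * eps_level n K C J) (2 * c))\<^sup>2)) (ln 2)"
    using bad J unfolding J_good_def by linarith
qed

lemma tree_upper_bound:
  assumes k: "0 < k" "k \<le> rate_exponent" and c: "16 \<le> c" and J: "J_star n K C c k \<le> J"
  shows "worst_risk n h T A K (out J) \<le> ennreal (upper_const c C * min ((eps_star n K c k)\<^sup>2) (diam\<^sup>2))"
proof -
  define s where "s = eps_star n K c k"
  have s0: "0 \<le> s" unfolding s_def using c k by (intro eps_star_nonneg) auto
  have st: "0 \<le> stop_const c C" by (simp add: stop_const_def)
  have up: "1 \<le> upper_const c C" "64 * stop_const c C \<le> upper_const c C" "16 * (C + 1)\<^sup>2 \<le> upper_const c C"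
    using st by (auto simp: upper_const_def)
  have "worst_risk n h T A K (out J) \<le> ennreal (upper_const c C * s\<^sup>2)"
  proof (cases "diam = 0")
    case True
    then show ?thesis using trivial_risk[of J] by simp
  next
    case False
    then have d: "0 < diam" using diam2_nonneg by simp
    show ?thesis
    proof (cases "\<exists>J. J_good n K C c k J")
      case True
      define j where "j = J_star n K C c k"
      have j: "J_good n K C c k j" "\<not> J_good n K C c k (Suc j)"
        using J_star_maximal[OF d k(1) True] by (auto simp: j_def)
      then have j1: "1 \<le> j" by (simp add: J_good_def)
      have "eps_level n K C j = 2 * eps_level n K C (Suc j)"
        using radius_Suc[OF j1] by (simp add: eps_level_radius)
      also have "\<dots> \<le> 8 * s" using not_good_level[OF d k(1) c _ j(2)] by (simp add: s_def)
      finally have "(eps_level n K C j)\<^sup>2 \<le> (8 * s)\<^sup>2"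
        using radius_nonneg C_ge by (intro power_mono) (auto simp: eps_level_radius)
      then have "stop_const c C * (eps_level n K C j)\<^sup>2 \<le> stop_const c C * (64 * s\<^sup>2)"
        using st by (intro mult_left_mono) (auto simp: power_mult_distrib)
      also have "\<dots> \<le> upper_const c C * s\<^sup>2" using mult_right_mono[OF up(2), of "s\<^sup>2"] by simp
      finally show ?thesis
        using good_stop_risk[OF d k j(1)] J unfolding j_def[symmetric] by (meson ennreal_leI order_trans)
    next
      case False
      then have "eps_level n K C 1 \<le> 4 * s" using not_good_level[OF d k(1) c, of 1] by (simp add: s_def)
      then have "diam \<le> 4 * (C + 1) * s" using C_ge by (simp add: eps_level_def field_simps)
      then have "diam\<^sup>2 \<le> (4 * (C + 1) * s)\<^sup>2" using d by (intro power_mono) auto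
      also have "\<dots> = 16 * (C + 1)\<^sup>2 * s\<^sup>2" unfolding power_mult_distrib by simp
      also have "\<dots> \<le> upper_const c C * s\<^sup>2" using up(3) by (intro mult_right_mono) auto
      finally show ?thesis using trivial_risk[of J] by (meson ennreal_leI order_trans)
    qed
  qed
  moreover have "worst_risk n h T A K (out J) \<le> ennreal (upper_const c C * diam\<^sup>2)"
  proof -
    have "diam\<^sup>2 \<le> upper_const c C * diam\<^sup>2" using mult_right_mono[OF up(1), of "diam\<^sup>2"] by simp
    then show ?thesis using trivial_risk[of J] by (meson ennreal_leI order_trans)
  qed
  ultimately show ?thesis by (cases "s\<^sup>2 \<le> diam\<^sup>2") (auto simp: s_def min_def)
qed

end

text \<open>
The second lower bound on \<open>C\<close> keeps the difference in the second term of \<open>kappa\<close> away from zero.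
\<close>

lemma (in expfam_model) kappa_pos:
  assumes C: "max (2 * sqrt (curv_max A M / curv_min A M + 8)) (sqrt (2 * curv_max A M / curv_min A M) + 1) \<le> C"
  shows "0 < kappa A M C"
proof -
  have pos: "0 < curv_min A M" "0 < curv_max A M" "0 < curv_max A (2 * M)"
    using curv_min_pos curv_order by auto
  have "sqrt (2 * curv_max A M / curv_min A M) \<le> C - 1" using C by simp
  then have "(sqrt (2 * curv_max A M / curv_min A M))\<^sup>2 \<le> (C - 1)\<^sup>2"
    using pos by (intro power_mono) auto
  then have "2 * curv_max A M \<le> curv_min A M * (C - 1)\<^sup>2" using pos by (simp add: field_simps)
  then have gap: "0 < \<bar>curv_max A M - curv_min A M * (C - 1)\<^sup>2\<bar>" using pos by simp
  have "0 < curv_max A M / curv_min A M + 8" using pos by (simp add: add_pos_pos)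
  then have "0 < sqrt (curv_max A M / curv_min A M + 8)" by simp
  moreover have "2 * sqrt (curv_max A M / curv_min A M + 8) \<le> C" using C by simp
  ultimately have "0 < C" by linarith
  then show ?thesis using pos gap by (simp add: kappa_def)
qed

section \<open>The minimax rate\<close>

theorem theorem2p17:
  fixes A :: "real \<Rightarrow> real" and D :: "real set" and M C :: real
  assumes "open D" and "twice_cont_diff_on A D"
    and "M > 0" and "{-2 * M..2 * M} \<subseteq> D"
    and "C \<ge> max (2 * sqrt (curv_max A M / curv_min A M + 8))
                 (sqrt (2 * curv_max A M / curv_min A M) + 1)"
  shows "\<exists>c0. \<forall>c. c \<ge> 2 * (C + 1) \<and> c \<ge> c0 \<longrightarrow>
    (\<exists>a>0. \<exists>b>0. \<forall>h T n K.
      expfam h T A D \<and> n \<ge> 1 \<and> K \<subseteq> {..<n} \<rightarrow>\<^sub>E {-M..M} \<and> star_shaped n K \<longrightarrow>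
      (let rate = min ((eps_star n K c (kappa A M C))\<^sup>2) ((diam2 n K)\<^sup>2) in
        ennreal (a * rate) \<le> minimax_risk n h T A K \<and>
        minimax_risk n h T A K \<le> ennreal (b * rate) \<and>
        (\<forall>r E. pruned_tree n K c r E \<longrightarrow>
          (\<forall>J\<ge>J_star n K C c (kappa A M C).
            tree_output n T A K C r E J \<in> estimators n \<and>
            worst_risk n h T A K (tree_output n T A K C r E J) \<le> ennreal (b * rate)))))"
proof (rule exI[of _ 16], intro allI impI, goal_cases)
  case (1 c)
  \<comment> \<open>The threshold 16 is the one of \<open>small_entropy_level\<close>.\<close>
  then have c: "2 * (C + 1) \<le> c" "16 \<le> c" by auto
  show ?case
  proof (cases "\<exists>h T. expfam h T A D")
    case False
    \<comment> \<open>Without a family that generates \<open>A\<close> the curvature may vanish, but the claim is vacuous.\<close>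
    then show ?thesis by (intro exI[of _ 1] conjI) auto
  next
    case True
    then obtain h0 T0 where "expfam h0 T0 A D" by blast
    then interpret F: expfam_model h0 T0 A D M using assms by unfold_locales
    define k where "k = kappa A M C"
    have k: "0 < k" unfolding k_def by (rule F.kappa_pos[OF assms(5)])
    define a where "a = minimax_model.lower_const A M c k"
    define b where "b = upper_const c C"
    have b: "0 < b" by (simp add: b_def upper_const_def stop_const_def add_nonneg_pos)
    \<comment> \<open>
      The lower constant depends on \<open>A\<close>, \<open>M\<close>, \<open>c\<close> and \<open>k\<close> only, so its sign can be read off from the
      degenerate parameter set in dimension 0.
    \<close>
    have K0: "star_body 0 M {\<lambda>_. undefined}"
      by unfold_locales (auto simp: star_shaped_def)
    interpret G: minimax_model h0 T0 A D M 0 "{\<lambda>_. undefined}"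
      by (intro minimax_model.intro F.expfam_model_axioms K0)
    have a: "0 < a" unfolding a_def using c k by (intro G.lower_const_pos) auto
    have main: "ennreal (a * rate) \<le> minimax_risk n h T A K \<and>
        minimax_risk n h T A K \<le> ennreal (b * rate) \<and>
        (\<forall>r E. pruned_tree n K c r E \<longrightarrow>
          (\<forall>J\<ge>J_star n K C c k.
            tree_output n T A K C r E J \<in> estimators n \<and>
            worst_risk n h T A K (tree_output n T A K C r E J) \<le> ennreal (b * rate)))"
      if "expfam h T A D" "K \<subseteq> {..<n} \<rightarrow>\<^sub>E {-M..M}" "star_shaped n K"
        and rate: "rate = min ((eps_star n K c k)\<^sup>2) ((diam2 n K)\<^sup>2)" for h T n K rate
    proof -
      interpret expfam_model h T A D M using assms that(1) by unfold_locales
      interpret star_body n M K using that by unfold_locales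
      interpret minimax_model h T A D M n K by unfold_locales
      have tree: "tree_output n T A K C r E J \<in> estimators n \<and>
          worst_risk n h T A K (tree_output n T A K C r E J) \<le> ennreal (b * rate)"
        if "pruned_tree n K c r E" "J_star n K C c k \<le> J" for r E J
      proof -
        interpret tree_estimator h T A D M n K c r E C
          using that(1) assms(5) c by unfold_locales auto
        have "k \<le> rate_exponent" by (simp add: k_def kappa_def rate_exponent_def)
        then show ?thesis
          using out_estimator tree_upper_bound[OF k _ _ that(2)] c unfolding rate b_def by auto
      qed
      obtain E where E: "pruned_tree n K c centre E" using pruned_tree_exists[of c] c by auto
      have "minimax_risk n h T A K \<le> worst_risk n h T A K (tree_output n T A K C centre E (J_star n K C c k))"
        unfolding minimax_risk_def using tree[OF E order_refl] by (intro INF_lower) auto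
      also have "\<dots> \<le> ennreal (b * rate)" using tree[OF E order_refl] by auto
      finally show ?thesis
        using tree minimax_lower_bound[of c k] c k unfolding a_def rate by auto
    qed
    show ?thesis
      using a b main unfolding Let_def k_def[symmetric] by (intro exI[of _ a] conjI exI[of _ b] allI impI) auto
  qed
qed

end
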